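(* Let $n\ge2$. There exists a constant $c=c(n)>0$ such that the following holds. Let $\Omega$ be an open set in $\mathbb R^n$ with $|\Omega|<\infty$ and let $\phi$ be a Young function such that $\phi(1)>0$. Then $$\int_\Omega\phi_{0,n}\left(\frac{c\,|u(x)|}{\big(|\Omega|+\int_\Omega\phi(|\nabla u|)\,dy\big)^{1/n}}\right)dx\le\int_\Omega\phi(|\nabla u|)\,dx$$ for every $u\in W^{1,\phi}_0(\Omega)$.
   Context: A Young function is a left-continuous convex function $\phi:[0,\infty)\to[0,\infty]$ with $\phi(0)=0$, not constant in $(0,\infty)$. $|\Omega|$ is the Lebesgue measure of $\Omega$; $n'=\frac{n}{n-1}$; $\chi$ denotes characteristic functions. Given a Young function $\phi$ with $\phi(1)>0$, define, for $t\ge0$, $$K_n(t)=\chi_{[1,\infty)}(t)\Big(\int_1^t\Big(\frac{\tau}{\phi(\tau)}\Big)^{\frac1{n-1}}d\tau\Big)^{\frac1{n'}},\qquad \overline\phi_{0,n}(t)=\chi_{[1,\infty)}(t)\Big(\frac{\phi(K_n^{-1}(t-1))}{K_n^{-1}(t-1)}(t-1)\Big)^{n'},$$ where $K_n^{-1}:[0,\infty)\to[1,\infty]$ is the generalized right-continuous inverse of $K_n$ (so $K_n^{-1}(0)=1$), and $\overline\phi_{0,n}(t)$ is understood as $\infty$ where $t>1$ and $K_n^{-1}(t-1)=\infty$. The function $\overline\phi_{0,n}(t)/(t-1)$ is non-decreasing, and one sets $$\phi_{0,n}(t)=\int_0^t\frac{\overline\phi_{0,n}(\tau)}{\tau-1}\,d\tau$$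 (the integrand being $0$ for $\tau\leq 1$), a convex function. $L^\phi(\Omega)$ is the set of measurable $v:\Omega\to\mathbb R$ with $\int_\Omega\phi(|v|/\lambda)\,dx<\infty$ for some $\lambda>0$; $W^{1,\phi}(\Omega)$ is the set of weakly differentiable $v\in L^\phi(\Omega)$ with $|\nabla v|\in L^\phi(\Omega)$; $W^{1,\phi}_0(\Omega)$ is the set of $v\in W^{1,\phi}(\Omega)$ whose extension by $0$ to $\mathbb R^n\setminus\Omega$ is weakly differentiable in $\mathbb R^n$. If $\int_\Omega\phi(|\nabla u|)=\infty$ the inequality is trivially true. *)

theory Defs
  imports "HOL-Analysis.Analysis"
begin

text \<open>
  Functions \<open>[0,\<infinity>) \<rightarrow> [0,\<infinity>]\<close> are given the type \<open>real \<Rightarrow> ennreal\<close>; their values at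
  negative arguments are irrelevant.
\<close>

definition young_function :: "(real \<Rightarrow> ennreal) \<Rightarrow> bool" where
  "young_function \<phi> \<longleftrightarrow>
     \<phi> 0 = 0 \<and>
     (\<forall>x\<ge>0. \<forall>y\<ge>0. \<forall>s\<in>{0..1}.
        \<phi> ((1 - s) * x + s * y) \<le> ennreal (1 - s) * \<phi> x + ennreal s * \<phi> y) \<and>
     (\<forall>t>0. continuous (at_left t) \<phi>) \<and>
     \<not> (\<exists>a. \<forall>t>0. \<phi> t = a)"

text \<open>Power of an extended nonnegative real; only used with exponent \<open>p > 0\<close>.\<close>

definition epowr :: "ennreal \<Rightarrow> real \<Rightarrow> ennreal" where
  "epowr x p = (if x = \<infinity> then \<infinity> else ennreal (enn2real x powr p))"

subsection \<open>The function \<open>\<phi>\<^bsub>0,n\<^esub>\<close>\<close>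

text \<open>
  In \<open>ennreal\<close> one has \<open>\<tau> / \<infinity> = 0\<close>, so the integrand of \<open>K\<^sub>n\<close> vanishes where \<open>\<phi> = \<infinity>\<close>.
\<close>

definition young_K :: "nat \<Rightarrow> (real \<Rightarrow> ennreal) \<Rightarrow> real \<Rightarrow> ennreal" where
  "young_K n \<phi> t =
     (if 1 \<le> t
      then epowr (\<integral>\<^sup>+\<tau>\<in>{1..t}. epowr (ennreal \<tau> / \<phi> \<tau>) (1 / (real n - 1)) \<partial>lborel)
                 (1 / (real n / (real n - 1)))
      else 0)"

text \<open>
  Right-continuous generalized inverse \<open>s \<mapsto> inf {r. K\<^sub>n r > s}\<close>, with \<open>inf {} = \<infinity>\<close>. The value at
  \<open>0\<close> is fixed separately because the infimum is \<open>\<infinity>\<close> instead of \<open>1\<close> there if \<open>\<phi> = \<infinity>\<close> on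
  \<open>(1,\<infinity>)\<close>; in all other cases the infimum at \<open>0\<close> is \<open>1\<close>.
\<close>

definition young_K_inv :: "nat \<Rightarrow> (real \<Rightarrow> ennreal) \<Rightarrow> real \<Rightarrow> ennreal" where
  "young_K_inv n \<phi> s =
     (if s = 0 then 1 else (INF r\<in>{r. ennreal s < young_K n \<phi> r}. ennreal r))"

definition young_bar :: "nat \<Rightarrow> (real \<Rightarrow> ennreal) \<Rightarrow> real \<Rightarrow> ennreal" where
  "young_bar n \<phi> t =
     (if t < 1 then 0
      else if young_K_inv n \<phi> (t - 1) = \<infinity> then \<infinity>
      else epowr (\<phi> (enn2real (young_K_inv n \<phi> (t - 1))) / young_K_inv n \<phi> (t - 1)
                    * ennreal (t - 1))
                 (real n / (real n - 1)))"

definition young_0 :: "nat \<Rightarrow> (real \<Rightarrow> ennreal) \<Rightarrow> real \<Rightarrow> ennreal" where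
  "young_0 n \<phi> t =
     (\<integral>\<^sup>+\<tau>\<in>{0..t}. (if \<tau> \<le> 1 then 0 else young_bar n \<phi> \<tau> / ennreal (\<tau> - 1)) \<partial>lborel)"

subsection \<open>Weak gradients and Orlicz--Sobolev spaces\<close>

primrec C_times :: "nat \<Rightarrow> (real ^ 'n \<Rightarrow> real) \<Rightarrow> bool" where
  "C_times 0 f \<longleftrightarrow> continuous_on UNIV f"
| "C_times (Suc k) f \<longleftrightarrow>
     (\<forall>x. f differentiable (at x)) \<and>
     (\<forall>i. C_times k (\<lambda>x. frechet_derivative f (at x) (axis i 1)))"

definition test_function :: "(real ^ 'n) set \<Rightarrow> (real ^ 'n \<Rightarrow> real) \<Rightarrow> bool" where
  "test_function \<Omega> \<psi> \<longleftrightarrow>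
     (\<forall>k. C_times k \<psi>) \<and> compact (closure {x. \<psi> x \<noteq> 0}) \<and> closure {x. \<psi> x \<noteq> 0} \<subseteq> \<Omega>"

definition locally_integrable_on ::
    "(real ^ 'n \<Rightarrow> 'b::euclidean_space) \<Rightarrow> (real ^ 'n) set \<Rightarrow> bool" where
  "locally_integrable_on f \<Omega> \<longleftrightarrow>
     (\<forall>C. compact C \<and> C \<subseteq> \<Omega> \<longrightarrow> f absolutely_integrable_on C)"

text \<open>\<open>g\<close> is a representative of the weak gradient of \<open>u\<close>, which is unique up to null sets.\<close>

definition weak_gradient ::
    "(real ^ 'n) set \<Rightarrow> (real ^ 'n \<Rightarrow> real) \<Rightarrow> (real ^ 'n \<Rightarrow> real ^ 'n) \<Rightarrow> bool" where
  "weak_gradient \<Omega> u g \<longleftrightarrow>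
     locally_integrable_on u \<Omega> \<and> locally_integrable_on g \<Omega> \<and>
     (\<forall>\<psi> i. test_function \<Omega> \<psi> \<longrightarrow>
        (\<integral>x. u x * frechet_derivative \<psi> (at x) (axis i 1) \<partial>lebesgue_on \<Omega>)
          = - (\<integral>x. g x $ i * \<psi> x \<partial>lebesgue_on \<Omega>))"

definition orlicz :: "(real \<Rightarrow> ennreal) \<Rightarrow> (real ^ 'n) set \<Rightarrow> (real ^ 'n \<Rightarrow> real) set" where
  "orlicz \<phi> \<Omega> =
     {v. v \<in> borel_measurable (lebesgue_on \<Omega>) \<and>
         (\<exists>l>0. (\<integral>\<^sup>+x. \<phi> (\<bar>v x\<bar> / l) \<partial>lebesgue_on \<Omega>) < \<infinity>)}"

definition orlicz_sobolev ::
    "(real \<Rightarrow> ennreal) \<Rightarrow> (real ^ 'n) set \<Rightarrow> (real ^ 'n \<Rightarrow> real) set" where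
  "orlicz_sobolev \<phi> \<Omega> =
     {v \<in> orlicz \<phi> \<Omega>. \<exists>g. weak_gradient \<Omega> v g \<and> (\<lambda>x. norm (g x)) \<in> orlicz \<phi> \<Omega>}"

definition orlicz_sobolev_0 ::
    "(real \<Rightarrow> ennreal) \<Rightarrow> (real ^ 'n) set \<Rightarrow> (real ^ 'n \<Rightarrow> real) set" where
  "orlicz_sobolev_0 \<phi> \<Omega> =
     {v \<in> orlicz_sobolev \<phi> \<Omega>.
        \<exists>g. weak_gradient UNIV (\<lambda>x. if x \<in> \<Omega> then v x else 0) g}"

text \<open>
  \<open>\<integral>\<^sub>\<Omega> \<phi>(|\<nabla>u|)\<close> when \<open>g\<close> is a weak gradient of \<open>u\<close>. Applying \<open>enn2real\<close> to it is harmless in an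
  inequality whose right-hand side is the energy itself, which holds trivially for energy \<open>\<infinity>\<close>.
\<close>

definition young_energy ::
    "(real \<Rightarrow> ennreal) \<Rightarrow> (real ^ 'n) set \<Rightarrow> (real ^ 'n \<Rightarrow> real ^ 'n) \<Rightarrow> ennreal" where
  "young_energy \<phi> \<Omega> g = (\<integral>\<^sup>+x. \<phi> (norm (g x)) \<partial>lebesgue_on \<Omega>)"

end

theory Submission
  imports Defs
begin

text \<open>
  Let \<open>U\<close> be the extension of \<open>u\<close> by zero, \<open>G\<close> its gradient, and \<open>M\<^sup>n = |\<Omega>| + \<integral>\<phi>(|\<nabla>u|)\<close>. Testing the weak
  gradient against translated test functions gives \<open>U (x + h) - U x = \<integral>\<^sub>0\<^sup>1 G (x + s h) \<bullet> h ds\<close> for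
  almost every \<open>x\<close>, so almost every segment from \<open>{|U| \<ge> b}\<close> to \<open>{|U| \<le> a}\<close> carries at least the mass
  \<open>b - a\<close> of \<open>H = |G|\<close> restricted to the shell \<open>{a < |U| < b}\<close>. Averaging over all segments in a large
  ball bounds \<open>(b - a) |S|\<close>, \<open>S = {|U| \<ge> b}\<close>, by the integral over \<open>S\<close> of the Riesz potential of \<open>H\<close>.

  Cut \<open>H\<close> at height \<open>r\<close>. By Hoelder's inequality on the layers of \<open>H\<close>, the potential of \<open>min H r\<close> is at
  most a constant times \<open>M (1 + K\<^sub>n r)\<close>; the excess \<open>(H - r)\<^sup>+\<close> has integral at most \<open>r / \<phi> r\<close> times
  the energy of the shell, and its potential has integral at most a constant times
  \<open>|S|\<^bsup>1/n\<^esup>\<close> times that over \<open>S\<close>. With dyadic levels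
  \<open>b = 2\<^sup>j M / c\<close>, \<open>a = b / 2\<close> and \<open>r = K\<^sub>n\<^sup>-\<^sup>1 (2\<^bsup>j+1\<^esup> - 1)\<close> the first part is
  absorbed, and the remaining inequality says that \<open>young_bar (2\<^bsup>j+1\<^esup>) |S|\<close> is at most the energy of
  the shell. The shells are disjoint, so summing over \<open>j\<close> proves the claim. Because every shell stays
  away from \<open>{U = 0}\<close>, the gradient of the extension outside \<open>\<Omega>\<close> plays no role.
\<close>

subsection \<open>Smooth bumps and the fundamental lemma of the calculus of variations\<close>

text \<open>A Young function may take the value infinity and need not be doubling, so smooth
  functions need not be dense in the norm; the argument therefore works with the weakly
  differentiable \<open>U\<close> itself and never approximates it.

  \<open>M\<close> combines measure and energy because both enter. The layers of the gradient below
  height 1, about which \<open>young_K\<close> says nothing, are controlled by the measure of the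
  support. The energy controls the layers above height 1, and it also removes the exponent n' =
  n/(n-1) of \<open>young_bar\<close> at the end: if a shell has energy e \<le> M^n, then (e/M)^n'
  \<le> e.

  The constant is c = 1/(24 C), where C is the product of the constants of the crossing estimate and
  of the kernel estimate. For b = 12 C (s + 1) M and a = b/2 the low part of the potential
  contributes at most 3 C s M |S|, which is at most half of (b - a) |S|; the choice s + 1 = 2^(j+1)
  turns 12 into 24. Dyadic levels suffice because \<open>young_0\<close> at t is at most
  \<open>young_bar\<close> at t, so on each dyadic interval it is bounded by the value of
  \<open>young_bar\<close> at the right end.\<close>

definition exp_tail :: "nat \<Rightarrow> real \<Rightarrow> real" where
  "exp_tail k t = (if t > 0 then exp (- (1 / t)) / t ^ k else 0)"

lemma exp_tail_tendsto_0: "(exp_tail k \<longlongrightarrow> 0) (at 0)"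
proof -
  have "((\<lambda>y::real. y ^ k / exp y) \<longlongrightarrow> 0) at_top"
    by (rule tendsto_power_div_exp_0)
  then have "((\<lambda>t::real. inverse t ^ k / exp (inverse t)) \<longlongrightarrow> 0) (at_right 0)"
    by (rule filterlim_compose[OF _ filterlim_inverse_at_top_right])
  moreover have "eventually (\<lambda>t::real. inverse t ^ k / exp (inverse t) = exp_tail k t) (at_right 0)"
    by (auto simp: eventually_at_right_field exp_tail_def exp_minus field_simps intro: exI[of _ 1])
  ultimately have 1: "(exp_tail k \<longlongrightarrow> 0) (at_right 0)"
    by (rule Lim_transform_eventually)
  have "eventually (\<lambda>t::real. 0 = exp_tail k t) (at_left 0)"
    by (auto simp: eventually_at_left_field exp_tail_def intro: exI[of _ "-1"])
  then have 2: "(exp_tail k \<longlongrightarrow> 0) (at_left 0)"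
    by (rule Lim_transform_eventually[OF tendsto_const])
  show ?thesis using 1 2 by (simp add: filterlim_split_at_real)
qed

text \<open>The powers of t in the denominator are there to close the family under differentiation.
  At t = 0 the difference quotient of \<open>exp_tail k\<close> is \<open>exp_tail (Suc k)\<close>,
  which tends to 0.\<close>

lemma exp_tail_has_field_derivative:
  "(exp_tail k has_field_derivative (exp_tail (k + 2) t - real k * exp_tail (k + 1) t)) (at t)"
proof -
  consider "t > 0" | "t < 0" | "t = 0" by linarith
  then show ?thesis
  proof cases
    case 1
    have "((\<lambda>t. exp (- (1 / t)) / t ^ k) has_field_derivative
        (exp (- (1 / t)) * (1 / (t * t)) * t ^ k - exp (- (1 / t)) * (real k * t ^ (k - 1)))
          / (t ^ k * t ^ k)) (at t)"
      using 1 by (auto intro!: derivative_eq_intros)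
    also have "(exp (- (1 / t)) * (1 / (t * t)) * t ^ k - exp (- (1 / t)) * (real k * t ^ (k - 1)))
          / (t ^ k * t ^ k) = exp_tail (k + 2) t - real k * exp_tail (k + 1) t"
      using 1 by (cases k) (auto simp: exp_tail_def field_simps power2_eq_square)
    finally have "((\<lambda>t. exp (- (1 / t)) / t ^ k) has_field_derivative
        (exp_tail (k + 2) t - real k * exp_tail (k + 1) t)) (at t)" .
    then show ?thesis
      by (rule DERIV_cong_ev[THEN iffD1, rotated 3])
         (use 1 eventually_nhds_in_open[of "{0<..}" t] in \<open>auto simp: exp_tail_def elim!: eventually_mono\<close>)
  next
    case 2
    have "((\<lambda>t. 0) has_field_derivative (0::real)) (at t)" by simp
    moreover have "eventually (\<lambda>x. 0 = exp_tail k x) (nhds t)"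
      using 2 eventually_nhds_in_open[of "{..<0}" t] by (auto simp: exp_tail_def elim!: eventually_mono)
    ultimately show ?thesis
      using 2 DERIV_cong_ev[of t t "\<lambda>t. 0" "exp_tail k" 0] by (simp add: exp_tail_def)
  next
    case 3
    have "eventually (\<lambda>h. exp_tail (Suc k) h = (exp_tail k (0 + h) - exp_tail k 0) / h) (at 0)"
      by (auto simp: exp_tail_def field_simps eventually_at_filter)
    then have "((\<lambda>h. (exp_tail k (0 + h) - exp_tail k 0) / h) \<longlongrightarrow> 0) (at 0)"
      by (rule Lim_transform_eventually[OF exp_tail_tendsto_0])
    then show ?thesis using 3 by (simp add: DERIV_def exp_tail_def)
  qed
qed

text \<open>Besides sums and products the class is closed under partial derivatives, by the
  derivative formula for \<open>exp_tail\<close>; hence \<open>C_times k\<close> follows for all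
  \<open>k\<close> by induction. The affine argument covers dilated, reflected and translated
  tails.\<close>

inductive bump_alg :: "(real ^ 'n \<Rightarrow> real) \<Rightarrow> bool" where
  const: "bump_alg (\<lambda>x. c)"
| tail: "bump_alg (\<lambda>x. exp_tail k (c * x $ i + d))"
| add: "bump_alg f \<Longrightarrow> bump_alg g \<Longrightarrow> bump_alg (\<lambda>x. f x + g x)"
| mult: "bump_alg f \<Longrightarrow> bump_alg g \<Longrightarrow> bump_alg (\<lambda>x. f x * g x)"

lemma bump_alg_prod:
  "finite I \<Longrightarrow> (\<And>i. i \<in> I \<Longrightarrow> bump_alg (f i)) \<Longrightarrow> bump_alg (\<lambda>x. \<Prod>i\<in>I. f i x)"
  by (induction I rule: finite_induct) (auto intro: bump_alg.intros)

lemma bump_alg_derivative: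
  fixes f :: "real ^ 'n \<Rightarrow> real"
  assumes "bump_alg f"
  shows "(\<forall>x. f differentiable (at x)) \<and>
    (\<forall>j. bump_alg (\<lambda>x. frechet_derivative f (at x) (axis j 1)))"
  using assms
proof induction
  case (const c)
  then show ?case by (auto intro: bump_alg.intros simp: frechet_derivative_const)
next
  case (tail k c i d)
  have der: "((\<lambda>x::real^'n. exp_tail k (c * x $ i + d)) has_derivative
      (\<lambda>h. (exp_tail (k + 2) (c * x $ i + d) - real k * exp_tail (k + 1) (c * x $ i + d)) * (c * h $ i)))
      (at x)" for x
  proof -
    have a: "((\<lambda>x::real^'n. c * x $ i + d) has_derivative (\<lambda>h. c * h $ i)) (at x)"
      by (auto intro!: derivative_eq_intros bounded_linear.has_derivative[OF bounded_linear_vec_nth])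
    show ?thesis
      using has_derivative_compose[OF a, of "exp_tail k"] exp_tail_has_field_derivative
      unfolding has_field_derivative_def by blast
  qed
  have "bump_alg (\<lambda>x::real^'n. (exp_tail (k + 2) (c * x $ i + d) +
      (- real k) * exp_tail (k + 1) (c * x $ i + d)) * (c * axis j 1 $ i))" for j
    by (intro bump_alg.intros)
  then show ?case
    using der frechet_derivative_at[OF der, symmetric] by (auto simp: differentiable_def)
next
  case (add f g)
  have der: "((\<lambda>x. f x + g x) has_derivative (\<lambda>h. frechet_derivative f (at x) h + frechet_derivative g (at x) h)) (at x)" for x
    using add by (intro has_derivative_add) (auto simp: frechet_derivative_works)
  show ?case
    using add der frechet_derivative_at[OF der, symmetric]
    by (auto simp: differentiable_def intro: bump_alg.intros)
next
  case (mult f g)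
  have der: "((\<lambda>x. f x * g x) has_derivative (\<lambda>h. f x * frechet_derivative g (at x) h + frechet_derivative f (at x) h * g x)) (at x)" for x
    using mult by (intro has_derivative_mult) (auto simp: frechet_derivative_works)
  have "bump_alg (\<lambda>x. f x * frechet_derivative g (at x) (axis j 1) +
      frechet_derivative f (at x) (axis j 1) * g x)" for j
    using mult by (intro bump_alg.add bump_alg.mult) auto
  then show ?case
    using der frechet_derivative_at[OF der, symmetric] by (auto simp: differentiable_def)
qed

lemma bump_alg_imp_C_times: "bump_alg f \<Longrightarrow> C_times k f"
proof (induction k arbitrary: f)
  case 0
  then show ?case
    using bump_alg_derivative[of f]
    by (auto intro!: differentiable_imp_continuous_on simp: differentiable_on_def)
next
  case (Suc k)
  then show ?case using bump_alg_derivative[of f] by auto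
qed

text \<open>A product of one-dimensional bumps whose support is fixed by the box. The parameter
  \<open>m\<close> only sharpens the profile: as it grows, exp (-1/(m t)) tends to 1 for every t >
  0.\<close>

definition box_bump :: "real \<Rightarrow> real ^ 'n \<Rightarrow> real ^ 'n \<Rightarrow> real ^ 'n \<Rightarrow> real" where
  "box_bump m a b x = (\<Prod>i\<in>UNIV. exp_tail 0 (m * (x $ i - a $ i)) * exp_tail 0 (m * (b $ i - x $ i)))"

lemma bump_alg_box_bump: "bump_alg (box_bump m a (b :: real ^ 'n))"
proof -
  have "bump_alg (\<lambda>x::real^'n. \<Prod>i\<in>UNIV. exp_tail 0 (m * x $ i + (- m * a $ i)) * exp_tail 0 ((- m) * x $ i + m * b $ i))"
    by (intro bump_alg_prod bump_alg.intros) auto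
  then show ?thesis by (simp add: box_bump_def[abs_def] algebra_simps)
qed

lemma exp_tail_0_bounds: "0 \<le> exp_tail 0 t" "exp_tail 0 t \<le> 1"
  by (auto simp: exp_tail_def)

lemma box_bump_bounds: "0 \<le> box_bump m a b x" "box_bump m a b x \<le> 1"
  unfolding box_bump_def
  by (auto intro!: prod_nonneg prod_le_1 mult_le_one simp: exp_tail_0_bounds)

lemma box_bump_eq_0:
  assumes "m > 0" "x \<notin> box a b"
  shows "box_bump m a b x = 0"
proof -
  obtain i where "x $ i \<le> a $ i \<or> b $ i \<le> x $ i"
    using assms by (auto simp: mem_box_cart not_less)
  then have "exp_tail 0 (m * (x $ i - a $ i)) * exp_tail 0 (m * (b $ i - x $ i)) = 0"
    using assms(1) by (auto simp: exp_tail_def zero_less_mult_iff)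
  then show ?thesis unfolding box_bump_def
    by (intro prod_zero) auto
qed

lemma test_function_box_bump:
  assumes "m > 0" "cbox a b \<subseteq> \<Omega>"
  shows "test_function \<Omega> (box_bump m a b)"
proof -
  have "{x. box_bump m a b x \<noteq> 0} \<subseteq> cbox a b"
    using box_bump_eq_0[OF assms(1)] box_subset_cbox by blast
  then have *: "closure {x. box_bump m a b x \<noteq> 0} \<subseteq> cbox a b"
    by (intro closure_minimal closed_cbox)
  then have "compact (closure {x. box_bump m a b x \<noteq> 0})"
    by (meson bounded_cbox bounded_subset closed_closure compact_eq_bounded_closed)
  then show ?thesis
    using * assms(2) bump_alg_imp_C_times[OF bump_alg_box_bump] by (auto simp: test_function_def)
qed

lemma box_bump_tendsto_indicator:
  "(\<lambda>m. box_bump (real (Suc m)) a b x) \<longlonglongrightarrow> indicator (box a b) x"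
proof (cases "x \<in> box a b")
  case True
  have lim: "(\<lambda>m. exp_tail 0 (real (Suc m) * t)) \<longlonglongrightarrow> 1" if "t > 0" for t
  proof -
    have "(\<lambda>m. exp (- (1 / t * (1 / real (Suc m))))) \<longlonglongrightarrow> exp (- (1 / t * 0))"
      by (intro tendsto_intros LIMSEQ_Suc lim_1_over_n)
    then show ?thesis using that by (simp add: exp_tail_def mult.commute)
  qed
  have "(\<lambda>m. box_bump (real (Suc m)) a b x) \<longlonglongrightarrow> (\<Prod>i\<in>(UNIV::'a set). 1 * 1)"
    unfolding box_bump_def using True
    by (intro tendsto_prod tendsto_mult lim) (auto simp: mem_box_cart)
  then show ?thesis using True by simp
next
  case False
  then show ?thesis by (simp add: box_bump_eq_0 del: of_nat_Suc)
qed

text \<open>Lebesgue differentiation: for almost every \<open>x\<close> the averages over the cubes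
  with lower corner \<open>x\<close> and side \<open>h\<close> tend to \<open>F x\<close>, and here
  all of them vanish.\<close>

lemma box_integrals_zero_imp_AE_zero:
  fixes F :: "'a::euclidean_space \<Rightarrow> real"
  assumes int: "\<And>a b. F absolutely_integrable_on cbox a b"
    and zero: "\<And>a b. integral (cbox a b) F = 0"
  shows "AE x in lebesgue. F x = 0"
proof -
  have "\<And>a b. F integrable_on cbox a b"
    using int set_lebesgue_integral_eq_integral(1) by blast
  then obtain N where N: "negligible N"
    and *: "\<And>x e. \<lbrakk>x \<notin> N; 0 < e\<rbrakk> \<Longrightarrow> \<exists>d>0. \<forall>h. 0 < h \<and> h < d \<longrightarrow>
        norm (integral (cbox x (x + h *\<^sub>R One)) F /\<^sub>R h ^ DIM('a) - F x) < e"
    by (rule integrable_ccontinuous_explicit) blast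
  have "F x = 0" if xN: "x \<notin> N" for x
  proof (rule ccontr)
    assume "F x \<noteq> 0"
    then obtain d where "d > 0" "\<And>h. 0 < h \<Longrightarrow> h < d \<Longrightarrow>
        norm (integral (cbox x (x + h *\<^sub>R One)) F /\<^sub>R h ^ DIM('a) - F x) < \<bar>F x\<bar>"
      using *[OF xN, of "\<bar>F x\<bar>"] by auto
    from this(2)[of "d / 2"] this(1) show False by (simp add: zero)
  qed
  then show ?thesis
    using N by (intro AE_I'[of N]) (auto simp: negligible_iff_null_sets)
qed

lemma test_function_zero_outside:
  assumes "test_function \<Omega> \<psi>" "x \<notin> \<Omega>"
  shows "\<psi> x = 0"
  using assms closure_subset[of "{x. \<psi> x \<noteq> 0}"] by (auto simp: test_function_def)

lemma test_function_derivative_zero_outside: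
  assumes \<psi>: "test_function \<Omega> \<psi>" "x \<notin> \<Omega>"
  shows "frechet_derivative \<psi> (at x) h = 0"
proof -
  let ?S = "closure {x. \<psi> x \<noteq> 0}"
  have x: "x \<in> - ?S" using assms by (auto simp: test_function_def)
  have "((\<lambda>_. 0) has_derivative (\<lambda>_. 0)) (at x)" by simp
  then have "(\<psi> has_derivative (\<lambda>_. 0)) (at x)"
    by (rule has_derivative_transform_within_open[OF _ _ x])
       (use closure_subset[of "{x. \<psi> x \<noteq> 0}"] in auto)
  then have "frechet_derivative \<psi> (at x) = (\<lambda>_. 0)" by (rule frechet_derivative_at[symmetric])
  then show ?thesis by simp
qed

lemma test_function_mono: "test_function \<Omega> \<psi> \<Longrightarrow> \<Omega> \<subseteq> \<Omega>' \<Longrightarrow> test_function \<Omega>' \<psi>"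
  by (auto simp: test_function_def)

lemma integral_lebesgue_on_UNIV:
  assumes "\<And>x. x \<notin> S \<Longrightarrow> f x = (0::real)" "S \<in> sets lebesgue"
  shows "(\<integral>x. f x \<partial>lebesgue_on S) = (\<integral>x. f x \<partial>lebesgue)"
  using assms by (subst integral_restrict_space) (auto intro!: Bochner_Integration.integral_cong simp: indicator_def)

text \<open>By dominated convergence the bumps \<open>box_bump\<close> with growing parameter
  replace the test function by the indicator of a box, so the integral of \<open>F\<close> over
  every box in \<open>\<Omega>\<close> is 0. Then \<open>F\<close> vanishes almost everywhere in
  each such box, and countably many of them cover the open set.\<close>

lemma test_integrals_zero_imp_AE_zero:
  fixes F :: "real ^ 'n \<Rightarrow> real"
  assumes "open \<Omega>" and int: "locally_integrable_on F \<Omega>"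
    and zero: "\<And>\<psi>. test_function \<Omega> \<psi> \<Longrightarrow> (\<integral>x. F x * \<psi> x \<partial>lebesgue_on \<Omega>) = 0"
  shows "AE x in lebesgue. x \<in> \<Omega> \<longrightarrow> F x = 0"
proof -
  have sets: "\<Omega> \<in> sets lebesgue" using assms(1) by auto
  have abs: "F absolutely_integrable_on cbox a b" if "cbox a b \<subseteq> \<Omega>" for a b
    using int that by (auto simp: locally_integrable_on_def)
  have box0: "integral (cbox a b) F = 0" if sub: "cbox a b \<subseteq> \<Omega>" for a b
  proof -
    have integ: "integrable lebesgue (\<lambda>x. indicat_real (cbox a b) x * F x)"
      using abs[OF sub] by (simp add: set_integrable_def)
    let ?B = "\<lambda>m. box_bump (real (Suc m)) a b"
    have B0: "F x * ?B m x = indicat_real (cbox a b) x * F x * ?B m x" for m x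
      using box_bump_eq_0[of "real (Suc m)" x a b] box_subset_cbox[of a b]
      by (auto simp: indicator_def)
    have Z: "(\<integral>x. indicat_real (cbox a b) x * F x * ?B m x \<partial>lebesgue) = 0" for m
    proof -
      have "test_function \<Omega> (?B m)" using sub by (intro test_function_box_bump) auto
      then have "(\<integral>x. F x * ?B m x \<partial>lebesgue) = 0"
        using zero[of "?B m"] integral_lebesgue_on_UNIV[of \<Omega> "\<lambda>x. F x * ?B m x"] sets test_function_zero_outside
        by fastforce
      then show ?thesis by (simp only: B0)
    qed
    have meas: "?B m \<in> borel_measurable lebesgue" for m
    proof -
      have "continuous_on UNIV (?B m)"
        using bump_alg_imp_C_times[OF bump_alg_box_bump, of 0] by simp
      then show ?thesis
        by (intro measurable_completion) (simp add: borel_measurable_continuous_onI)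
    qed
    have "(\<lambda>m. \<integral>x. indicat_real (cbox a b) x * F x * ?B m x \<partial>lebesgue)
        \<longlonglongrightarrow> (\<integral>x. indicat_real (cbox a b) x * F x * indicator (box a b) x \<partial>lebesgue)"
    proof (rule integral_dominated_convergence[where w="\<lambda>x. \<bar>indicat_real (cbox a b) x * F x\<bar>"])
      show "AE x in lebesgue. norm (indicat_real (cbox a b) x * F x * ?B m x) \<le> \<bar>indicat_real (cbox a b) x * F x\<bar>" for m
        using box_bump_bounds[of "real (Suc m)" a b]
        by (auto simp: abs_mult intro!: mult_left_le AE_I2)
      show "AE x in lebesgue. (\<lambda>m. indicat_real (cbox a b) x * F x * ?B m x)
          \<longlonglongrightarrow> indicat_real (cbox a b) x * F x * indicator (box a b) x"
        by (intro AE_I2 tendsto_intros box_bump_tendsto_indicator)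
      show "(\<lambda>x. indicat_real (cbox a b) x * F x * indicat_real (box a b) x) \<in> borel_measurable lebesgue"
        by (rule borel_measurable_times[OF borel_measurable_integrable[OF integ]])
           (auto intro!: borel_measurable_indicator)
      show "(\<lambda>x. indicat_real (cbox a b) x * F x * ?B m x) \<in> borel_measurable lebesgue" for m
        by (rule borel_measurable_times[OF borel_measurable_integrable[OF integ] meas])
    qed (use integ in auto)
    then have "(\<integral>x. indicat_real (cbox a b) x * F x * indicator (box a b) x \<partial>lebesgue) = 0"
      using Z LIMSEQ_unique[OF _ tendsto_const] by (simp add: LIMSEQ_const_iff)
    moreover have "(\<integral>x. indicat_real (cbox a b) x * F x * indicator (box a b) x \<partial>lebesgue)
        = (\<integral>x. indicat_real (box a b) x * F x \<partial>lebesgue)"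
      using box_subset_cbox[of a b] by (intro Bochner_Integration.integral_cong) (auto simp: indicator_def)
    moreover have "F absolutely_integrable_on box a b"
      using abs[OF sub] by (simp add: absolutely_integrable_on_open_interval)
    ultimately have "integral (box a b) F = 0"
      using set_lebesgue_integral_eq_integral(2)[of "box a b" F]
      by (simp add: set_lebesgue_integral_def)
    then show ?thesis by (simp add: integral_open_interval)
  qed
  have local: "AE x in lebesgue. x \<in> cbox a b \<longrightarrow> F x = 0" if sub: "cbox a b \<subseteq> \<Omega>" for a b
  proof -
    \<comment> \<open>Cutting \<open>F\<close> off outside the box makes it a function on the whole
      space; its integral over another box is an integral over the intersection, which is again a
      box inside \<open>\<Omega>\<close>.\<close>
    have "AE x in lebesgue. (if x \<in> cbox a b then F x else 0) = 0"
    proof (rule box_integrals_zero_imp_AE_zero)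
      fix c d
      obtain e f where ef: "cbox a b \<inter> cbox c d = cbox e f"
        using Int_interval[of a b c d] by blast
      have "cbox e f \<subseteq> \<Omega>" using ef sub by blast
      then show "integral (cbox c d) (\<lambda>x. if x \<in> cbox a b then F x else 0) = 0"
        using box0[of e f] integral_restrict_Int[of "cbox c d" "cbox a b" F] ef by (simp add: Int_commute)
      have "F absolutely_integrable_on cbox e f" using abs \<open>cbox e f \<subseteq> \<Omega>\<close> by blast
      then show "(\<lambda>x. if x \<in> cbox a b then F x else 0) absolutely_integrable_on cbox c d"
        unfolding ef[symmetric] set_integrable_def
        by (rule Bochner_Integration.integrable_cong[THEN iffD1, rotated 2]) (auto simp: indicator_def)
    qed
    then show ?thesis by (rule AE_mp) (auto intro!: AE_I2)
  qed
  obtain \<D> where D: "countable \<D>" "\<D> \<subseteq> Pow \<Omega>" "\<And>X. X \<in> \<D> \<Longrightarrow> \<exists>a b. X = cbox a b" "\<Union>\<D> = \<Omega>"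
    using open_countable_Union_open_cbox[OF assms(1)] by metis
  have "AE x in lebesgue. \<forall>X\<in>\<D>. x \<in> X \<longrightarrow> F x = 0"
  proof (subst AE_ball_countable[OF D(1)], rule ballI)
    fix X assume "X \<in> \<D>"
    then obtain a b where "X = cbox a b" "cbox a b \<subseteq> \<Omega>"
      using D(2,3) by blast
    then show "AE x in lebesgue. x \<in> X \<longrightarrow> F x = 0"
      using local by simp
  qed
  then show ?thesis by (rule AE_mp) (use D(4) in \<open>auto intro!: AE_I2\<close>)
qed

section \<open>Translates of test functions\<close>

lemma has_derivative_translate:
  assumes "f differentiable (at (x - v))"
  shows "((\<lambda>x. f (x - v)) has_derivative frechet_derivative f (at (x - v))) (at x)"
proof -
  have "((\<lambda>x. x - v) has_derivative (\<lambda>h. h)) (at x)" by (auto intro!: derivative_eq_intros)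
  moreover have "(f has_derivative frechet_derivative f (at (x - v))) (at (x - v))"
    using assms by (simp add: frechet_derivative_works[symmetric])
  ultimately show ?thesis using has_derivative_compose by blast
qed

lemma C_times_translate:
  fixes f :: "real ^ 'n \<Rightarrow> real"
  assumes "C_times k f" shows "C_times k (\<lambda>x. f (x - v))"
  using assms
proof (induction k arbitrary: f)
  case 0
  then show ?case by (auto intro!: continuous_on_compose2[of UNIV f] continuous_intros)
next
  case (Suc k)
  have der: "((\<lambda>x. f (x - v)) has_derivative frechet_derivative f (at (x - v))) (at x)" for x
    using Suc.prems by (intro has_derivative_translate) simp
  have "C_times k (\<lambda>x. frechet_derivative f (at (x - v)) (axis i 1))" for i
    using Suc.IH[of "\<lambda>x. frechet_derivative f (at x) (axis i 1)"] Suc.prems by simp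
  with frechet_derivative_at[OF der, symmetric] der show ?case
    by (auto simp: differentiable_def)
qed

lemma test_function_translate:
  fixes \<psi> :: "real ^ 'n \<Rightarrow> real"
  assumes "test_function UNIV \<psi>" shows "test_function UNIV (\<lambda>x. \<psi> (x - v))"
proof -
  have "{x. \<psi> (x - v) \<noteq> 0} = (+) v ` {x. \<psi> x \<noteq> 0}"
    by (force simp: image_iff intro: exI[of _ "_ - v"])
  then have "closure {x. \<psi> (x - v) \<noteq> 0} = (+) v ` closure {x. \<psi> x \<noteq> 0}"
    by (simp add: closure_translation)
  then show ?thesis
    using assms C_times_translate[of _ \<psi> v]
    by (auto simp: test_function_def simp del: compact_closure intro: compact_translation)
qed

subsection \<open>Increments of weakly differentiable functions along lines\<close>

lemma nn_integral_lborel_translate: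
  fixes f :: "'a::euclidean_space \<Rightarrow> ennreal"
  assumes [measurable]: "f \<in> borel_measurable borel"
  shows "(\<integral>\<^sup>+x. f (x + c) \<partial>lborel) = (\<integral>\<^sup>+x. f x \<partial>lborel)"
proof -
  have "(\<integral>\<^sup>+x. f x \<partial>lborel) = (\<integral>\<^sup>+x. f x \<partial>distr lborel borel ((+) c))"
    by (simp add: lborel_distr_plus)
  also have "\<dots> = (\<integral>\<^sup>+x. f (c + x) \<partial>lborel)"
    by (rule nn_integral_distr) auto
  finally show ?thesis by (simp add: add.commute)
qed

lemma lborel_integral_translate:
  fixes f :: "'a::euclidean_space \<Rightarrow> real"
  assumes [measurable]: "f \<in> borel_measurable borel"
  shows "(\<integral>x. f (x + c) \<partial>lborel) = (\<integral>x. f x \<partial>lborel)"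
proof -
  have "(\<integral>x. f x \<partial>lborel) = (\<integral>x. f x \<partial>distr lborel borel ((+) c))"
    by (simp add: lborel_distr_plus)
  also have "\<dots> = (\<integral>x. f (c + x) \<partial>lborel)"
    by (rule integral_distr) auto
  finally show ?thesis by (simp add: add.commute)
qed

lemma set_integrable_lborel_imp_locally_integrable_on:
  fixes F :: "real ^ 'n \<Rightarrow> real"
  assumes "\<And>a b. set_integrable lborel (cbox a b) F"
  shows "locally_integrable_on F UNIV"
  unfolding locally_integrable_on_def
proof (intro allI impI)
  fix C :: "(real ^ 'n) set" assume C: "compact C \<and> C \<subseteq> UNIV"
  then obtain a b where "C \<subseteq> cbox a b"
    using bounded_subset_cbox_symmetric compact_imp_bounded by metis
  moreover have "F absolutely_integrable_on cbox a b"
    using assms[of a b] unfolding set_integrable_def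
    by (subst integrable_completion) auto
  moreover have "C \<in> sets lebesgue" using C compact_imp_closed[of C] by simp
  ultimately show "F absolutely_integrable_on C"
    by (intro set_integrable_subset[of lebesgue "cbox a b" F C])
qed

lemma C_times_continuous: "C_times k f \<Longrightarrow> continuous_on UNIV f"
  by (cases k) (auto intro!: differentiable_imp_continuous_on simp: differentiable_on_def)

lemma frechet_derivative_axis_sum:
  fixes f :: "real ^ 'n \<Rightarrow> real"
  assumes "f differentiable (at x)"
  shows "frechet_derivative f (at x) h = (\<Sum>i\<in>UNIV. h $ i * frechet_derivative f (at x) (axis i 1))"
proof -
  have lin: "linear (frechet_derivative f (at x))"
    using assms by (rule linear_frechet_derivative)
  have "frechet_derivative f (at x) h = frechet_derivative f (at x) (\<Sum>i\<in>UNIV. (h $ i) *\<^sub>R axis i 1)"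
    by (simp add: basis_expansion scalar_mult_eq_scaleR[symmetric])
  also have "\<dots> = (\<Sum>i\<in>UNIV. h $ i * frechet_derivative f (at x) (axis i 1))"
    by (simp add: linear_sum[OF lin] linear_scale[OF lin])
  finally show ?thesis .
qed

lemma
  fixes \<psi> :: "real ^ 'n \<Rightarrow> real"
  assumes \<psi>: "test_function UNIV \<psi>"
  shows test_function_differentiable: "\<psi> differentiable (at x)"
    and test_function_continuous: "continuous_on UNIV \<psi>"
    and test_function_derivative_continuous: "continuous_on UNIV (\<lambda>x. frechet_derivative \<psi> (at x) h)"
proof -
  have C: "C_times (Suc 0) \<psi>" using \<psi> unfolding test_function_def by blast
  then have 1: "\<psi> differentiable (at x)" for x by simp
  show "\<psi> differentiable (at x)" by (rule 1)
  show "continuous_on UNIV \<psi>" using C by (rule C_times_continuous)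
  have 2: "continuous_on UNIV (\<lambda>x. frechet_derivative \<psi> (at x) (axis i 1))" for i
    using C by simp
  have "continuous_on UNIV (\<lambda>x. \<Sum>i\<in>UNIV. h $ i * frechet_derivative \<psi> (at x) (axis i 1))"
    by (intro continuous_intros 2)
  then show "continuous_on UNIV (\<lambda>x. frechet_derivative \<psi> (at x) h)"
    by (simp add: frechet_derivative_axis_sum[OF 1, symmetric])
qed

lemma continuous_vanishing_bounded:
  fixes f :: "'a::euclidean_space \<Rightarrow> real"
  assumes "continuous_on UNIV f" "\<And>x. x \<notin> cbox a b \<Longrightarrow> f x = 0"
  obtains C where "C > 0" "\<And>x. \<bar>f x\<bar> \<le> C * indicator (cbox a b) x"
proof -
  have "bounded (f ` cbox a b)"
    using assms(1) by (intro compact_imp_bounded compact_continuous_image) (auto intro: continuous_on_subset)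
  then obtain C where "C > 0" "\<forall>x\<in>f ` cbox a b. norm x \<le> C"
    using bounded_pos by blast
  then show thesis using assms(2) by (intro that[of C]) (auto simp: indicator_def)
qed

lemma test_function_obtain_box:
  fixes \<psi> :: "real ^ 'n \<Rightarrow> real"
  assumes \<psi>: "test_function UNIV \<psi>"
  obtains a b where "\<And>x. x \<notin> cbox a b \<Longrightarrow> \<psi> x = 0"
    "\<And>x h. x \<notin> cbox a b \<Longrightarrow> frechet_derivative \<psi> (at x) h = 0"
proof -
  have "bounded (closure {x. \<psi> x \<noteq> 0})"
    using \<psi> by (intro compact_imp_bounded) (simp add: test_function_def)
  then obtain a where "closure {x. \<psi> x \<noteq> 0} \<subseteq> cbox (-a) a"
    using bounded_subset_cbox_symmetric by metis
  then have "test_function (cbox (-a) a) \<psi>"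
    using \<psi> by (simp add: test_function_def)
  then show thesis
    using that test_function_zero_outside test_function_derivative_zero_outside by blast
qed

text \<open>By Tonelli, a bounded factor with compact support reduces integrability on the product
  space to local integrability of \<open>Q\<close>. This is what allows the integrals in
  \<open>x\<close> and \<open>s\<close> to be exchanged later.\<close>

lemma integrable_dominated_product:
  fixes Q :: "'a::euclidean_space \<Rightarrow> real" and \<kappa> :: "'a \<times> real \<Rightarrow> real"
  assumes [measurable]: "Q \<in> borel_measurable borel" "\<kappa> \<in> borel_measurable borel"
    and Q: "set_integrable lborel (cbox a b) Q" and C: "0 \<le> C"
    and \<kappa>: "\<And>x s. \<bar>\<kappa> (x, s)\<bar> \<le> C * (indicator (cbox a b) x * indicator {0..1::real} s)"
  shows "integrable (lborel \<Otimes>\<^sub>M lborel) (\<lambda>(x, s). Q x * \<kappa> (x, s))"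
proof -
  have [measurable]: "\<kappa> \<in> borel_measurable (lborel \<Otimes>\<^sub>M lborel)"
    by (simp add: lborel_prod)
  have le: "ennreal (norm (Q x * \<kappa> (x, s))) \<le> ennreal (C * norm (indicator (cbox a b) x *\<^sub>R Q x)) * indicator {0..1::real} s" for x s
  proof -
    have "\<bar>Q x\<bar> * \<bar>\<kappa> (x, s)\<bar> \<le> \<bar>Q x\<bar> * (C * (indicator (cbox a b) x * indicator {0..1::real} s))"
      using \<kappa> by (intro mult_left_mono) auto
    then show ?thesis
      by (cases "x \<in> cbox a b \<and> s \<in> {0..1}")
         (auto simp: abs_mult[symmetric] mult.commute mult.left_commute intro!: ennreal_leI)
  qed
  have "(\<integral>\<^sup>+z. ennreal (norm (case z of (x, s) \<Rightarrow> Q x * \<kappa> (x, s))) \<partial>(lborel \<Otimes>\<^sub>M lborel))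
    = (\<integral>\<^sup>+x. \<integral>\<^sup>+s. ennreal (norm (Q x * \<kappa> (x, s))) \<partial>lborel \<partial>lborel)"
    by (subst lborel.nn_integral_fst[symmetric]) auto
  also have "\<dots> \<le> (\<integral>\<^sup>+x. \<integral>\<^sup>+s. ennreal (C * norm (indicator (cbox a b) x *\<^sub>R Q x)) * indicator {0..1::real} s \<partial>lborel \<partial>lborel)"
    by (intro nn_integral_mono le)
  also have "\<dots> = (\<integral>\<^sup>+x. ennreal (C * norm (indicator (cbox a b) x *\<^sub>R Q x)) \<partial>lborel)"
    by (simp add: nn_integral_cmult_indicator)
  also have "\<dots> = ennreal C * (\<integral>\<^sup>+x. norm (indicator (cbox a b) x *\<^sub>R Q x) \<partial>lborel)"
    using C by (subst nn_integral_cmult[symmetric]) (auto simp: ennreal_mult)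
  also have "\<dots> < \<infinity>"
    using Q unfolding set_integrable_def integrable_iff_bounded by (auto simp: ennreal_mult_less_top)
  finally show ?thesis
    by (intro integrableI_bounded) auto
qed

text \<open>The points \<open>x + s *\<^sub>R h\<close> with \<open>x\<close> in a box and
  \<open>s\<close> in [0,1] form a compact set, so a single larger box contains the supports of all
  the translates.\<close>

lemma integrable_translates_product:
  fixes Q :: "'a::euclidean_space \<Rightarrow> real" and \<psi> :: "'a \<Rightarrow> real"
  assumes Q_meas[measurable]: "Q \<in> borel_measurable borel" and \<psi>_meas[measurable]: "\<psi> \<in> borel_measurable borel"
    and Q: "\<And>a b. set_integrable lborel (cbox a b) Q" and C: "0 \<le> C"
    and \<psi>: "\<And>x. \<bar>\<psi> x\<bar> \<le> C * indicator (cbox a b) x"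
  shows "integrable (lborel \<Otimes>\<^sub>M lborel) (\<lambda>(y, s). Q y * (indicator {0..1::real} s * \<psi> (y - s *\<^sub>R h)))"
proof -
  have "bounded ((\<lambda>(x, s). x + s *\<^sub>R h) ` (cbox a b \<times> {0..1::real}))"
    by (intro compact_imp_bounded compact_continuous_image compact_Times)
       (auto simp: case_prod_beta intro!: continuous_intros)
  then obtain c where c: "(\<lambda>(x, s). x + s *\<^sub>R h) ` (cbox a b \<times> {0..1::real}) \<subseteq> cbox (-c) c"
    using bounded_subset_cbox_symmetric by metis
  have m: "(\<lambda>z. indicator {0..1} (snd z) * \<psi> (fst z - snd z *\<^sub>R h)) \<in> borel_measurable borel"
    by (simp only: borel_prod[symmetric]) measurable
  have "\<bar>indicator {0..1::real} s * \<psi> (y - s *\<^sub>R h)\<bar> \<le> C * (indicator (cbox (-c) c) y * indicator {0..1::real} s)" for y s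
  proof (cases "s \<in> {0..1} \<and> y - s *\<^sub>R h \<in> cbox a b")
    case True
    then have "y \<in> cbox (-c) c" using c by force
    with True \<psi>[of "y - s *\<^sub>R h"] show ?thesis by simp
  next
    case False
    with False \<psi>[of "y - s *\<^sub>R h"] C show ?thesis by (auto simp: indicator_def split: if_splits)
  qed
  then show ?thesis
    using integrable_dominated_product[OF Q_meas m Q[of "-c" c] C] by simp
qed

text \<open>For fixed \<open>s\<close> the substitution y = x + s h moves the translation from
  \<open>Q\<close> to \<open>\<psi>\<close>, so by Tonelli the integral of the norm is the one of
  the preceding lemma.\<close>

lemma integrable_product_of_translates:
  fixes Q :: "'a::euclidean_space \<Rightarrow> real" and \<psi> :: "'a \<Rightarrow> real"
  assumes Q_meas[measurable]: "Q \<in> borel_measurable borel" and \<psi>_meas[measurable]: "\<psi> \<in> borel_measurable borel"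
    and Q: "\<And>a b. set_integrable lborel (cbox a b) Q" and C: "0 \<le> C"
    and \<psi>: "\<And>x. \<bar>\<psi> x\<bar> \<le> C * indicator (cbox a b) x"
  shows "integrable (lborel \<Otimes>\<^sub>M lborel) (\<lambda>(x, s). indicator {0..1::real} s * Q (x + s *\<^sub>R h) * \<psi> x)"
proof -
  have "integrable (lborel \<Otimes>\<^sub>M lborel) (\<lambda>(y, s). Q y * (indicator {0..1::real} s * \<psi> (y - s *\<^sub>R h)))"
    by (rule integrable_translates_product[OF Q_meas \<psi>_meas Q C \<psi>])
  then have fin: "(\<integral>\<^sup>+z. ennreal (norm (case z of (y, s) \<Rightarrow> Q y * (indicator {0..1::real} s * \<psi> (y - s *\<^sub>R h)))) \<partial>(lborel \<Otimes>\<^sub>M lborel)) < \<infinity>"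
    by (simp add: integrable_iff_bounded)
  have "(\<integral>\<^sup>+z. ennreal (norm (case z of (x, s) \<Rightarrow> indicator {0..1::real} s * Q (x + s *\<^sub>R h) * \<psi> x)) \<partial>(lborel \<Otimes>\<^sub>M lborel))
    = (\<integral>\<^sup>+s. \<integral>\<^sup>+x. ennreal (norm (indicator {0..1::real} s * Q (x + s *\<^sub>R h) * \<psi> x)) \<partial>lborel \<partial>lborel)"
    by (subst lborel_pair.nn_integral_snd[symmetric]) auto
  also have "\<dots> = (\<integral>\<^sup>+s. \<integral>\<^sup>+y. ennreal (norm (Q y * (indicator {0..1::real} s * \<psi> (y - s *\<^sub>R h)))) \<partial>lborel \<partial>lborel)"
  proof (rule nn_integral_cong)
    fix s :: real
    show "(\<integral>\<^sup>+x. ennreal (norm (indicator {0..1::real} s * Q (x + s *\<^sub>R h) * \<psi> x)) \<partial>lborel)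
      = (\<integral>\<^sup>+y. ennreal (norm (Q y * (indicator {0..1::real} s * \<psi> (y - s *\<^sub>R h)))) \<partial>lborel)"
      by (subst (2) nn_integral_lborel_translate[symmetric, where c="s *\<^sub>R h"]) (auto simp: ac_simps)
  qed
  also have "\<dots> = (\<integral>\<^sup>+z. ennreal (norm (case z of (y, s) \<Rightarrow> Q y * (indicator {0..1::real} s * \<psi> (y - s *\<^sub>R h)))) \<partial>(lborel \<Otimes>\<^sub>M lborel))"
    by (subst lborel_pair.nn_integral_snd[symmetric]) auto
  finally show ?thesis
    using fin by (intro integrableI_bounded) auto
qed

lemma integrable_mult_continuous:
  fixes Q f :: "'a::euclidean_space \<Rightarrow> real"
  assumes [measurable]: "Q \<in> borel_measurable borel"
    and Q: "\<And>a b. set_integrable lborel (cbox a b) Q"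
    and f: "continuous_on UNIV f" "\<And>x. x \<notin> cbox a b \<Longrightarrow> f x = 0"
  shows "integrable lborel (\<lambda>x. Q x * f x)"
proof -
  have [measurable]: "f \<in> borel_measurable borel"
    using f(1) by (rule borel_measurable_continuous_onI)
  obtain C where C: "C > 0" "\<And>x. \<bar>f x\<bar> \<le> C * indicator (cbox a b) x"
    using continuous_vanishing_bounded[OF f] by blast
  have "integrable lborel (\<lambda>x. C * (indicator (cbox a b) x *\<^sub>R Q x))"
    using Q[of a b] unfolding set_integrable_def by (rule integrable_mult_right)
  then show ?thesis
  proof (rule Bochner_Integration.integrable_bound)
    show "AE x in lborel. norm (Q x * f x) \<le> norm (C * (indicat_real (cbox a b) x *\<^sub>R Q x))"
    proof (rule AE_I2)
      fix x
      have "\<bar>Q x\<bar> * \<bar>f x\<bar> \<le> \<bar>Q x\<bar> * (C * indicator (cbox a b) x)"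
        using C by (intro mult_left_mono) auto
      then show "norm (Q x * f x) \<le> norm (C * (indicat_real (cbox a b) x *\<^sub>R Q x))"
        using C(1) by (simp add: abs_mult ac_simps)
    qed
  qed simp
qed

text \<open>Borel functions and \<open>lborel\<close> are used because compositions such as
  \<open>G (x + s *\<^sub>R h)\<close> must be measurable in the pair (x, s) for Fubini, and a
  composition with a merely Lebesgue measurable function need not be. Borel representatives of the
  given functions are constructed at the end.\<close>

locale borel_weak_gradient =
  fixes U :: "real ^ 'n \<Rightarrow> real" and G :: "real ^ 'n \<Rightarrow> real ^ 'n"
  assumes U_borel [measurable]: "U \<in> borel_measurable borel"
    and G_borel [measurable]: "G \<in> borel_measurable borel"
    and U_integrable: "\<And>a b. set_integrable lborel (cbox a b) U"
    and G_integrable: "\<And>a b. set_integrable lborel (cbox a b) G"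
    and weak: "\<And>\<psi> i. test_function UNIV \<psi> \<Longrightarrow>
      (\<integral>x. U x * frechet_derivative \<psi> (at x) (axis i 1) \<partial>lborel) = - (\<integral>x. G x $ i * \<psi> x \<partial>lborel)"
begin

lemma G_inner_integrable: "set_integrable lborel (cbox a b) (\<lambda>x. G x \<bullet> h)"
  using integrable_inner_left[OF G_integrable[of a b, unfolded set_integrable_def], of h]
  unfolding set_integrable_def by (simp add: inner_scaleR_left)

lemma weak_directional:
  assumes \<psi>: "test_function UNIV \<psi>"
  shows "(\<integral>x. U x * frechet_derivative \<psi> (at x) h \<partial>lborel) = - (\<integral>x. (G x \<bullet> h) * \<psi> x \<partial>lborel)"
proof -
  obtain a b where ab: "\<And>x. x \<notin> cbox a b \<Longrightarrow> \<psi> x = 0"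
    "\<And>x h. x \<notin> cbox a b \<Longrightarrow> frechet_derivative \<psi> (at x) h = 0"
    using test_function_obtain_box[OF \<psi>] by metis
  have iU: "integrable lborel (\<lambda>x. U x * frechet_derivative \<psi> (at x) (axis i 1))" for i
    by (rule integrable_mult_continuous[OF U_borel U_integrable test_function_derivative_continuous[OF \<psi>] ab(2)])
  have iG: "integrable lborel (\<lambda>x. (G x $ i) * \<psi> x)" for i
  proof (rule integrable_mult_continuous[OF _ _ test_function_continuous[OF \<psi>] ab(1)])
    have "(\<lambda>x. G x \<bullet> axis i 1) \<in> borel_measurable borel" by measurable
    then show "(\<lambda>x. G x $ i) \<in> borel_measurable borel" by (simp add: inner_axis)
    show "set_integrable lborel (cbox a b) (\<lambda>x. G x $ i)" for a b
      using G_inner_integrable[of a b "axis i 1"] by (simp add: inner_axis)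
  qed
  have "(\<integral>x. U x * frechet_derivative \<psi> (at x) h \<partial>lborel)
      = (\<integral>x. (\<Sum>i\<in>UNIV. h $ i * (U x * frechet_derivative \<psi> (at x) (axis i 1))) \<partial>lborel)"
    by (simp add: frechet_derivative_axis_sum[OF test_function_differentiable[OF \<psi>], of _ h] sum_distrib_left ac_simps)
  also have "\<dots> = (\<Sum>i\<in>UNIV. h $ i * (\<integral>x. U x * frechet_derivative \<psi> (at x) (axis i 1) \<partial>lborel))"
    using iU by (subst Bochner_Integration.integral_sum) auto
  also have "\<dots> = - (\<Sum>i\<in>UNIV. h $ i * (\<integral>x. G x $ i * \<psi> x \<partial>lborel))"
    by (simp add: weak[OF \<psi>] sum_negf)
  also have "(\<Sum>i\<in>UNIV. h $ i * (\<integral>x. G x $ i * \<psi> x \<partial>lborel)) = (\<integral>x. (\<Sum>i\<in>UNIV. h $ i * (G x $ i * \<psi> x)) \<partial>lborel)"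
    using iG by (subst Bochner_Integration.integral_sum) auto
  also have "\<dots> = (\<integral>x. (G x \<bullet> h) * \<psi> x \<partial>lborel)"
    by (simp add: inner_vec_def sum_distrib_right sum_distrib_left ac_simps)
  finally show ?thesis .
qed

lemma line_integrand_integrable:
  "integrable (lborel \<Otimes>\<^sub>M lborel) (\<lambda>(x, s). indicator {0..1} s * (G (x + s *\<^sub>R h) \<bullet> h) * indicator (cbox a b) x)"
  by (rule integrable_product_of_translates[where Q="\<lambda>x. G x \<bullet> h" and C=1])
     (auto simp: G_inner_integrable)

text \<open>Fubini yields integrability along segments only for \<open>x\<close> confined to a box,
  since \<open>G\<close> is only locally integrable; countably many boxes exhaust the space.\<close>

lemma AE_line_integrable:
  "AE x in lborel. integrable lborel (\<lambda>s. indicator {0..1} s * (G (x + s *\<^sub>R h) \<bullet> h))"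
proof -
  have "AE x in lborel. \<forall>N::nat. x \<in> cbox (- (real N *\<^sub>R One)) (real N *\<^sub>R One) \<longrightarrow>
      integrable lborel (\<lambda>s. indicator {0..1} s * (G (x + s *\<^sub>R h) \<bullet> h))"
  proof (subst AE_all_countable, rule allI)
    fix N :: nat
    let ?B = "cbox (- (real N *\<^sub>R One)) (real N *\<^sub>R One) :: (real ^ 'n) set"
    have "AE x in lborel. integrable lborel (\<lambda>s. indicator {0..1} s * (G (x + s *\<^sub>R h) \<bullet> h) * indicator ?B x)"
      by (rule lborel_pair.AE_integrable_fst[OF line_integrand_integrable])
    then show "AE x in lborel. x \<in> ?B \<longrightarrow> integrable lborel (\<lambda>s. indicator {0..1} s * (G (x + s *\<^sub>R h) \<bullet> h))"
      by (rule AE_mp) (auto intro!: AE_I2)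
  qed
  then show ?thesis
  proof (rule AE_mp, intro AE_I2 impI)
    fix x :: "real ^ 'n"
    assume *: "\<forall>N::nat. x \<in> cbox (- (real N *\<^sub>R One)) (real N *\<^sub>R One) \<longrightarrow>
      integrable lborel (\<lambda>s. indicator {0..1} s * (G (x + s *\<^sub>R h) \<bullet> h))"
    obtain N :: nat where N: "norm x \<le> real N" using real_arch_simple by blast
    have "x \<in> cbox (- (real N *\<^sub>R One)) (real N *\<^sub>R One)"
      using order_trans[OF Basis_le_norm N]
      by (force simp: mem_box abs_le_iff inner_minus_left minus_le_iff)
    with * show "integrable lborel (\<lambda>s. indicator {0..1} s * (G (x + s *\<^sub>R h) \<bullet> h))" by blast
  qed
qed

text \<open>The difference \<open>F\<close> of the two sides is tested against
  \<open>\<psi>\<close>. The increment \<psi> x - \<psi> (x - h) is the integral over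
  \<open>s\<close> of \<open>D (x - s *\<^sub>R h)\<close>, and for each \<open>s\<close> this is
  the derivative along \<open>h\<close> of a translated test function, to which the weak identity
  applies. Fubini in both directions and the substitution x + h for x show that \<open>F\<close> has
  vanishing test integrals.\<close>

lemma increment_eq_line_integral:
  "AE x in lborel. U (x + h) - U x = (\<integral>s. indicator {0..1} s * (G (x + s *\<^sub>R h) \<bullet> h) \<partial>lborel)"
proof -
  define I where "I = (\<lambda>x. \<integral>s. indicator {0..1} s * (G (x + s *\<^sub>R h) \<bullet> h) \<partial>lborel)"
  define F where "F = (\<lambda>x. U (x + h) - U x - I x)"
  have [measurable]: "I \<in> borel_measurable borel"
    unfolding I_def by measurable
  have [measurable]: "F \<in> borel_measurable borel"
    unfolding F_def by measurable
  have U_shift: "set_integrable lborel (cbox a b) (\<lambda>x. U (x + h))" for a b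
  proof -
    have "integrable (distr lborel borel ((+) h)) (\<lambda>x. indicator (cbox (a + h) (b + h)) x *\<^sub>R U x)"
      using U_integrable[of "a + h" "b + h"] by (simp add: lborel_distr_plus set_integrable_def)
    then have "integrable lborel (\<lambda>x. indicator (cbox (a + h) (b + h)) (h + x) *\<^sub>R U (h + x))"
      by (subst (asm) integrable_distr_eq) auto
    moreover have "indicator (cbox (a + h) (b + h)) (h + x) = (indicator (cbox a b) x :: real)" for x
      by (auto simp: indicator_def mem_box inner_add_left)
    ultimately show ?thesis by (simp add: set_integrable_def add.commute)
  qed
  have I_loc: "set_integrable lborel (cbox a b) I" for a b
    using lborel_pair.integrable_fst[OF line_integrand_integrable[of h a b]]
    unfolding set_integrable_def I_def by (simp add: mult.commute)
  have F_loc: "set_integrable lborel (cbox a b) F" for a b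
    unfolding F_def by (intro set_integral_diff U_shift U_integrable I_loc)
  have F_zero: "(\<integral>x. F x * \<psi> x \<partial>lborel) = 0" if \<psi>: "test_function UNIV \<psi>" for \<psi>
  proof -
    obtain a b where ab: "\<And>x. x \<notin> cbox a b \<Longrightarrow> \<psi> x = 0"
      "\<And>x h. x \<notin> cbox a b \<Longrightarrow> frechet_derivative \<psi> (at x) h = 0"
      using test_function_obtain_box[OF \<psi>] by metis
    note cont = test_function_continuous[OF \<psi>] test_function_derivative_continuous[OF \<psi>, of h]
    have [measurable]: "\<psi> \<in> borel_measurable borel"
      using cont(1) by (rule borel_measurable_continuous_onI)
    define D where "D = (\<lambda>x. frechet_derivative \<psi> (at x) h)"
    have D_cont: "continuous_on UNIV D" unfolding D_def by (rule cont(2))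
    have [measurable]: "D \<in> borel_measurable borel"
      using D_cont by (rule borel_measurable_continuous_onI)
    obtain C where C: "C > 0" "\<And>x. \<bar>\<psi> x\<bar> \<le> C * indicator (cbox a b) x"
      using continuous_vanishing_bounded[OF cont(1) ab(1)] by blast
    obtain C' where C': "C' > 0" "\<And>x. \<bar>D x\<bar> \<le> C' * indicator (cbox a b) x"
      using continuous_vanishing_bounded[OF D_cont, of a b] ab(2) by (auto simp: D_def)
    have shift: "(\<integral>x. U x * D (x - s *\<^sub>R h) \<partial>lborel) = - (\<integral>x. (G (x + s *\<^sub>R h) \<bullet> h) * \<psi> x \<partial>lborel)" for s
    proof -
      have "((\<lambda>x. \<psi> (x - s *\<^sub>R h)) has_derivative frechet_derivative \<psi> (at (x - s *\<^sub>R h))) (at x)" for x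
        by (rule has_derivative_translate[OF test_function_differentiable[OF \<psi>]])
      then have "frechet_derivative (\<lambda>x. \<psi> (x - s *\<^sub>R h)) (at x) h = D (x - s *\<^sub>R h)" for x
        using frechet_derivative_at[symmetric] unfolding D_def by metis
      then have "(\<integral>x. U x * D (x - s *\<^sub>R h) \<partial>lborel) = - (\<integral>x. (G x \<bullet> h) * \<psi> (x - s *\<^sub>R h) \<partial>lborel)"
        using weak_directional[OF test_function_translate[OF \<psi>, of "s *\<^sub>R h"], of h] by simp
      also have "(\<integral>x. (G x \<bullet> h) * \<psi> (x - s *\<^sub>R h) \<partial>lborel) = (\<integral>x. (G (x + s *\<^sub>R h) \<bullet> h) * \<psi> x \<partial>lborel)"
        by (subst lborel_integral_translate[symmetric, where c="s *\<^sub>R h"]) auto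
      finally show ?thesis .
    qed
    have int1: "integrable (lborel \<Otimes>\<^sub>M lborel) (\<lambda>(x, s). U x * (indicator {0..1} s * D (x - s *\<^sub>R h)))"
      by (rule integrable_translates_product[where C=C'])
         (use C' in \<open>auto simp: U_integrable\<close>)
    have int2: "integrable (lborel \<Otimes>\<^sub>M lborel) (\<lambda>(x, s). indicator {0..1} s * (G (x + s *\<^sub>R h) \<bullet> h) * \<psi> x)"
      by (rule integrable_product_of_translates[where Q="\<lambda>x. G x \<bullet> h" and C=C])
         (use C in \<open>auto simp: G_inner_integrable\<close>)
    have ftc: "(\<integral>s. indicator {0..1} s * D (x - s *\<^sub>R h) \<partial>lborel) = \<psi> x - \<psi> (x - h)" for x
    proof -
      have der: "((\<lambda>s. - \<psi> (x - s *\<^sub>R h)) has_vector_derivative D (x - s *\<^sub>R h)) (at s within {0..1})" for s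
      proof -
        have 1: "((\<lambda>s. x - s *\<^sub>R h) has_derivative (\<lambda>t. - (t *\<^sub>R h))) (at s within {0..1})"
          by (auto intro!: derivative_eq_intros)
        have 2: "(\<psi> has_derivative frechet_derivative \<psi> (at (x - s *\<^sub>R h))) (at (x - s *\<^sub>R h))"
          using test_function_differentiable[OF \<psi>] by (simp add: frechet_derivative_works[symmetric])
        have lin: "linear (frechet_derivative \<psi> (at (x - s *\<^sub>R h)))"
          using test_function_differentiable[OF \<psi>] by (rule linear_frechet_derivative)
        have "((\<lambda>s. - \<psi> (x - s *\<^sub>R h)) has_derivative
            (\<lambda>t. - frechet_derivative \<psi> (at (x - s *\<^sub>R h)) (- (t *\<^sub>R h)))) (at s within {0..1})"
          by (intro has_derivative_minus has_derivative_compose[OF 1 2])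
        then show ?thesis
          by (simp add: has_vector_derivative_def D_def linear_neg[OF lin] linear_scale[OF lin] mult.commute)
      qed
      have "continuous_on {0..1} (\<lambda>s. D (x - s *\<^sub>R h))"
        by (rule continuous_on_compose2[OF D_cont]) (auto intro!: continuous_intros)
      then show ?thesis
        using integral_FTC_Icc[of 0 1 "\<lambda>s. - \<psi> (x - s *\<^sub>R h)" "\<lambda>s. D (x - s *\<^sub>R h)"] der by simp
    qed
    have U_prod: "integrable lborel (\<lambda>x. U x * \<psi> x)"
      by (rule integrable_mult_continuous[OF U_borel U_integrable cont(1) ab(1)])
    have Us_prod: "integrable lborel (\<lambda>x. U (x + h) * \<psi> x)"
      by (rule integrable_mult_continuous[OF _ U_shift cont(1) ab(1)]) auto
    have I_prod: "integrable lborel (\<lambda>x. I x * \<psi> x)"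
      by (rule integrable_mult_continuous[OF _ I_loc cont(1) ab(1)]) auto
    have "(\<integral>x. U x * (\<psi> x - \<psi> (x - h)) \<partial>lborel)
        = (\<integral>x. (\<integral>s. U x * (indicator {0..1} s * D (x - s *\<^sub>R h)) \<partial>lborel) \<partial>lborel)"
      by (simp add: ftc)
    also have "\<dots> = (\<integral>s. (\<integral>x. U x * (indicator {0..1} s * D (x - s *\<^sub>R h)) \<partial>lborel) \<partial>lborel)"
      by (rule lborel_pair.Fubini_integral[OF int1, symmetric])
    also have "\<dots> = (\<integral>s. indicator {0..1} s * (\<integral>x. U x * D (x - s *\<^sub>R h) \<partial>lborel) \<partial>lborel)"
    proof (rule Bochner_Integration.integral_cong[OF refl])
      fix s :: real
      show "(\<integral>x. U x * (indicator {0..1} s * D (x - s *\<^sub>R h)) \<partial>lborel)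
          = indicator {0..1} s * (\<integral>x. U x * D (x - s *\<^sub>R h) \<partial>lborel)"
        by (subst integral_mult_right_zero[symmetric]) (simp only: mult.left_commute)
    qed
    also have "\<dots> = - (\<integral>s. (\<integral>x. indicator {0..1} s * (G (x + s *\<^sub>R h) \<bullet> h) * \<psi> x \<partial>lborel) \<partial>lborel)"
      by (simp add: shift mult.assoc)
    also have "(\<integral>s. (\<integral>x. indicator {0..1} s * (G (x + s *\<^sub>R h) \<bullet> h) * \<psi> x \<partial>lborel) \<partial>lborel)
        = (\<integral>x. (\<integral>s. indicator {0..1} s * (G (x + s *\<^sub>R h) \<bullet> h) * \<psi> x \<partial>lborel) \<partial>lborel)"
      by (rule lborel_pair.Fubini_integral[OF int2])
    also have "\<dots> = (\<integral>x. I x * \<psi> x \<partial>lborel)"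
      by (simp add: I_def)
    finally have A: "(\<integral>x. U x * (\<psi> x - \<psi> (x - h)) \<partial>lborel) = - (\<integral>x. I x * \<psi> x \<partial>lborel)" .
    have B: "(\<integral>x. U x * \<psi> (x - h) \<partial>lborel) = (\<integral>x. U (x + h) * \<psi> x \<partial>lborel)"
      by (subst lborel_integral_translate[symmetric, where c=h]) auto
    have U_prod2: "integrable lborel (\<lambda>x. U x * \<psi> (x - h))"
    proof -
      have "integrable (distr lborel borel ((+) (-h))) (\<lambda>x. U (x + h) * \<psi> x)"
        using Us_prod by (simp only: lborel_distr_plus)
      then show ?thesis by (subst (asm) integrable_distr_eq) auto
    qed
    have "(\<integral>x. U x * (\<psi> x - \<psi> (x - h)) \<partial>lborel) = (\<integral>x. U x * \<psi> x \<partial>lborel) - (\<integral>x. U (x + h) * \<psi> x \<partial>lborel)"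
      using U_prod U_prod2 B by (simp add: right_diff_distrib)
    then have "(\<integral>x. U (x + h) * \<psi> x \<partial>lborel) - (\<integral>x. U x * \<psi> x \<partial>lborel) - (\<integral>x. I x * \<psi> x \<partial>lborel) = 0"
      using A by simp
    then show ?thesis
      using U_prod Us_prod I_prod by (simp add: F_def left_diff_distrib)
  qed
  have "AE x in lebesgue. x \<in> UNIV \<longrightarrow> F x = 0"
  proof (rule test_integrals_zero_imp_AE_zero)
    show "locally_integrable_on F UNIV"
      by (rule set_integrable_lborel_imp_locally_integrable_on[OF F_loc])
    fix \<psi> :: "real ^ 'n \<Rightarrow> real" assume \<psi>: "test_function UNIV \<psi>"
    have "\<psi> \<in> borel_measurable borel"
      using test_function_continuous[OF \<psi>] by (rule borel_measurable_continuous_onI)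
    then have "(\<integral>x. F x * \<psi> x \<partial>lebesgue) = (\<integral>x. F x * \<psi> x \<partial>lborel)"
      by (intro integral_completion) auto
    then show "(\<integral>x. F x * \<psi> x \<partial>lebesgue_on UNIV) = 0"
      using F_zero[OF \<psi>] integral_lebesgue_on_UNIV[of UNIV "\<lambda>x. F x * \<psi> x"] by simp
  qed simp
  then have "AE x in lborel. F x = 0"
    by (simp add: AE_completion_iff)
  then show ?thesis
    by (rule AE_mp) (auto simp: F_def I_def intro!: AE_I2)
qed

end

subsection \<open>Riesz potentials\<close>

lemma nn_integral_power_le:
  assumes "0 < \<rho>" "0 < n"
  shows "(\<integral>\<^sup>+s. ennreal (1 / s ^ (n + 1)) * indicator {\<rho>..1::real} s \<partial>lborel) \<le> ennreal (1 / (real n * \<rho> ^ n))"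
proof (cases "\<rho> \<le> 1")
  case True
  have "(\<integral>\<^sup>+s. ennreal (1 / s ^ (n + 1)) * indicator {\<rho>..1::real} s \<partial>lborel)
      = ennreal (- (1 / (real n * 1 ^ n)) - (- (1 / (real n * \<rho> ^ n))))"
  proof (rule nn_integral_FTC_Icc[OF _ _ _ True])
    show "((\<lambda>s. - (1 / (real n * s ^ n))) has_real_derivative 1 / x ^ (n + 1)) (at x)" if "x \<in> {\<rho>..1}" for x
    proof -
      have x: "x > 0" using that assms by auto
      obtain m where m: "n = Suc m" using assms gr0_implies_Suc by blast
      have "((\<lambda>s. - (1 / real n) * inverse s ^ n) has_real_derivative
          - (1 / real n) * (real n * inverse x ^ (n - 1) * - (inverse x * inverse x))) (at x)"
        using x by (auto intro!: derivative_eq_intros simp: power2_eq_square)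
      also have "- (1 / real n) * (real n * inverse x ^ (n - 1) * - (inverse x * inverse x)) = 1 / x ^ (n + 1)"
        using x unfolding m by (simp add: field_simps)
      finally show ?thesis by (simp add: field_simps)
    qed
  qed (use assms in auto)
  also have "\<dots> \<le> ennreal (1 / (real n * \<rho> ^ n))"
    by (intro ennreal_leI) simp
  finally show ?thesis .
qed simp

lemma nn_integral_lborel_affine:
  fixes f :: "'a::euclidean_space \<Rightarrow> ennreal"
  assumes [measurable]: "f \<in> borel_measurable borel" and "c > 0"
  shows "(\<integral>\<^sup>+z. f z \<partial>lborel) = ennreal (c ^ DIM('a)) * (\<integral>\<^sup>+h. f (t + c *\<^sub>R h) \<partial>lborel)"
  using assms(2)
  by (subst lborel_affine[of c t]) (simp_all add: nn_integral_density nn_integral_distr nn_integral_cmult)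

text \<open>Polar coordinates without surface measure. For fixed \<open>s\<close> the substitution z
  = x + s h produces s^-(n+1): n powers come from the volume and one from norm h = norm (x - z) / s.
  For fixed \<open>z\<close> only s > norm (x - z) / R contribute, and integrating s^-(n+1) over
  them leaves the Riesz kernel.\<close>

lemma nn_integral_ball_segments_le:
  fixes H :: "'a::euclidean_space \<Rightarrow> ennreal"
  assumes [measurable]: "H \<in> borel_measurable borel" and R: "R > 0"
  shows "(\<integral>\<^sup>+h. indicator (ball 0 R) h * (\<integral>\<^sup>+s. indicator {0..1} s * (H (x + s *\<^sub>R h) * ennreal (norm h)) \<partial>lborel) \<partial>lborel)
    \<le> ennreal (R ^ DIM('a) / real DIM('a)) * (\<integral>\<^sup>+z. H z * ennreal (1 / norm (x - z) ^ (DIM('a) - 1)) \<partial>lborel)"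
proof -
  let ?n = "DIM('a)"
  have [measurable]: "ball (0::'a) R \<in> sets borel" by simp
  have meas_ball [measurable]: "(\<lambda>(s, z). indicator (ball x (s * R)) z :: ennreal) \<in> borel_measurable (borel \<Otimes>\<^sub>M borel)"
    unfolding ball_def indicator_def by measurable
  have "(\<integral>\<^sup>+h. indicator (ball 0 R) h * (\<integral>\<^sup>+s. indicator {0..1} s * (H (x + s *\<^sub>R h) * ennreal (norm h)) \<partial>lborel) \<partial>lborel)
      = (\<integral>\<^sup>+h. (\<integral>\<^sup>+s. indicator {0..1} s * (indicator (ball 0 R) h * (H (x + s *\<^sub>R h) * ennreal (norm h))) \<partial>lborel) \<partial>lborel)"
    by (subst nn_integral_cmult[symmetric]) (auto simp: ac_simps)
  also have "\<dots> = (\<integral>\<^sup>+s. (\<integral>\<^sup>+h. indicator {0..1} s * (indicator (ball 0 R) h * (H (x + s *\<^sub>R h) * ennreal (norm h))) \<partial>lborel) \<partial>lborel)"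
    by (rule lborel_pair.Fubini') measurable
  also have "\<dots> = (\<integral>\<^sup>+s. (\<integral>\<^sup>+z. indicator {0<..1} s * ennreal (1 / s ^ (?n + 1)) *
      (indicator (ball x (s * R)) z * (H z * ennreal (norm (x - z)))) \<partial>lborel) \<partial>lborel)"
  proof (rule nn_integral_cong_AE)
    have "AE s in lborel. s \<noteq> (0::real)" by (rule AE_lborel_singleton)
    then show "AE s in lborel. (\<integral>\<^sup>+h. indicator {0..1} s * (indicator (ball 0 R) h * (H (x + s *\<^sub>R h) * ennreal (norm h))) \<partial>lborel)
      = (\<integral>\<^sup>+z. indicator {0<..1} s * ennreal (1 / s ^ (?n + 1)) * (indicator (ball x (s * R)) z * (H z * ennreal (norm (x - z)))) \<partial>lborel)"
    proof (rule AE_mp, intro AE_I2 impI)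
      fix s :: real assume "s \<noteq> 0"
      show "(\<integral>\<^sup>+h. indicator {0..1} s * (indicator (ball 0 R) h * (H (x + s *\<^sub>R h) * ennreal (norm h))) \<partial>lborel)
        = (\<integral>\<^sup>+z. indicator {0<..1} s * ennreal (1 / s ^ (?n + 1)) * (indicator (ball x (s * R)) z * (H z * ennreal (norm (x - z)))) \<partial>lborel)"
      proof (cases "s \<in> {0<..1}")
        case True
        then have s: "s > 0" by simp
        have "(\<integral>\<^sup>+z. ennreal (1 / s ^ (?n + 1)) * (indicator (ball x (s * R)) z * (H z * ennreal (norm (x - z)))) \<partial>lborel)
          = ennreal (s ^ ?n) * (\<integral>\<^sup>+h. ennreal (1 / s ^ (?n + 1)) * (indicator (ball x (s * R)) (x + s *\<^sub>R h)
              * (H (x + s *\<^sub>R h) * ennreal (norm (x - (x + s *\<^sub>R h))))) \<partial>lborel)"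
          by (rule nn_integral_lborel_affine[OF _ s]) measurable
        also have "\<dots> = (\<integral>\<^sup>+h. ennreal (s ^ ?n) * (ennreal (1 / s ^ (?n + 1)) * (indicator (ball x (s * R)) (x + s *\<^sub>R h)
              * (H (x + s *\<^sub>R h) * ennreal (norm (x - (x + s *\<^sub>R h)))))) \<partial>lborel)"
          by (rule nn_integral_cmult[symmetric]) measurable
        also have "\<dots> = (\<integral>\<^sup>+h. indicator (ball 0 R) h * (H (x + s *\<^sub>R h) * ennreal (norm h)) \<partial>lborel)"
        proof (rule nn_integral_cong)
          fix h
          have 1: "indicator (ball x (s * R)) (x + s *\<^sub>R h) = (indicator (ball 0 R) h :: ennreal)"
            using s by (auto simp: indicator_def dist_norm)
          have 2: "ennreal (s ^ ?n) * (ennreal (1 / s ^ (?n + 1)) * ennreal (norm (x - (x + s *\<^sub>R h)))) = ennreal (norm h)"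
            using s by (simp add: ennreal_mult[symmetric])
          show "ennreal (s ^ ?n) * (ennreal (1 / s ^ (?n + 1)) * (indicator (ball x (s * R)) (x + s *\<^sub>R h)
              * (H (x + s *\<^sub>R h) * ennreal (norm (x - (x + s *\<^sub>R h))))))
            = indicator (ball 0 R) h * (H (x + s *\<^sub>R h) * ennreal (norm h))"
            unfolding 1 2[symmetric] by (simp only: ac_simps)
        qed
        finally show ?thesis using True by simp
      qed (use \<open>s \<noteq> 0\<close> in \<open>auto simp: indicator_def\<close>)
    qed
  qed
  also have "\<dots> = (\<integral>\<^sup>+z. (\<integral>\<^sup>+s. indicator {0<..1} s * ennreal (1 / s ^ (?n + 1)) *
      (indicator (ball x (s * R)) z * (H z * ennreal (norm (x - z)))) \<partial>lborel) \<partial>lborel)"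
    by (rule lborel_pair.Fubini') measurable
  also have "\<dots> \<le> (\<integral>\<^sup>+z. ennreal (R ^ ?n / real ?n) * (H z * ennreal (1 / norm (x - z) ^ (?n - 1))) \<partial>lborel)"
  proof (rule nn_integral_mono)
    fix z
    show "(\<integral>\<^sup>+s. indicator {0<..1} s * ennreal (1 / s ^ (?n + 1)) *
        (indicator (ball x (s * R)) z * (H z * ennreal (norm (x - z)))) \<partial>lborel)
      \<le> ennreal (R ^ ?n / real ?n) * (H z * ennreal (1 / norm (x - z) ^ (?n - 1)))"
    proof (cases "z = x")
      \<comment> \<open>For z = x the factor norm (x - z) annihilates the left side, so the default
        value of the kernel at its singularity is harmless.\<close>
      case False
      define \<rho> where "\<rho> = norm (x - z) / R"
      have \<rho>: "\<rho> > 0" using False R by (simp add: \<rho>_def)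
      have "(\<integral>\<^sup>+s. indicator {0<..1} s * ennreal (1 / s ^ (?n + 1)) *
        (indicator (ball x (s * R)) z * (H z * ennreal (norm (x - z)))) \<partial>lborel)
        \<le> (\<integral>\<^sup>+s. (H z * ennreal (norm (x - z))) * (ennreal (1 / s ^ (?n + 1)) * indicator {\<rho>..1} s) \<partial>lborel)"
      proof (rule nn_integral_mono)
        fix s
        have "z \<in> ball x (s * R) \<Longrightarrow> \<rho> \<le> s"
          using R by (auto simp: \<rho>_def dist_norm field_simps)
        then show "indicator {0<..1} s * ennreal (1 / s ^ (?n + 1)) *
          (indicator (ball x (s * R)) z * (H z * ennreal (norm (x - z))))
          \<le> (H z * ennreal (norm (x - z))) * (ennreal (1 / s ^ (?n + 1)) * indicator {\<rho>..1} s)"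
          by (auto simp: indicator_def mult.commute)
      qed
      also have "\<dots> = (H z * ennreal (norm (x - z))) * (\<integral>\<^sup>+s. ennreal (1 / s ^ (?n + 1)) * indicator {\<rho>..1} s \<partial>lborel)"
        by (rule nn_integral_cmult) measurable
      also have "\<dots> \<le> (H z * ennreal (norm (x - z))) * ennreal (1 / (real ?n * \<rho> ^ ?n))"
        using \<rho> by (intro mult_left_mono nn_integral_power_le) auto
      also have "\<dots> = H z * (ennreal (norm (x - z)) * ennreal (1 / (real ?n * \<rho> ^ ?n)))"
        by (simp only: ac_simps)
      also have "ennreal (norm (x - z)) * ennreal (1 / (real ?n * \<rho> ^ ?n))
          = ennreal (R ^ ?n / real ?n) * ennreal (1 / norm (x - z) ^ (?n - 1))"
      proof -
        obtain m where m: "?n = Suc m" using DIM_positive[where 'a='a] gr0_implies_Suc by blast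
        have "norm (x - z) * (1 / (real ?n * \<rho> ^ ?n)) = (R ^ ?n / real ?n) * (1 / norm (x - z) ^ (?n - 1))"
        proof -
          define a where "a = norm (x - z)"
          have "a > 0" using False by (simp add: a_def)
          then show ?thesis
            unfolding a_def[symmetric] \<rho>_def m by (simp add: power_divide)
        qed
        then show ?thesis using R \<rho> by (simp add: ennreal_mult[symmetric])
      qed
      also have "H z * (ennreal (R ^ ?n / real ?n) * ennreal (1 / norm (x - z) ^ (?n - 1)))
        = ennreal (R ^ ?n / real ?n) * (H z * ennreal (1 / norm (x - z) ^ (?n - 1)))"
        by (simp only: ac_simps)
      finally show ?thesis .
    qed simp
  qed
  also have "\<dots> = ennreal (R ^ ?n / real ?n) * (\<integral>\<^sup>+z. H z * ennreal (1 / norm (x - z) ^ (?n - 1)) \<partial>lborel)"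
    by (rule nn_integral_cmult) measurable
  finally show ?thesis .
qed

text \<open>\<open>A\<close> is split at the ball of radius \<open>R\<close> around
  \<open>x\<close>. Inside the ball the kernel has an integral of order R; outside it is at most
  R^(1-n), and the bound R^n on the measure of \<open>A\<close> turns this into R.\<close>

lemma riesz_kernel_integral_le:
  fixes A :: "'a::euclidean_space set"
  assumes [measurable]: "A \<in> sets borel" and R: "R > 0" and A: "emeasure lborel A \<le> ennreal (R ^ DIM('a))"
  shows "(\<integral>\<^sup>+z. indicator A z * ennreal (1 / norm (x - z) ^ (DIM('a) - 1)) \<partial>lborel)
    \<le> ennreal ((2 ^ (DIM('a) + 1) * unit_ball_vol (real DIM('a)) + 1) * R)"
proof -
  let ?n = "DIM('a)"
  let ?k = "\<lambda>z. ennreal (1 / norm (x - z) ^ (?n - 1))"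
  obtain m where m: "?n = Suc m" using DIM_positive[where 'a='a] gr0_implies_Suc by blast
  have [measurable]: "ball x R \<in> sets borel" by simp
  have ball: "(\<integral>\<^sup>+z. indicator (ball x R) z * ?k z \<partial>lborel) \<le> ennreal (2 ^ (?n + 1) * unit_ball_vol (real ?n) * R)"
  proof -
    have [measurable]: "(\<lambda>(s, z). indicator (cball x s) z :: ennreal) \<in> borel_measurable (borel \<Otimes>\<^sub>M borel)"
      unfolding cball_def indicator_def by measurable
    have [measurable]: "(\<lambda>(z, s). indicator (cball x s) z :: ennreal) \<in> borel_measurable (borel \<Otimes>\<^sub>M borel)"
      unfolding cball_def indicator_def by measurable
    \<comment> \<open>The kernel at distance \<rho> is dominated by an integral of ball indicators:
      on the interval [\<rho>, 2\<rho>], of length \<rho>, the function 2^n / s^n is at least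
      \<rho>^-n. After Fubini only volumes of balls remain, which cancel s^n. The range of
      \<open>s\<close> ends at 2R because \<rho> < R.\<close>
    have "(\<integral>\<^sup>+z. indicator (ball x R) z * ?k z \<partial>lborel)
        \<le> (\<integral>\<^sup>+z. (\<integral>\<^sup>+s. indicator {0<..2 * R} s * ennreal (2 ^ ?n / s ^ ?n) * indicator (cball x s) z \<partial>lborel) \<partial>lborel)"
    proof (rule nn_integral_mono_AE)
      have "AE z in lborel. z \<noteq> x" by (rule AE_lborel_singleton)
      then show "AE z in lborel. indicator (ball x R) z * ?k z
          \<le> (\<integral>\<^sup>+s. indicator {0<..2 * R} s * ennreal (2 ^ ?n / s ^ ?n) * indicator (cball x s) z \<partial>lborel)"
      proof (rule AE_mp, intro AE_I2 impI)
        fix z assume "z \<noteq> x"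
        define \<rho> where "\<rho> = norm (x - z)"
        have \<rho>: "\<rho> > 0" using \<open>z \<noteq> x\<close> by (simp add: \<rho>_def)
        show "indicator (ball x R) z * ?k z
          \<le> (\<integral>\<^sup>+s. indicator {0<..2 * R} s * ennreal (2 ^ ?n / s ^ ?n) * indicator (cball x s) z \<partial>lborel)"
        proof (cases "z \<in> ball x R")
          case True
          then have "\<rho> < R" by (simp add: \<rho>_def dist_norm)
          have "ennreal (1 / \<rho> ^ m) = (\<integral>\<^sup>+s. ennreal (2 ^ ?n / (2 * \<rho>) ^ ?n) * indicator {\<rho>..2 * \<rho>} s \<partial>lborel)"
            using \<rho> by (simp add: nn_integral_cmult_indicator ennreal_mult[symmetric] power_mult_distrib m)
          also have "\<dots> \<le> (\<integral>\<^sup>+s. indicator {0<..2 * R} s * ennreal (2 ^ ?n / s ^ ?n) * indicator (cball x s) z \<partial>lborel)"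
          proof (rule nn_integral_mono)
            fix s
            have "2 ^ ?n / (2 * \<rho>) ^ ?n \<le> 2 ^ ?n / s ^ ?n" if "s \<in> {\<rho>..2 * \<rho>}"
              using that \<rho> by (intro divide_left_mono power_mono) auto
            moreover have "s > 0" if "\<rho> \<le> s" using that \<rho> by simp
            ultimately show "ennreal (2 ^ ?n / (2 * \<rho>) ^ ?n) * indicator {\<rho>..2 * \<rho>} s
              \<le> indicator {0<..2 * R} s * ennreal (2 ^ ?n / s ^ ?n) * indicator (cball x s) z"
              using \<rho> \<open>\<rho> < R\<close> by (auto simp: indicator_def \<rho>_def dist_norm intro: ennreal_leI)
          qed
          finally show ?thesis using True by (simp add: \<rho>_def m)
        qed simp
      qed
    qed
    also have "\<dots> = (\<integral>\<^sup>+s. (\<integral>\<^sup>+z. indicator {0<..2 * R} s * ennreal (2 ^ ?n / s ^ ?n) * indicator (cball x s) z \<partial>lborel) \<partial>lborel)"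
      by (rule lborel_pair.Fubini') measurable
    also have "\<dots> = (\<integral>\<^sup>+s. ennreal (2 ^ ?n * unit_ball_vol (real ?n)) * indicator {0<..2 * R} s \<partial>lborel)"
    proof (rule nn_integral_cong)
      fix s :: real
      show "(\<integral>\<^sup>+z. indicator {0<..2 * R} s * ennreal (2 ^ ?n / s ^ ?n) * indicator (cball x s) z \<partial>lborel)
        = ennreal (2 ^ ?n * unit_ball_vol (real ?n)) * indicator {0<..2 * R} s"
      proof (cases "s \<in> {0<..2 * R}")
        case True
        then have "(\<integral>\<^sup>+z. indicator {0<..2 * R} s * ennreal (2 ^ ?n / s ^ ?n) * indicator (cball x s) z \<partial>lborel)
          = ennreal (2 ^ ?n / s ^ ?n) * emeasure lborel (cball x s)"
          by (simp add: nn_integral_cmult_indicator)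
        also have "\<dots> = ennreal (2 ^ ?n * unit_ball_vol (real ?n))"
          using True by (simp add: emeasure_cball ennreal_mult[symmetric])
        finally show ?thesis using True by simp
      qed simp
    qed
    also have "\<dots> = ennreal (2 ^ (?n + 1) * unit_ball_vol (real ?n) * R)"
    proof -
      have "(\<integral>\<^sup>+s. ennreal (2 ^ ?n * unit_ball_vol (real ?n)) * indicator {0<..2 * R} s \<partial>lborel)
        = ennreal (2 ^ ?n * unit_ball_vol (real ?n)) * ennreal (2 * R)"
        using R by (subst nn_integral_cmult_indicator) auto
      also have "\<dots> = ennreal (2 ^ ?n * unit_ball_vol (real ?n) * (2 * R))"
        using R by (intro ennreal_mult[symmetric]) auto
      finally show ?thesis by (simp add: ac_simps)
    qed
    finally show ?thesis .
  qed
  have "(\<integral>\<^sup>+z. indicator A z * ?k z \<partial>lborel) \<le> (\<integral>\<^sup>+z. indicator (ball x R) z * ?k z + ennreal (1 / R ^ m) * indicator A z \<partial>lborel)"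
  proof (rule nn_integral_mono)
    fix z
    have "1 / norm (x - z) ^ m \<le> 1 / R ^ m" if "z \<notin> ball x R"
      using that R by (intro divide_left_mono power_mono mult_pos_pos zero_less_power) (auto simp: dist_norm)
    then show "indicator A z * ?k z \<le> indicator (ball x R) z * ?k z + ennreal (1 / R ^ m) * indicator A z"
      by (auto simp: indicator_def m intro: ennreal_leI)
  qed
  also have "\<dots> = (\<integral>\<^sup>+z. indicator (ball x R) z * ?k z \<partial>lborel) + ennreal (1 / R ^ m) * emeasure lborel A"
    by (subst nn_integral_add) (measurable, simp add: nn_integral_cmult_indicator)
  also have "\<dots> \<le> ennreal (2 ^ (?n + 1) * unit_ball_vol (real ?n) * R) + ennreal (1 / R ^ m) * ennreal (R ^ ?n)"
    by (intro add_mono ball mult_left_mono A) auto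
  also have "\<dots> = ennreal ((2 ^ (?n + 1) * unit_ball_vol (real ?n) + 1) * R)"
  proof -
    have "1 / R ^ m * R ^ ?n = R" using R by (simp add: m)
    then show ?thesis using R
      by (simp add: ennreal_mult[symmetric] ennreal_plus[symmetric] algebra_simps del: ennreal_plus)
  qed
  finally show ?thesis .
qed

subsection \<open>Segments crossing a shell\<close>

text \<open>The intermediate value theorem replaces the chain rule for truncations: a path from
  \<open>{|p| \<ge> b}\<close> to \<open>{|p| \<le> a}\<close> contains a stretch inside \<open>{a < |p| < b}\<close> on which \<open>|p|\<close> drops
  from \<open>b\<close> to \<open>a\<close>.\<close>

lemma path_crossing_le:
  fixes q v :: "real \<Rightarrow> real"
  assumes q: "integrable lborel (\<lambda>s. indicator {0..1} s * q s)"
    and p: "\<And>s. p s = u0 + (\<integral>\<sigma>. indicator {0..s} \<sigma> * q \<sigma> \<partial>lborel)"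
    and v: "AE s in lborel. s \<in> {0<..1} \<longrightarrow> v s = p s"
    and ends: "b \<le> \<bar>u0\<bar>" "\<bar>p 1\<bar> \<le> a" and ab: "a < b"
  shows "ennreal (b - a) \<le> (\<integral>\<^sup>+s. indicator {0..1} s * (ennreal \<bar>q s\<bar> * indicator {s. a < \<bar>v s\<bar> \<and> \<bar>v s\<bar> < b} s) \<partial>lborel)"
proof -
  have set_int: "set_integrable lborel {0..1} q"
    using q by (simp add: set_integrable_def)
  have int_s: "integrable lborel (\<lambda>\<sigma>. indicator {0..s} \<sigma> * q \<sigma>)" if "s \<in> {0..1}" for s
    using set_integrable_subset[OF set_int, of "{0..s}"] that by (simp add: set_integrable_def)
  have p_eq: "p s = u0 + integral {0..s} q" if "s \<in> {0..1}" for s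
    using set_borel_integral_eq_integral(2)[of "{0..s}" q] int_s[OF that]
    by (simp add: p set_integrable_def set_lebesgue_integral_def)
  have "q integrable_on {0..1}"
    using set_borel_integral_eq_integral(1)[OF set_int] .
  then have "continuous_on {0..1} (\<lambda>s. u0 + integral {0..s} q)"
    by (intro continuous_intros indefinite_integral_continuous_1)
  then have cont: "continuous_on {0..1} p"
    by (rule continuous_on_eq) (simp add: p_eq)
  have cont_abs: "continuous_on {0..1} (\<lambda>s. \<bar>p s\<bar>)"
    by (intro continuous_intros cont)
  have p0: "p 0 = u0" using p_eq[of 0] by simp
  \<comment> \<open>\<open>s1\<close> is the last time at which |p| is at least \<open>b\<close>,
    and \<open>s2\<close> the first time after it at which |p| is at most \<open>a\<close>; strictly
    between them the path stays in the open shell.\<close>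
  define S1 where "S1 = {s \<in> {0..1}. b \<le> \<bar>p s\<bar>}"
  have "closed S1" unfolding S1_def
    by (intro continuous_on_closed_Collect_le cont_abs continuous_intros)
  moreover have "bounded S1" by (rule bounded_subset[of "{0..1}"]) (auto simp: S1_def)
  ultimately have "compact S1" by (simp add: compact_eq_bounded_closed)
  moreover have "S1 \<noteq> {}" using ends(1) p0 by (auto simp: S1_def intro: exI[of _ 0])
  ultimately obtain s1 where s1: "s1 \<in> S1" "\<And>s. s \<in> S1 \<Longrightarrow> s \<le> s1"
    using compact_attains_sup by metis
  define S2 where "S2 = {s \<in> {s1..1}. \<bar>p s\<bar> \<le> a}"
  have s1_range: "0 \<le> s1" "s1 \<le> 1" "b \<le> \<bar>p s1\<bar>" using s1(1) by (auto simp: S1_def)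
  have "closed S2" unfolding S2_def
    by (intro continuous_on_closed_Collect_le continuous_on_subset[OF cont_abs] continuous_intros)
       (use s1_range in auto)
  moreover have "bounded S2" by (rule bounded_subset[of "{s1..1}"]) (auto simp: S2_def)
  ultimately have "compact S2" by (simp add: compact_eq_bounded_closed)
  moreover have "S2 \<noteq> {}" using ends(2) s1_range by (auto simp: S2_def intro: exI[of _ 1])
  ultimately obtain s2 where s2: "s2 \<in> S2" "\<And>s. s \<in> S2 \<Longrightarrow> s2 \<le> s"
    using compact_attains_inf by metis
  have s2_range: "s1 \<le> s2" "s2 \<le> 1" "\<bar>p s2\<bar> \<le> a" using s2(1) by (auto simp: S2_def)
  have between: "a < \<bar>p s\<bar> \<and> \<bar>p s\<bar> < b" if "s1 < s" "s < s2" for s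
    using that s1(2)[of s] s2(2)[of s] s1_range s2_range by (force simp: S1_def S2_def)
  have "ennreal (b - a) \<le> ennreal \<bar>p s2 - p s1\<bar>"
    using s1_range s2_range by (intro ennreal_leI) linarith
  also have "p s2 - p s1 = (\<integral>\<sigma>. indicator {0..s2} \<sigma> * q \<sigma> - indicator {0..s1} \<sigma> * q \<sigma> \<partial>lborel)"
    using int_s[of s1] int_s[of s2] s1_range s2_range by (simp add: p)
  also have "ennreal \<bar>\<dots>\<bar> \<le> (\<integral>\<^sup>+\<sigma>. ennreal (norm (indicator {0..s2} \<sigma> * q \<sigma> - indicator {0..s1} \<sigma> * q \<sigma>)) \<partial>lborel)"
    unfolding real_norm_def[symmetric]
    using int_s[of s1] int_s[of s2] s1_range s2_range by (intro integral_norm_bound_ennreal) auto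
  also have "\<dots> \<le> (\<integral>\<^sup>+s. indicator {0..1} s * (ennreal \<bar>q s\<bar> * indicator {s. a < \<bar>v s\<bar> \<and> \<bar>v s\<bar> < b} s) \<partial>lborel)"
  proof (rule nn_integral_mono_AE)
    \<comment> \<open>The difference of the indicators equals 1 on (s1, s2], and at
      \<open>s2\<close> the path has already left the shell. The shell is described by
      \<open>v\<close>, which agrees with the continuous path \<open>p\<close> only almost
      everywhere.\<close>
    have "AE s in lborel. s \<noteq> s2" by (rule AE_lborel_singleton)
    with v show "AE s in lborel. ennreal (norm (indicator {0..s2} s * q s - indicator {0..s1} s * q s))
        \<le> indicator {0..1} s * (ennreal \<bar>q s\<bar> * indicator {s. a < \<bar>v s\<bar> \<and> \<bar>v s\<bar> < b} s)"
    proof eventually_elim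
      case (elim s)
      show ?case
      proof (cases "s1 < s \<and> s < s2")
        case True
        then show ?thesis using elim(1) between[of s] s1_range s2_range by (auto simp: indicator_def)
      next
        case False
        with elim(2) have eq: "indicator {0..s2} s * q s - indicator {0..s1} s * q s = 0"
          using s1_range s2_range by (auto simp: indicator_def)
        show ?thesis by (subst eq) simp
      qed
    qed
  qed
  finally show ?thesis .
qed

context borel_weak_gradient
begin

lemma increment_eq_segment_integral:
  assumes s: "s > 0"
  shows "AE x in lborel. U (x + s *\<^sub>R h) = U x + (\<integral>\<sigma>. indicator {0..s} \<sigma> * (G (x + \<sigma> *\<^sub>R h) \<bullet> h) \<partial>lborel)"
  using increment_eq_line_integral[of "s *\<^sub>R h"]
proof (rule AE_mp, intro AE_I2 impI)
  fix x assume eq: "U (x + s *\<^sub>R h) - U x = (\<integral>\<sigma>. indicator {0..1} \<sigma> * (G (x + \<sigma> *\<^sub>R s *\<^sub>R h) \<bullet> (s *\<^sub>R h)) \<partial>lborel)"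
  have "(\<integral>\<sigma>. indicator {0..s} \<sigma> * (G (x + \<sigma> *\<^sub>R h) \<bullet> h) \<partial>lborel)
      = \<bar>s\<bar> *\<^sub>R (\<integral>\<sigma>. indicator {0..s} (0 + s * \<sigma>) * (G (x + (0 + s * \<sigma>) *\<^sub>R h) \<bullet> h) \<partial>lborel)"
    using s by (intro lborel_integral_real_affine) auto
  also have "\<dots> = (\<integral>\<sigma>. s * (indicator {0..s} (s * \<sigma>) * (G (x + (s * \<sigma>) *\<^sub>R h) \<bullet> h)) \<partial>lborel)"
    using s by simp
  also have "\<dots> = (\<integral>\<sigma>. indicator {0..1} \<sigma> * (G (x + \<sigma> *\<^sub>R s *\<^sub>R h) \<bullet> (s *\<^sub>R h)) \<partial>lborel)"
    using s by (intro Bochner_Integration.integral_cong)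
      (auto simp: indicator_def zero_le_mult_iff mult.commute)
  finally show "U (x + s *\<^sub>R h) = U x + (\<integral>\<sigma>. indicator {0..s} \<sigma> * (G (x + \<sigma> *\<^sub>R h) \<bullet> h) \<partial>lborel)"
    using eq by simp
qed

text \<open>The exceptional set of points \<open>x\<close> depends on \<open>s\<close>. Joint
  measurability allows the two quantifiers to be exchanged, so that almost every \<open>x\<close> is
  good for almost every \<open>s\<close> on its segment.\<close>

lemma AE_segment_integral:
  "AE x in lborel. AE s in lborel. s \<in> {0<..1} \<longrightarrow>
    U (x + s *\<^sub>R h) = U x + (\<integral>\<sigma>. indicator {0..s} \<sigma> * (G (x + \<sigma> *\<^sub>R h) \<bullet> h) \<partial>lborel)"
proof (subst lborel_pair.AE_commute)
  have [measurable]: "(\<lambda>(x, s). \<integral>\<sigma>. indicator {0..s} \<sigma> * (G (x + \<sigma> *\<^sub>R h) \<bullet> h) \<partial>lborel) \<in> borel_measurable (lborel \<Otimes>\<^sub>M lborel)"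
    unfolding indicator_def atLeastAtMost_iff by measurable
  show "{x \<in> space (lborel \<Otimes>\<^sub>M lborel). snd x \<in> {0<..1} \<longrightarrow>
      U (fst x + snd x *\<^sub>R h) = U (fst x) + (\<integral>\<sigma>. indicator {0..snd x} \<sigma> * (G (fst x + \<sigma> *\<^sub>R h) \<bullet> h) \<partial>lborel)}
    \<in> sets (lborel \<Otimes>\<^sub>M lborel)"
    by measurable
  show "AE s in lborel. AE x in lborel. s \<in> {0<..1} \<longrightarrow>
    U (x + s *\<^sub>R h) = U x + (\<integral>\<sigma>. indicator {0..s} \<sigma> * (G (x + \<sigma> *\<^sub>R h) \<bullet> h) \<partial>lborel)"
  proof (rule AE_I2)
    fix s :: real
    show "AE x in lborel. s \<in> {0<..1} \<longrightarrow>
      U (x + s *\<^sub>R h) = U x + (\<integral>\<sigma>. indicator {0..s} \<sigma> * (G (x + \<sigma> *\<^sub>R h) \<bullet> h) \<partial>lborel)"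
      using increment_eq_segment_integral[of s h] by (cases "s > 0") auto
  qed
qed

text \<open>Up to null sets this is the length of the gradient of |U| truncated to [a, b], written
  down directly and not derived from a chain rule. For \<open>a \<ge> 0\<close> the shell does not
  meet {U = 0}.\<close>

definition shell_gradient :: "real \<Rightarrow> real \<Rightarrow> real ^ 'n \<Rightarrow> real" where
  "shell_gradient a b z = indicator {z. a < \<bar>U z\<bar> \<and> \<bar>U z\<bar> < b} z * norm (G z)"

lemma shell_gradient_borel [measurable]: "shell_gradient a b \<in> borel_measurable borel"
  unfolding shell_gradient_def by measurable

text \<open>The endpoint \<open>x + h\<close> has its own increment identity: the identity along the
  segment holds only for almost every \<open>s\<close> and might fail at s = 1.\<close>

lemma AE_gap_le_segment_integral:
  assumes ab: "a < b"
  shows "AE x in lborel. b \<le> \<bar>U x\<bar> \<longrightarrow> \<bar>U (x + h)\<bar> \<le> a \<longrightarrow>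
    ennreal (b - a) \<le> (\<integral>\<^sup>+s. indicator {0..1} s * (ennreal (shell_gradient a b (x + s *\<^sub>R h)) * ennreal (norm h)) \<partial>lborel)"
  using AE_segment_integral[of h] increment_eq_line_integral[of h] AE_line_integrable[of h]
proof eventually_elim
  case (elim x)
  show ?case
  proof (intro impI)
    assume ends: "b \<le> \<bar>U x\<bar>" "\<bar>U (x + h)\<bar> \<le> a"
    have "ennreal (b - a) \<le> (\<integral>\<^sup>+s. indicator {0..1} s * (ennreal \<bar>G (x + s *\<^sub>R h) \<bullet> h\<bar>
        * indicator {s. a < \<bar>U (x + s *\<^sub>R h)\<bar> \<and> \<bar>U (x + s *\<^sub>R h)\<bar> < b} s) \<partial>lborel)"
      by (rule path_crossing_le[OF elim(3) refl elim(1) ends(1) _ ab]) (use elim(2) ends(2) in \<open>simp add: algebra_simps\<close>)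
    also have "\<dots> \<le> (\<integral>\<^sup>+s. indicator {0..1} s * (ennreal (shell_gradient a b (x + s *\<^sub>R h)) * ennreal (norm h)) \<partial>lborel)"
    proof (rule nn_integral_mono)
      fix s :: real
      have "\<bar>G (x + s *\<^sub>R h) \<bullet> h\<bar> \<le> norm (G (x + s *\<^sub>R h)) * norm h" by (rule Cauchy_Schwarz_ineq2)
      then show "indicator {0..1} s * (ennreal \<bar>G (x + s *\<^sub>R h) \<bullet> h\<bar>
        * indicator {s. a < \<bar>U (x + s *\<^sub>R h)\<bar> \<and> \<bar>U (x + s *\<^sub>R h)\<bar> < b} s)
        \<le> indicator {0..1} s * (ennreal (shell_gradient a b (x + s *\<^sub>R h)) * ennreal (norm h))"
        by (auto simp: indicator_def shell_gradient_def ennreal_mult[symmetric] intro: ennreal_leI)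
    qed
    finally show "ennreal (b - a) \<le> (\<integral>\<^sup>+s. indicator {0..1} s * (ennreal (shell_gradient a b (x + s *\<^sub>R h)) * ennreal (norm h)) \<partial>lborel)" .
  qed
qed

text \<open>Almost every segment from \<open>{|U| \<ge> b}\<close> to \<open>{|U| \<le> a}\<close> crosses the shell; averaging over all
  segments of length at most \<open>R\<close> produces the Riesz potential of the gradient on the shell. The
  radius is chosen such that \<open>{|U| \<le> a}\<close> fills at least half of every ball.\<close>

lemma superlevel_gap_le_riesz:
  assumes ab: "a < b" and fin: "emeasure lborel {x. a < \<bar>U x\<bar>} < \<infinity>"
    and S[measurable]: "S \<in> sets borel" and S_sub: "S \<subseteq> {x. b \<le> \<bar>U x\<bar>}"
  shows "ennreal (b - a) * emeasure lborel S
    \<le> ennreal (2 / (real CARD('n) * unit_ball_vol (real CARD('n)))) *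
      (\<integral>\<^sup>+x. indicator S x * (\<integral>\<^sup>+z. ennreal (shell_gradient a b z) * ennreal (1 / norm (x - z) ^ (CARD('n) - 1)) \<partial>lborel) \<partial>lborel)"
proof -
  define n where "n = CARD('n)"
  have n: "n > 0" by (simp add: n_def)
  define \<omega> where "\<omega> = unit_ball_vol (real n)"
  have \<omega>: "\<omega> > 0" by (simp add: \<omega>_def)
  define v where "v = measure lborel {x. a < \<bar>U x\<bar>}"
  have v: "emeasure lborel {x. a < \<bar>U x\<bar>} = ennreal v"
    unfolding v_def using fin by (simp add: emeasure_eq_ennreal_measure less_top)
  have "v \<ge> 0" by (simp add: v_def)
  \<comment> \<open>R \<ge> 1 gives R \<le> R^n, so \<open>v\<close> is at most half the volume of a
    ball of radius \<open>R\<close>.\<close>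
  define R where "R = max 1 (2 * v / \<omega>)"
  have R: "R \<ge> 1" by (simp add: R_def)
  have vR: "v \<le> \<omega> * R ^ n / 2"
  proof -
    have "2 * v / \<omega> \<le> R" by (simp add: R_def)
    also have "R \<le> R ^ n" using R n by (simp add: self_le_power)
    finally show ?thesis using \<omega> by (simp add: field_simps)
  qed
  let ?I = "\<lambda>x h. \<integral>\<^sup>+s. indicator {0..1} s * (ennreal (shell_gradient a b (x + s *\<^sub>R h)) * ennreal (norm h)) \<partial>lborel"
  let ?P = "\<lambda>x. \<integral>\<^sup>+z. ennreal (shell_gradient a b z) * ennreal (1 / norm (x - z) ^ (n - 1)) \<partial>lborel"
  have [measurable]: "ball (0::real^'n) R \<in> sets borel" by simp
  \<comment> \<open>The set {|U| > a} has total measure \<open>v\<close>, so it covers at most half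
    of any ball of radius \<open>R\<close>, wherever its centre \<open>x\<close> lies.\<close>
  have lower: "ennreal (\<omega> * R ^ n / 2) \<le> (\<integral>\<^sup>+h. indicator (ball 0 R) h * indicator {z. \<bar>U z\<bar> \<le> a} (x + h) \<partial>lborel)" for x
  proof -
    have "ennreal (\<omega> * R ^ n) = emeasure lborel (ball (0::real^'n) R)"
      using R by (simp add: emeasure_ball \<omega>_def n_def)
    also have "\<dots> = (\<integral>\<^sup>+h. indicator (ball (0::real^'n) R) h \<partial>lborel)"
      by simp
    also have "\<dots> \<le> (\<integral>\<^sup>+h. indicator (ball 0 R) h * indicator {z. \<bar>U z\<bar> \<le> a} (x + h) + indicator {z. a < \<bar>U z\<bar>} (h + x) \<partial>lborel)"
      by (intro nn_integral_mono) (auto simp: indicator_def add.commute)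
    also have "\<dots> = (\<integral>\<^sup>+h. indicator (ball 0 R) h * indicator {z. \<bar>U z\<bar> \<le> a} (x + h) \<partial>lborel) + (\<integral>\<^sup>+h. indicator {z. a < \<bar>U z\<bar>} (h + x) \<partial>lborel)"
      by (rule nn_integral_add) measurable
    also have "(\<integral>\<^sup>+h. indicator {z. a < \<bar>U z\<bar>} (h + x) \<partial>lborel) = ennreal v"
      by (subst nn_integral_lborel_translate) (auto simp: v)
    also have "\<dots> \<le> ennreal (\<omega> * R ^ n / 2)" using vR by (rule ennreal_leI)
    finally have *: "ennreal (\<omega> * R ^ n / 2) + ennreal (\<omega> * R ^ n / 2)
        \<le> (\<integral>\<^sup>+h. indicator (ball 0 R) h * indicator {z. \<bar>U z\<bar> \<le> a} (x + h) \<partial>lborel) + ennreal (\<omega> * R ^ n / 2)"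
      using \<omega> R by (simp add: ennreal_plus[symmetric] add_mono del: ennreal_plus)
    then show ?thesis by (simp add: ennreal_add_left_cancel_le add.commute)
  qed
  have "ennreal (\<omega> * R ^ n / 2) * (ennreal (b - a) * emeasure lborel S)
      = (\<integral>\<^sup>+x. ennreal (b - a) * indicator S x * ennreal (\<omega> * R ^ n / 2) \<partial>lborel)"
    by (simp add: nn_integral_cmult nn_integral_multc ac_simps)
  also have "\<dots> \<le> (\<integral>\<^sup>+x. ennreal (b - a) * indicator S x * (\<integral>\<^sup>+h. indicator (ball 0 R) h * indicator {z. \<bar>U z\<bar> \<le> a} (x + h) \<partial>lborel) \<partial>lborel)"
    by (intro nn_integral_mono mult_left_mono lower) auto
  also have "\<dots> = (\<integral>\<^sup>+x. (\<integral>\<^sup>+h. ennreal (b - a) * indicator S x * (indicator (ball 0 R) h * indicator {z. \<bar>U z\<bar> \<le> a} (x + h)) \<partial>lborel) \<partial>lborel)"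
    by (subst nn_integral_cmult[symmetric]) auto
  also have "\<dots> = (\<integral>\<^sup>+h. (\<integral>\<^sup>+x. ennreal (b - a) * indicator S x * (indicator (ball 0 R) h * indicator {z. \<bar>U z\<bar> \<le> a} (x + h)) \<partial>lborel) \<partial>lborel)"
    by (rule lborel_pair.Fubini'[symmetric]) measurable
  also have "\<dots> \<le> (\<integral>\<^sup>+h. (\<integral>\<^sup>+x. indicator S x * (indicator (ball 0 R) h * ?I x h) \<partial>lborel) \<partial>lborel)"
  proof (rule nn_integral_mono, rule nn_integral_mono_AE)
    fix h
    show "AE x in lborel. ennreal (b - a) * indicator S x * (indicator (ball 0 R) h * indicator {z. \<bar>U z\<bar> \<le> a} (x + h))
      \<le> indicator S x * (indicator (ball 0 R) h * ?I x h)"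
      using AE_gap_le_segment_integral[OF ab, of h]
    proof eventually_elim
      case (elim x)
      then show ?case using S_sub by (auto simp: indicator_def)
    qed
  qed
  also have "\<dots> = (\<integral>\<^sup>+x. (\<integral>\<^sup>+h. indicator S x * (indicator (ball 0 R) h * ?I x h) \<partial>lborel) \<partial>lborel)"
    by (rule lborel_pair.Fubini') measurable
  also have "\<dots> = (\<integral>\<^sup>+x. indicator S x * (\<integral>\<^sup>+h. indicator (ball 0 R) h * ?I x h \<partial>lborel) \<partial>lborel)"
    by (subst nn_integral_cmult[symmetric]) auto
  also have "\<dots> \<le> (\<integral>\<^sup>+x. indicator S x * (ennreal (R ^ n / real n) * ?P x) \<partial>lborel)"
    using R nn_integral_ball_segments_le[of "\<lambda>z. ennreal (shell_gradient a b z)" R]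
    by (intro nn_integral_mono mult_left_mono) (auto simp: n_def)
  also have "\<dots> = ennreal (R ^ n / real n) * (\<integral>\<^sup>+x. indicator S x * ?P x \<partial>lborel)"
    by (subst nn_integral_cmult[symmetric]) (auto simp: ac_simps)
  finally have main: "ennreal (\<omega> * R ^ n / 2) * (ennreal (b - a) * emeasure lborel S)
    \<le> ennreal (R ^ n / real n) * (\<integral>\<^sup>+x. indicator S x * ?P x \<partial>lborel)" .
  \<comment> \<open>The powers of \<open>R\<close> cancel. This is why the constant depends on the
    dimension only, although \<open>R\<close> depends on \<open>U\<close>.\<close>
  have "ennreal (b - a) * emeasure lborel S
      = ennreal (2 / (\<omega> * R ^ n)) * (ennreal (\<omega> * R ^ n / 2) * (ennreal (b - a) * emeasure lborel S))"
    using \<omega> R by (simp add: mult.assoc[symmetric] ennreal_mult[symmetric])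
  also have "\<dots> \<le> ennreal (2 / (\<omega> * R ^ n)) * (ennreal (R ^ n / real n) * (\<integral>\<^sup>+x. indicator S x * ?P x \<partial>lborel))"
    by (intro mult_left_mono main) auto
  also have "\<dots> = ennreal (2 / (real n * \<omega>)) * (\<integral>\<^sup>+x. indicator S x * ?P x \<partial>lborel)"
  proof -
    have "R ^ n > 0" using R by simp
    then have "2 / (\<omega> * R ^ n) * (R ^ n / real n) = 2 / (real n * \<omega>)"
      using R by auto
    moreover have "ennreal (2 / (\<omega> * R ^ n)) * ennreal (R ^ n / real n) = ennreal (2 / (\<omega> * R ^ n) * (R ^ n / real n))"
      using \<omega> R by (intro ennreal_mult[symmetric]) auto
    ultimately show ?thesis by (simp only: mult.assoc[symmetric])
  qed
  finally show ?thesis by (simp add: n_def \<omega>_def)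
qed

end

subsection \<open>Young functions\<close>

lemma borel_measurable_mono_ennreal:
  fixes f :: "real \<Rightarrow> ennreal"
  assumes "mono f" shows "f \<in> borel_measurable borel"
proof (rule borel_measurableI_greater)
  fix c
  have "is_interval {x. c < f x}"
    using assms unfolding is_interval_1 mono_def by (auto intro: less_le_trans)
  then show "{x \<in> space borel. c < f x} \<in> sets borel"
    using real_interval_borel_measurable by simp
qed

text \<open>The chord from the origin lies above the graph because \<phi> 0 = 0; equivalently
  \<phi>(t)/t is non-decreasing. Every later use of convexity goes through this form.\<close>

lemma young_scale:
  assumes "young_function \<phi>" "0 < y" "0 \<le> x" "x \<le> y"
  shows "\<phi> x \<le> ennreal (x / y) * \<phi> y"
proof -
  have "\<phi> ((1 - x / y) * 0 + (x / y) * y) \<le> ennreal (1 - x / y) * \<phi> 0 + ennreal (x / y) * \<phi> y"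
  proof -
    have "\<forall>x\<ge>0. \<forall>y\<ge>0. \<forall>s\<in>{0..1}. \<phi> ((1 - s) * x + s * y) \<le> ennreal (1 - s) * \<phi> x + ennreal s * \<phi> y"
      using assms(1) unfolding young_function_def by blast
    moreover have "x / y \<in> {0..1}" using assms by simp
    ultimately show ?thesis using assms(2) by (meson less_imp_le order_refl)
  qed
  then show ?thesis using assms by (simp add: young_function_def)
qed

lemma young_mono:
  assumes "young_function \<phi>" "0 \<le> x" "x \<le> y"
  shows "\<phi> x \<le> \<phi> y"
proof (cases "y = 0")
  case False
  then have "\<phi> x \<le> ennreal (x / y) * \<phi> y" using assms by (intro young_scale) auto
  also have "\<dots> \<le> 1 * \<phi> y" using assms False by (intro mult_right_mono) auto
  finally show ?thesis by simp
qed (use assms in auto)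

text \<open>Nothing is known about \<open>\<phi>\<close> at negative arguments, so monotonicity, and
  with it measurability, is available only after cutting the argument at 0.\<close>

lemma young_max_borel:
  assumes "young_function \<phi>" shows "(\<lambda>t. \<phi> (max 0 t)) \<in> borel_measurable borel"
  using young_mono[OF assms] by (intro borel_measurable_mono_ennreal) (auto simp: mono_def)

lemma young_compose_borel:
  assumes \<phi>: "young_function \<phi>" and [measurable]: "f \<in> borel_measurable M" and "\<And>x. 0 \<le> f x"
  shows "(\<lambda>x. \<phi> (f x)) \<in> borel_measurable M"
proof -
  have "(\<lambda>x. \<phi> (max 0 (f x))) \<in> borel_measurable M"
    by (rule measurable_compose[OF assms(2) young_max_borel[OF \<phi>]])
  moreover have "max 0 (f x) = f x" for x using assms(3)[of x] by simp
  ultimately show ?thesis by simp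
qed

lemma epowr_mono: "0 < p \<Longrightarrow> x \<le> y \<Longrightarrow> epowr x p \<le> epowr y p"
  by (cases x; cases y) (auto simp: epowr_def top_unique intro!: ennreal_leI powr_mono2)

lemma epowr_ennreal: "0 \<le> x \<Longrightarrow> epowr (ennreal x) p = ennreal (x powr p)"
  by (simp add: epowr_def)

lemma epowr_borel [measurable]: "0 < p \<Longrightarrow> (\<lambda>x. epowr x p) \<in> borel_measurable borel"
  unfolding epowr_def by measurable

text \<open>For \<sigma> < h the integrand is at most \<phi>(h)/h, and the interval has length at
  most h. Together with Fubini this turns the measures of the layers, weighted by
  \<phi>(\<sigma>)/\<sigma>, into the energy.\<close>

lemma nn_integral_young_ratio_le:
  assumes \<phi>: "young_function \<phi>" and "0 \<le> h"
  shows "(\<integral>\<^sup>+\<sigma>. indicator {1..r} \<sigma> * (indicator {..<h} \<sigma> * (\<phi> (max 0 \<sigma>) / ennreal \<sigma>)) \<partial>lborel) \<le> \<phi> h"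
proof (cases "h = 0")
  case True
  have "indicator {1..r} \<sigma> * (indicator {..<h} \<sigma> * (\<phi> (max 0 \<sigma>) / ennreal \<sigma>)) = 0" for \<sigma>
    using True by (auto simp: indicator_def)
  then have "(\<integral>\<^sup>+\<sigma>. indicator {1..r} \<sigma> * (indicator {..<h} \<sigma> * (\<phi> (max 0 \<sigma>) / ennreal \<sigma>)) \<partial>lborel)
      = (\<integral>\<^sup>+\<sigma>. 0 \<partial>(lborel :: real measure))"
    by (rule nn_integral_cong)
  then show ?thesis by simp
next
  case False
  then have h: "h > 0" using assms by simp
  have "(\<integral>\<^sup>+\<sigma>. indicator {1..r} \<sigma> * (indicator {..<h} \<sigma> * (\<phi> (max 0 \<sigma>) / ennreal \<sigma>)) \<partial>lborel)
      \<le> (\<integral>\<^sup>+\<sigma>. (ennreal (1 / h) * \<phi> h) * indicator {0..h} \<sigma> \<partial>lborel)"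
  proof (rule nn_integral_mono)
    fix \<sigma>
    have "\<phi> \<sigma> / ennreal \<sigma> \<le> ennreal (1 / h) * \<phi> h" if "1 \<le> \<sigma>" "\<sigma> < h"
    proof -
      have "\<phi> \<sigma> / ennreal \<sigma> \<le> (ennreal (\<sigma> / h) * \<phi> h) / ennreal \<sigma>"
        using that h by (intro divide_right_mono_ennreal young_scale[OF \<phi>]) auto
      also have "\<dots> = (ennreal (\<sigma> / h) / ennreal \<sigma>) * \<phi> h"
        by (simp add: ennreal_times_divide mult.commute)
      also have "ennreal (\<sigma> / h) / ennreal \<sigma> = ennreal (1 / h)"
        using that h by (subst divide_ennreal) auto
      finally show ?thesis .
    qed
    then show "indicator {1..r} \<sigma> * (indicator {..<h} \<sigma> * (\<phi> (max 0 \<sigma>) / ennreal \<sigma>)) \<le> (ennreal (1 / h) * \<phi> h) * indicator {0..h} \<sigma>"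
      by (auto simp: indicator_def)
  qed
  also have "\<dots> = (ennreal (1 / h) * \<phi> h) * ennreal h"
    using h by (subst nn_integral_cmult_indicator) auto
  also have "\<dots> = (ennreal (1 / h) * ennreal h) * \<phi> h" by (simp only: ac_simps)
  also have "\<dots> = \<phi> h" using h by (simp add: ennreal_mult[symmetric])
  finally show ?thesis by simp
qed

section \<open>Layers and the Riesz potential of the bounded part\<close>

lemma ennreal_min_eq_layers:
  assumes "0 \<le> h" "0 \<le> r"
  shows "ennreal (min h r) = (\<integral>\<^sup>+\<sigma>. indicator {0..r} \<sigma> * indicator {..<h} \<sigma> \<partial>lborel)"
proof -
  have "(\<integral>\<^sup>+\<sigma>. indicator {0..r} \<sigma> * indicator {..<h} \<sigma> \<partial>lborel) = emeasure lborel ({0..r} \<inter> {..<h})"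
    by (simp add: indicator_inter_arith[symmetric])
  also have "{0..r} \<inter> {..<h} = (if h \<le> r then {0..<h} else {0..r})" by auto
  also have "emeasure lborel \<dots> = ennreal (min h r)" using assms by auto
  finally show ?thesis ..
qed

abbreviation riesz_const :: "nat \<Rightarrow> real" where
  "riesz_const n \<equiv> 2 ^ (n + 1) * unit_ball_vol (real n) + 1"

lemma powr_split:
  fixes n :: nat
  assumes n: "n \<ge> 2" and s: "s > 0"
  shows "s powr (- (1 / (real n - 1))) * s powr (real n / (real n - 1)) = s"
proof -
  have "- (1 / (real n - 1)) + real n / (real n - 1) = 1"
    using n by (simp add: diff_divide_distrib[symmetric])
  then show ?thesis using s by (simp add: powr_add[symmetric])
qed

text \<open>The potential of the layer {H > \<sigma>} is at most a constant times the n-th root of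
  its measure. Integrating over \<sigma> from 0 to \<open>r\<close>, the heights below 1 contribute
  M, since the support has measure at most M^n. Above 1 the root is bounded by two terms, one
  integrating to a multiple of the energy and one to a multiple of the integral in \<open>J\<close>;
  each contributes s M. With s \<ge> 1 the total is at most 3 s M, which explains the factor
  3.\<close>

lemma riesz_potential_low_part:
  fixes H :: "'a::euclidean_space \<Rightarrow> real" and \<phi> :: "real \<Rightarrow> ennreal"
  defines "n \<equiv> DIM('a)"
  assumes n: "n \<ge> 2" and \<phi>: "young_function \<phi>" and \<phi>1: "\<phi> 1 > 0"
    and H[measurable]: "H \<in> borel_measurable borel" and H0: "\<And>z. 0 \<le> H z"
    and M: "M > 0" and supp: "emeasure lborel {z. 0 < H z} \<le> ennreal (M ^ n)"
    and energy: "(\<integral>\<^sup>+z. \<phi> (H z) \<partial>lborel) \<le> ennreal (M ^ n)"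
    and r: "r \<ge> 1" and s: "s \<ge> 1"
    and J: "(\<integral>\<^sup>+\<tau>\<in>{1..r}. epowr (ennreal \<tau> / \<phi> \<tau>) (1 / (real n - 1)) \<partial>lborel) \<le> ennreal (s powr (real n / (real n - 1)))"
  shows "(\<integral>\<^sup>+z. ennreal (min (H z) r) * ennreal (1 / norm (x - z) ^ (n - 1)) \<partial>lborel) \<le> ennreal (3 * riesz_const n * s * M)"
proof -
  define k where "k = (\<lambda>z. ennreal (1 / norm (x - z) ^ (n - 1)))"
  have [measurable]: "k \<in> borel_measurable borel" unfolding k_def by measurable
  define K where "K = riesz_const n"
  have K: "K > 0" unfolding K_def by (intro add_nonneg_pos mult_nonneg_nonneg) auto
  define p where "p = 1 / (real n - 1)"
  have p: "p > 0" using n by (simp add: p_def)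
  define \<phi>' where "\<phi>' = (\<lambda>t. \<phi> (max 0 t))"
  have [measurable]: "\<phi>' \<in> borel_measurable borel" unfolding \<phi>'_def by (rule young_max_borel[OF \<phi>])
  have \<phi>'_eq: "\<phi>' t = \<phi> t" if "t \<ge> 0" for t using that by (simp add: \<phi>'_def)
  have \<phi>H[measurable]: "(\<lambda>z. \<phi> (H z)) \<in> borel_measurable borel"
    by (rule young_compose_borel[OF \<phi> H H0])
  define D where "D = (\<lambda>\<sigma>. emeasure lborel {z. \<sigma> < H z})"
  have D_nn: "D \<sigma> = (\<integral>\<^sup>+z. indicator {..<H z} \<sigma> \<partial>lborel)" for \<sigma>
  proof -
    have "(\<integral>\<^sup>+z. indicator {..<H z} \<sigma> \<partial>lborel) = (\<integral>\<^sup>+z. indicator {z. \<sigma> < H z} z \<partial>lborel)"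
      by (intro nn_integral_cong) (auto simp: indicator_def)
    then show ?thesis by (simp add: D_def)
  qed
  have [measurable]: "(\<lambda>(z, \<sigma>). indicator {..<H z} \<sigma> :: ennreal) \<in> borel_measurable (borel \<Otimes>\<^sub>M borel)"
    "(\<lambda>(\<sigma>, z). indicator {..<H z} \<sigma> :: ennreal) \<in> borel_measurable (borel \<Otimes>\<^sub>M borel)"
    unfolding indicator_def lessThan_iff by measurable
  have [measurable]: "D \<in> borel_measurable borel"
    unfolding D_nn by measurable
  \<comment> \<open>An integrable majorant of the n-th root of \<open>D \<sigma>\<close>. That both
    indicators equal 1 at \<sigma> = 1 does no harm to an upper bound.\<close>
  define \<Lambda> where "\<Lambda> = (\<lambda>\<sigma>. ennreal M * indicator {0..1} \<sigma> + indicator {1..r} \<sigma> *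
     (ennreal (s / M ^ (n - 1)) * (\<phi>' \<sigma> / ennreal \<sigma> * D \<sigma>) + ennreal (M * s powr (- p)) * epowr (ennreal \<sigma> / \<phi>' \<sigma>) p))"
  have layer: "(\<integral>\<^sup>+z. indicator {..<H z} \<sigma> * k z \<partial>lborel) \<le> ennreal K * \<Lambda> \<sigma>" if \<sigma>: "0 < \<sigma>" "\<sigma> \<le> r" for \<sigma>
  proof -
    have eq: "(\<integral>\<^sup>+z. indicator {..<H z} \<sigma> * k z \<partial>lborel) = (\<integral>\<^sup>+z. indicator {z. \<sigma> < H z} z * k z \<partial>lborel)"
      by (intro nn_integral_cong) (auto simp: indicator_def)
    have D_le: "D \<sigma> \<le> ennreal (M ^ n)"
    proof -
      have "D \<sigma> \<le> emeasure lborel {z. 0 < H z}"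
        unfolding D_def using \<sigma> by (intro emeasure_mono) auto
      then show ?thesis using supp by (rule order_trans)
    qed
    have kernel: "(\<integral>\<^sup>+z. indicator {z. \<sigma> < H z} z * k z \<partial>lborel) \<le> ennreal (K * R)"
      if "R > 0" "D \<sigma> \<le> ennreal (R ^ n)" for R
      using riesz_kernel_integral_le[of "{z. \<sigma> < H z}" R x] that unfolding K_def k_def n_def D_def by simp
    show ?thesis
    proof (cases "\<sigma> < 1")
      case True
      have "(\<integral>\<^sup>+z. indicator {z. \<sigma> < H z} z * k z \<partial>lborel) \<le> ennreal (K * M)"
        using kernel M D_le by blast
      also have "\<dots> = ennreal K * (ennreal M * indicator {0..1} \<sigma>)"
        using True \<sigma> K M by (simp add: ennreal_mult)
      also have "\<dots> \<le> ennreal K * \<Lambda> \<sigma>"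
        unfolding \<Lambda>_def by (intro mult_left_mono) auto
      finally show ?thesis using eq by simp
    next
      case False
      then have \<sigma>1: "1 \<le> \<sigma>" by simp
      show ?thesis
      proof (cases "D \<sigma> = 0")
        case True
        then have "AE z in lborel. \<not> \<sigma> < H z"
          unfolding D_def by (subst AE_iff_measurable[OF _ refl]) auto
        then have "(\<integral>\<^sup>+z. indicator {z. \<sigma> < H z} z * k z \<partial>lborel) = (\<integral>\<^sup>+z. 0 \<partial>(lborel :: 'a measure))"
          by (intro nn_integral_cong_AE) (auto simp: indicator_def)
        then show ?thesis using eq by simp
      next
        case D0: False
        obtain d where d: "D \<sigma> = ennreal d" "d > 0"
          using D_le D0 by (cases "D \<sigma>") (auto simp: top_unique less_le)
        \<comment> \<open>Markov's inequality: a layer of positive measure forces \<phi>(\<sigma>)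
          to be finite. It is also at least \<phi>(1) > 0, so real arithmetic applies.\<close>
        have "\<phi> \<sigma> * D \<sigma> = (\<integral>\<^sup>+z. \<phi> \<sigma> * indicator {z. \<sigma> < H z} z \<partial>lborel)"
          by (simp add: D_def nn_integral_cmult_indicator)
        also have "\<dots> \<le> (\<integral>\<^sup>+z. \<phi> (H z) \<partial>lborel)"
          using young_mono[OF \<phi>, of \<sigma>] \<sigma> by (intro nn_integral_mono) (auto simp: indicator_def)
        finally have "\<phi> \<sigma> * D \<sigma> < \<infinity>" using energy by (auto simp: less_top[symmetric] top_unique)
        then have "\<phi> \<sigma> < \<infinity>" using D0 by (auto simp: ennreal_mult_less_top)
        moreover have "\<phi> \<sigma> > 0" using \<phi>1 young_mono[OF \<phi>, of 1 \<sigma>] \<sigma>1 by (auto intro: less_le_trans)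
        ultimately obtain f where f: "\<phi> \<sigma> = ennreal f" "f > 0"
          by (cases "\<phi> \<sigma>") auto
        txt \<open>In place of Hoelder's inequality: \<open>d = X Y\<^bsup>n-1\<^esup> \<le> (X + Y)\<^sup>n\<close>, where \<open>X\<close> and \<open>Y\<close> integrate in
          \<open>\<sigma>\<close> to the energy and to \<open>K\<^sub>n\<^bsup>n/(n-1)\<^esup>\<close>. Their weights make both integrals at most \<open>s M\<close>.\<close>
        define X where "X = s / M ^ (n - 1) * (f / \<sigma> * d)"
        define Y where "Y = M * s powr (- p) * (\<sigma> / f) powr p"
        have X0: "X > 0" using s M f d \<sigma> by (simp add: X_def)
        have Y0: "Y > 0" using s M f \<sigma> by (simp add: Y_def)
        have Yn: "Y ^ (n - 1) = M ^ (n - 1) * (1 / s) * (\<sigma> / f)"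
        proof -
          have e: "(t powr q) ^ (n - 1) = t powr (q * (real n - 1))" if "t > 0" for t q :: real
            using that n by (simp add: powr_realpow[symmetric] powr_powr of_nat_diff)
          have "p * (real n - 1) = 1" using n by (simp add: p_def)
          then have "((\<sigma> / f) powr p) ^ (n - 1) = \<sigma> / f" "(s powr (- p)) ^ (n - 1) = 1 / s"
            using e[of "\<sigma> / f" p] e[of s "- p"] s \<sigma> f by (simp_all add: powr_minus_divide)
          then show ?thesis
            unfolding Y_def power_mult_distrib by (simp only:)
        qed
        have "d = X * Y ^ (n - 1)"
          unfolding Yn X_def using s M f \<sigma> by (simp add: field_simps)
        also have "\<dots> \<le> (X + Y) * (X + Y) ^ (n - 1)"
          using X0 Y0 by (intro mult_mono power_mono) auto
        also have "\<dots> = (X + Y) ^ n" using n by (simp add: power_eq_if)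
        finally have "D \<sigma> \<le> ennreal ((X + Y) ^ n)" using d by (simp add: ennreal_leI)
        then have "(\<integral>\<^sup>+z. indicator {z. \<sigma> < H z} z * k z \<partial>lborel) \<le> ennreal (K * (X + Y))"
          using kernel X0 Y0 by (simp add: add_pos_pos)
        also have "\<dots> = ennreal K * (ennreal X + ennreal Y)"
          using K X0 Y0 by (simp add: ennreal_mult)
        also have "ennreal X = ennreal (s / M ^ (n - 1)) * (\<phi>' \<sigma> / ennreal \<sigma> * D \<sigma>)"
          using s M f d \<sigma> by (simp add: X_def \<phi>'_eq divide_ennreal ennreal_mult[symmetric])
        also have "ennreal Y = ennreal (M * s powr (- p)) * epowr (ennreal \<sigma> / \<phi>' \<sigma>) p"
          using s M f \<sigma> by (simp add: Y_def \<phi>'_eq divide_ennreal epowr_ennreal ennreal_mult[symmetric])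
        also have "ennreal K * (ennreal (s / M ^ (n - 1)) * (\<phi>' \<sigma> / ennreal \<sigma> * D \<sigma>)
            + ennreal (M * s powr (- p)) * epowr (ennreal \<sigma> / \<phi>' \<sigma>) p) \<le> ennreal K * \<Lambda> \<sigma>"
          unfolding \<Lambda>_def using \<sigma> \<sigma>1 by (intro mult_left_mono) auto
        finally show ?thesis using eq by simp
      qed
    qed
  qed
  have "(\<integral>\<^sup>+z. ennreal (min (H z) r) * k z \<partial>lborel)
      = (\<integral>\<^sup>+z. (\<integral>\<^sup>+\<sigma>. indicator {0..r} \<sigma> * (indicator {..<H z} \<sigma> * k z) \<partial>lborel) \<partial>lborel)"
    using r H0 by (subst ennreal_min_eq_layers) (auto simp: nn_integral_multc[symmetric] mult.assoc intro!: nn_integral_cong)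
  also have "\<dots> = (\<integral>\<^sup>+\<sigma>. (\<integral>\<^sup>+z. indicator {0..r} \<sigma> * (indicator {..<H z} \<sigma> * k z) \<partial>lborel) \<partial>lborel)"
    by (rule lborel_pair.Fubini') measurable
  also have "\<dots> = (\<integral>\<^sup>+\<sigma>. indicator {0..r} \<sigma> * (\<integral>\<^sup>+z. indicator {..<H z} \<sigma> * k z \<partial>lborel) \<partial>lborel)"
    by (subst nn_integral_cmult[symmetric]) auto
  also have "\<dots> \<le> (\<integral>\<^sup>+\<sigma>. ennreal K * \<Lambda> \<sigma> \<partial>lborel)"
  proof (rule nn_integral_mono_AE)
    have "AE \<sigma> in lborel. \<sigma> \<noteq> (0::real)" by (rule AE_lborel_singleton)
    then show "AE \<sigma> in lborel. indicator {0..r} \<sigma> * (\<integral>\<^sup>+z. indicator {..<H z} \<sigma> * k z \<partial>lborel) \<le> ennreal K * \<Lambda> \<sigma>"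
      by eventually_elim (use layer in \<open>auto simp: indicator_def\<close>)
  qed
  also have "\<dots> = ennreal K * (ennreal M + (ennreal (s / M ^ (n - 1)) * (\<integral>\<^sup>+\<sigma>. indicator {1..r} \<sigma> * (\<phi>' \<sigma> / ennreal \<sigma> * D \<sigma>) \<partial>lborel)
      + ennreal (M * s powr (- p)) * (\<integral>\<^sup>+\<sigma>. indicator {1..r} \<sigma> * epowr (ennreal \<sigma> / \<phi>' \<sigma>) p \<partial>lborel)))"
  proof -
    have [measurable]: "(\<lambda>\<sigma>. epowr (ennreal \<sigma> / \<phi>' \<sigma>) p) \<in> borel_measurable borel"
      using p by measurable
    have "(\<integral>\<^sup>+\<sigma>. ennreal K * \<Lambda> \<sigma> \<partial>lborel) = ennreal K * (\<integral>\<^sup>+\<sigma>. \<Lambda> \<sigma> \<partial>lborel)"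
      unfolding \<Lambda>_def by (rule nn_integral_cmult) measurable
    also have "(\<integral>\<^sup>+\<sigma>. \<Lambda> \<sigma> \<partial>lborel) = (\<integral>\<^sup>+\<sigma>. ennreal M * indicator {0..1::real} \<sigma> + (ennreal (s / M ^ (n - 1)) * (indicator {1..r} \<sigma> * (\<phi>' \<sigma> / ennreal \<sigma> * D \<sigma>))
      + ennreal (M * s powr (- p)) * (indicator {1..r} \<sigma> * epowr (ennreal \<sigma> / \<phi>' \<sigma>) p)) \<partial>lborel)"
      unfolding \<Lambda>_def by (intro nn_integral_cong) (auto simp: indicator_def)
    also have "\<dots> = (\<integral>\<^sup>+\<sigma>. ennreal M * indicator {0..1::real} \<sigma> \<partial>lborel) + ((\<integral>\<^sup>+\<sigma>. ennreal (s / M ^ (n - 1)) * (indicator {1..r} \<sigma> * (\<phi>' \<sigma> / ennreal \<sigma> * D \<sigma>)) \<partial>lborel)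
      + (\<integral>\<^sup>+\<sigma>. ennreal (M * s powr (- p)) * (indicator {1..r} \<sigma> * epowr (ennreal \<sigma> / \<phi>' \<sigma>) p) \<partial>lborel))"
      by (subst nn_integral_add, measurable, subst nn_integral_add, measurable)
    also have "\<dots> = ennreal M + (ennreal (s / M ^ (n - 1)) * (\<integral>\<^sup>+\<sigma>. indicator {1..r} \<sigma> * (\<phi>' \<sigma> / ennreal \<sigma> * D \<sigma>) \<partial>lborel)
      + ennreal (M * s powr (- p)) * (\<integral>\<^sup>+\<sigma>. indicator {1..r} \<sigma> * epowr (ennreal \<sigma> / \<phi>' \<sigma>) p \<partial>lborel))"
      by (simp add: nn_integral_cmult nn_integral_cmult_indicator)
    finally show ?thesis .
  qed
  also have "\<dots> \<le> ennreal K * (ennreal M + (ennreal (s / M ^ (n - 1)) * ennreal (M ^ n)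
      + ennreal (M * s powr (- p)) * ennreal (s powr (real n / (real n - 1)))))"
  proof (intro mult_left_mono add_left_mono add_mono)
    \<comment> \<open>After Fubini the inner integral at the point \<open>z\<close> runs over the
      heights below \<open>H z\<close> and is at most \<phi>(H z).\<close>
    have "(\<integral>\<^sup>+\<sigma>. indicator {1..r} \<sigma> * (\<phi>' \<sigma> / ennreal \<sigma> * D \<sigma>) \<partial>lborel)
        = (\<integral>\<^sup>+\<sigma>. (\<integral>\<^sup>+z. indicator {1..r} \<sigma> * (indicator {..<H z} \<sigma> * (\<phi>' \<sigma> / ennreal \<sigma>)) \<partial>lborel) \<partial>lborel)"
      unfolding D_nn by (simp add: nn_integral_cmult nn_integral_multc ac_simps)
    also have "\<dots> = (\<integral>\<^sup>+z. (\<integral>\<^sup>+\<sigma>. indicator {1..r} \<sigma> * (indicator {..<H z} \<sigma> * (\<phi>' \<sigma> / ennreal \<sigma>)) \<partial>lborel) \<partial>lborel)"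
      by (rule lborel_pair.Fubini'[symmetric]) measurable
    also have "\<dots> \<le> (\<integral>\<^sup>+z. \<phi> (H z) \<partial>lborel)"
      unfolding \<phi>'_def by (intro nn_integral_mono nn_integral_young_ratio_le \<phi> H0)
    finally show "(\<integral>\<^sup>+\<sigma>. indicator {1..r} \<sigma> * (\<phi>' \<sigma> / ennreal \<sigma> * D \<sigma>) \<partial>lborel) \<le> ennreal (M ^ n)"
      using energy by (rule order_trans)
    have "(\<integral>\<^sup>+\<sigma>. indicator {1..r} \<sigma> * epowr (ennreal \<sigma> / \<phi>' \<sigma>) p \<partial>lborel)
        = (\<integral>\<^sup>+\<tau>\<in>{1..r}. epowr (ennreal \<tau> / \<phi> \<tau>) (1 / (real n - 1)) \<partial>lborel)"
      by (intro nn_integral_cong) (auto simp: indicator_def \<phi>'_eq p_def)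
    then show "(\<integral>\<^sup>+\<sigma>. indicator {1..r} \<sigma> * epowr (ennreal \<sigma> / \<phi>' \<sigma>) p \<partial>lborel) \<le> ennreal (s powr (real n / (real n - 1)))"
      using J by simp
  qed auto
  also have "\<dots> = ennreal (K * (M + (s * M + M * s)))"
  proof -
    have 1: "s / M ^ (n - 1) * M ^ n = s * M"
      using M n by (cases n) auto
    have 2: "M * s powr (- p) * s powr (real n / (real n - 1)) = M * s"
      using powr_split[OF n, of s] s by (simp add: p_def mult.assoc)
    have "ennreal (s / M ^ (n - 1)) * ennreal (M ^ n) = ennreal (s * M)"
      using s M 1 by (simp add: ennreal_mult[symmetric])
    moreover have "ennreal (M * s powr (- p)) * ennreal (s powr (real n / (real n - 1))) = ennreal (M * s)"
      using s M 2 by (simp add: ennreal_mult[symmetric])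
    ultimately show ?thesis
      using K M s by (simp add: ennreal_mult[symmetric] ennreal_plus[symmetric] del: ennreal_plus)
  qed
  also have "\<dots> \<le> ennreal (3 * riesz_const n * s * M)"
  proof (rule ennreal_leI)
    have "K * (M + (s * M + M * s)) = K * M * (1 + 2 * s)" by (simp add: algebra_simps)
    also have "\<dots> \<le> K * M * (3 * s)" using K M s by (intro mult_left_mono) auto
    finally show "K * (M + (s * M + M * s)) \<le> 3 * riesz_const n * s * M"
      by (simp add: K_def ac_simps)
  qed
  finally show ?thesis unfolding k_def .
qed

section \<open>The generalized inverse of \<open>young_K\<close> and the function
  \<open>young_0\<close>\<close>

text \<open>The power \<open>K\<^sub>n\<^bsup>n/(n-1)\<^esup>\<close>, for \<open>t \<ge> 1\<close>.\<close>

definition young_J :: "nat \<Rightarrow> (real \<Rightarrow> ennreal) \<Rightarrow> real \<Rightarrow> ennreal" where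
  "young_J n \<phi> t = (\<integral>\<^sup>+\<tau>\<in>{1..t}. epowr (ennreal \<tau> / \<phi> \<tau>) (1 / (real n - 1)) \<partial>lborel)"

lemma young_J_le_of_young_K_le:
  assumes n: "n \<ge> 2" and "0 \<le> s" "1 \<le> t" "young_K n \<phi> t \<le> ennreal s"
  shows "young_J n \<phi> t \<le> ennreal (s powr (real n / (real n - 1)))"
proof -
  define q where "q = real n / (real n - 1)"
  have q: "q > 0" using n by (simp add: q_def)
  have le: "epowr (young_J n \<phi> t) (1 / q) \<le> ennreal s"
    using assms by (simp add: young_K_def young_J_def q_def)
  show ?thesis
  proof (cases "young_J n \<phi> t")
    case (real j)
    have "j powr (1 / q) \<le> s" using le real assms(2) by (simp add: epowr_ennreal)
    then have "(j powr (1 / q)) powr q \<le> s powr q" using q by (intro powr_mono2) auto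
    moreover have "(j powr (1 / q)) powr q = j" using q real by (simp add: powr_powr)
    ultimately show ?thesis unfolding q_def[symmetric] using real by (simp add: ennreal_leI)
  next
    case top
    then show ?thesis using le by (simp add: epowr_def top_unique)
  qed
qed

text \<open>Since \<phi>(t)/t is non-decreasing, \<tau>/\<phi>(\<tau>) is largest at 1. If \<phi>(1)
  is infinite, both sides are 0, because \<open>enn2real\<close> sends infinity to 0.\<close>

lemma young_ratio_bounded:
  assumes \<phi>: "young_function \<phi>" and \<phi>1: "\<phi> 1 > 0" and p: "p > 0" and \<tau>: "1 \<le> \<tau>"
  shows "epowr (ennreal \<tau> / \<phi> \<tau>) p \<le> ennreal ((1 / enn2real (\<phi> 1)) powr p)"
proof (cases "\<phi> \<tau>")
  case (real f)
  have "\<phi> 1 \<le> ennreal (1 / \<tau>) * \<phi> \<tau>" using \<tau> by (intro young_scale[OF \<phi>]) auto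
  also have "\<dots> = ennreal (f / \<tau>)" using real \<tau> by (simp add: ennreal_mult[symmetric])
  finally obtain g where g: "\<phi> 1 = ennreal g" "g > 0" "g \<le> f / \<tau>"
    using \<phi>1 real \<tau> by (cases "\<phi> 1") (auto simp: top_unique ennreal_le_iff)
  have "f / \<tau> > 0" using g by linarith
  then have f: "f > 0" using \<tau> by (simp add: zero_less_divide_iff)
  have "ennreal \<tau> / \<phi> \<tau> = ennreal (\<tau> / f)" using real f \<tau> by (simp add: divide_ennreal)
  moreover have "(\<tau> / f) powr p \<le> (1 / g) powr p"
    using g f \<tau> p by (intro powr_mono2) (auto simp: field_simps)
  ultimately show ?thesis using g f \<tau> by (simp add: epowr_ennreal ennreal_leI)
next
  case top
  then show ?thesis using p by (simp add: epowr_def)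
qed

lemma young_K_inv_infinite:
  assumes n: "n \<ge> 2" and s: "0 < s" and inf: "young_K_inv n \<phi> s = \<infinity>" and r: "1 \<le> r"
  shows "young_J n \<phi> r \<le> ennreal (s powr (real n / (real n - 1)))"
proof (rule young_J_le_of_young_K_le[OF n _ r])
  show "young_K n \<phi> r \<le> ennreal s"
  proof (rule ccontr)
    assume "\<not> young_K n \<phi> r \<le> ennreal s"
    then have "young_K_inv n \<phi> s \<le> ennreal r"
      using s unfolding young_K_inv_def by (auto intro: INF_lower)
    then show False using inf by (simp add: top_unique)
  qed
qed (use s in auto)

lemma young_K_inv_ge_1:
  assumes s: "0 < s" shows "1 \<le> young_K_inv n \<phi> s"
proof -
  have "1 \<le> r" if "ennreal s < young_K n \<phi> r" for r
    using that by (auto simp: young_K_def split: if_splits)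
  then show ?thesis using s unfolding young_K_inv_def by (auto intro!: INF_greatest)
qed

text \<open>Every r with 1 \<le> r < k satisfies K_n(r) \<le> s, as k is an infimum. The integrand
  defining \<open>young_J\<close> is bounded, so \<open>young_J\<close> is continuous where it is
  needed and the bound passes to k itself.\<close>

lemma young_K_inv_finite:
  assumes n: "n \<ge> 2" and \<phi>: "young_function \<phi>" and \<phi>1: "\<phi> 1 > 0"
    and s: "0 < s" and fin: "young_K_inv n \<phi> s \<noteq> \<infinity>"
  obtains k where "1 \<le> k" "young_K_inv n \<phi> s = ennreal k"
    "young_J n \<phi> k \<le> ennreal (s powr (real n / (real n - 1)))"
proof -
  obtain k where k: "young_K_inv n \<phi> s = ennreal k" "0 \<le> k"
    using fin by (cases "young_K_inv n \<phi> s") auto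
  have k1: "1 \<le> k" using young_K_inv_ge_1[OF s, of n \<phi>] k by simp
  have below: "young_J n \<phi> r \<le> ennreal (s powr (real n / (real n - 1)))" if r: "1 \<le> r" "r < k" for r
  proof (rule young_J_le_of_young_K_le[OF n _ r(1)])
    show "young_K n \<phi> r \<le> ennreal s"
    proof (rule ccontr)
      assume "\<not> young_K n \<phi> r \<le> ennreal s"
      then have "young_K_inv n \<phi> s \<le> ennreal r"
        using s unfolding young_K_inv_def by (auto intro: INF_lower)
      then show False using k r by simp
    qed
  qed (use s in auto)
  define B where "B = (1 / enn2real (\<phi> 1)) powr (1 / (real n - 1))"
  have B: "B \<ge> 0" by (simp add: B_def)
  have eps: "young_J n \<phi> k \<le> ennreal (s powr (real n / (real n - 1))) + ennreal e" if e: "e > 0" for e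
  proof (cases "k = 1")
    case True
    have "AE \<tau> in lborel. \<tau> \<noteq> (1::real)" by (rule AE_lborel_singleton)
    then have "young_J n \<phi> k = (\<integral>\<^sup>+\<tau>. 0 \<partial>(lborel :: real measure))"
      unfolding young_J_def True by (intro nn_integral_cong_AE) (auto simp: indicator_def elim!: eventually_mono)
    then show ?thesis by simp
  next
    case False
    \<comment> \<open>Chosen so that the piece of the integral over [r, k] is at most
      \<open>e\<close>; B + 1 replaces B, which may be 0, in the denominator.\<close>
    define r where "r = max 1 (k - e / (B + 1))"
    have r: "1 \<le> r" "r < k" "k - r \<le> e / (B + 1)" using False k1 e B by (auto simp: r_def)
    have phi_meas: "(\<lambda>\<tau>. \<phi> (max 0 \<tau>)) \<in> borel_measurable borel" by (rule young_max_borel[OF \<phi>])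
    have "young_J n \<phi> k \<le> (\<integral>\<^sup>+\<tau>. epowr (ennreal \<tau> / \<phi> (max 0 \<tau>)) (1 / (real n - 1)) * indicator {1..r} \<tau> + ennreal B * indicator {r..k} \<tau> \<partial>lborel)"
      unfolding young_J_def
    proof (rule nn_integral_mono)
      fix \<tau> :: real
      show "epowr (ennreal \<tau> / \<phi> \<tau>) (1 / (real n - 1)) * indicator {1..k} \<tau>
        \<le> epowr (ennreal \<tau> / \<phi> (max 0 \<tau>)) (1 / (real n - 1)) * indicator {1..r} \<tau> + ennreal B * indicator {r..k} \<tau>"
      proof -
        consider "\<tau> < 1 \<or> k < \<tau>" | "1 \<le> \<tau>" "\<tau> \<le> r" | "r < \<tau>" "\<tau> \<le> k" by linarith
        then show ?thesis
        proof cases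
          case 3
          then have "1 \<le> \<tau>" using r by simp
          then have "epowr (ennreal \<tau> / \<phi> \<tau>) (1 / (real n - 1)) \<le> ennreal B"
            using young_ratio_bounded[OF \<phi> \<phi>1, of "1 / (real n - 1)" \<tau>] n by (simp add: B_def)
          then show ?thesis using 3 r by simp
        qed (use r in auto)
      qed
    qed
    also have "\<dots> = (\<integral>\<^sup>+\<tau>. epowr (ennreal \<tau> / \<phi> (max 0 \<tau>)) (1 / (real n - 1)) * indicator {1..r} \<tau> \<partial>lborel) + (\<integral>\<^sup>+\<tau>. ennreal B * indicator {r..k} \<tau> \<partial>lborel)"
    proof (rule nn_integral_add)
      have [measurable]: "(\<lambda>x. epowr x (1 / (real n - 1))) \<in> borel_measurable borel"
        using n by (intro epowr_borel) simp
      note phi_meas[measurable]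
      show "(\<lambda>\<tau>. epowr (ennreal \<tau> / \<phi> (max 0 \<tau>)) (1 / (real n - 1)) * indicator {1..r} \<tau>) \<in> borel_measurable lborel"
        by measurable
    qed measurable
    also have "(\<integral>\<^sup>+\<tau>. epowr (ennreal \<tau> / \<phi> (max 0 \<tau>)) (1 / (real n - 1)) * indicator {1..r} \<tau> \<partial>lborel) = young_J n \<phi> r"
      unfolding young_J_def by (intro nn_integral_cong) (auto simp: indicator_def max_def)
    also have "(\<integral>\<^sup>+\<tau>. ennreal B * indicator {r..k} \<tau> \<partial>lborel) = ennreal (B * (k - r))"
      using r B by (simp add: nn_integral_cmult_indicator ennreal_mult)
    also have "young_J n \<phi> r + ennreal (B * (k - r)) \<le> ennreal (s powr (real n / (real n - 1))) + ennreal e"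
    proof (intro add_mono below r(1,2) ennreal_leI)
      have "B * (k - r) \<le> (B + 1) * (e / (B + 1))" using r B e by (intro mult_mono) auto
      then show "B * (k - r) \<le> e" using B by simp
    qed
    finally show ?thesis .
  qed
  have "young_J n \<phi> k \<le> ennreal (s powr (real n / (real n - 1)))"
    by (rule ennreal_le_epsilon) (rule eps)
  then show thesis by (rule that[OF k1 k(1)])
qed

lemma young_K_inv_mono:
  assumes "0 < s" "s \<le> t" shows "young_K_inv n \<phi> s \<le> young_K_inv n \<phi> t"
proof -
  have "{r. ennreal t < young_K n \<phi> r} \<subseteq> {r. ennreal s < young_K n \<phi> r}"
    using assms by (auto intro: le_less_trans[OF ennreal_leI])
  then have "(INF r\<in>{r. ennreal s < young_K n \<phi> r}. ennreal r) \<le> (INF r\<in>{r. ennreal t < young_K n \<phi> r}. ennreal r)"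
    by (rule INF_superset_mono) simp
  then show ?thesis using assms by (simp add: young_K_inv_def)
qed

text \<open>The integrand \<open>young_bar n \<phi> \<tau> / ennreal (\<tau> - 1)\<close> is
  non-decreasing, so its integral over the interval from 1 to t is at most the length t - 1 times
  its value at t. The monotonicity combines that of the inverse, of \<phi>(l)/l, and of the power q
  - 1 \<ge> 0.\<close>

lemma young_0_le_young_bar:
  assumes n: "n \<ge> 2" and \<phi>: "young_function \<phi>" and t: "t > 1"
  shows "young_0 n \<phi> t \<le> young_bar n \<phi> t"
proof (cases "young_bar n \<phi> t = \<infinity>")
  case False
  define q where "q = real n / (real n - 1)"
  have q: "q \<ge> 1" using n by (simp add: q_def)
  have fin: "young_K_inv n \<phi> (t - 1) \<noteq> \<infinity>" using False t by (auto simp: young_bar_def)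
  then obtain k where k: "young_K_inv n \<phi> (t - 1) = ennreal k" "0 \<le> k"
    by (cases "young_K_inv n \<phi> (t - 1)") auto
  have k1: "1 \<le> k" using young_K_inv_ge_1[of "t - 1" n \<phi>] k t by simp
  have bar_t: "young_bar n \<phi> t = epowr (\<phi> k / ennreal k * ennreal (t - 1)) q"
    using k t by (simp add: young_bar_def q_def)
  have "\<phi> k / ennreal k * ennreal (t - 1) \<noteq> \<infinity>"
    using False bar_t by (auto simp: epowr_def)
  then have "\<phi> k / ennreal k \<noteq> \<infinity>" using t by (auto simp: ennreal_mult_eq_top_iff)
  then obtain x where x: "\<phi> k / ennreal k = ennreal x" "0 \<le> x"
    by (cases "\<phi> k / ennreal k") auto
  have ratio: "young_bar n \<phi> \<tau> / ennreal (\<tau> - 1) \<le> ennreal ((x * (t - 1)) powr q / (t - 1))" if \<tau>: "1 < \<tau>" "\<tau> \<le> t" for \<tau>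
  proof -
    have "young_K_inv n \<phi> (\<tau> - 1) \<le> ennreal k"
      using young_K_inv_mono[of "\<tau> - 1" "t - 1" n \<phi>] \<tau> k by simp
    then obtain l where l: "young_K_inv n \<phi> (\<tau> - 1) = ennreal l" "0 \<le> l" "l \<le> k"
      using k by (cases "young_K_inv n \<phi> (\<tau> - 1)") (auto simp: top_unique)
    have l1: "1 \<le> l" using young_K_inv_ge_1[of "\<tau> - 1" n \<phi>] l \<tau> by simp
    have "\<phi> l / ennreal l \<le> (ennreal (l / k) * \<phi> k) / ennreal l"
      using l l1 by (intro divide_right_mono_ennreal young_scale[OF \<phi>]) auto
    also have "\<dots> = (ennreal (l / k) / ennreal l) * \<phi> k"
      by (simp add: ennreal_times_divide mult.commute)
    also have "ennreal (l / k) / ennreal l = 1 / ennreal k"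
      using l1 k1 by (simp add: divide_ennreal flip: ennreal_1)
    also have "1 / ennreal k * \<phi> k = ennreal x"
      using x by (simp add: ennreal_times_divide mult.commute)
    finally have le: "\<phi> l / ennreal l \<le> ennreal x" .
    have "young_bar n \<phi> \<tau> = epowr (\<phi> l / ennreal l * ennreal (\<tau> - 1)) q"
      using l \<tau> by (simp add: young_bar_def q_def)
    also have "\<dots> \<le> epowr (ennreal (x * (\<tau> - 1))) q"
      using q le x \<tau> by (intro epowr_mono) (auto simp: ennreal_mult intro: mult_right_mono)
    also have "\<dots> = ennreal ((x * (\<tau> - 1)) powr q)"
      using x \<tau> by (simp add: epowr_ennreal)
    finally have "young_bar n \<phi> \<tau> / ennreal (\<tau> - 1) \<le> ennreal ((x * (\<tau> - 1)) powr q) / ennreal (\<tau> - 1)"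
      by (rule divide_right_mono_ennreal)
    also have "\<dots> = ennreal ((x * (\<tau> - 1)) powr q / (\<tau> - 1))"
      using \<tau> by (simp add: divide_ennreal)
    also have "\<dots> \<le> ennreal ((x * (t - 1)) powr q / (t - 1))"
    proof (rule ennreal_leI)
      have e: "(x * y) powr q / y = x powr q * y powr (q - 1)" if "y > 0" for y
        using that x by (simp add: powr_mult powr_diff)
      show "(x * (\<tau> - 1)) powr q / (\<tau> - 1) \<le> (x * (t - 1)) powr q / (t - 1)"
        using \<tau> t q by (subst (1 2) e) (auto intro!: mult_left_mono powr_mono2)
    qed
    finally show ?thesis .
  qed
  have "young_0 n \<phi> t \<le> (\<integral>\<^sup>+\<tau>. ennreal ((x * (t - 1)) powr q / (t - 1)) * indicator {1..t} \<tau> \<partial>lborel)"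
    unfolding young_0_def using ratio by (intro nn_integral_mono) (auto simp: indicator_def)
  also have "\<dots> = ennreal ((x * (t - 1)) powr q / (t - 1)) * ennreal (t - 1)"
    using t by (subst nn_integral_cmult_indicator) auto
  also have "\<dots> = ennreal ((x * (t - 1)) powr q)"
    using t by (simp add: ennreal_mult[symmetric])
  also have "\<dots> = young_bar n \<phi> t"
    unfolding bar_t using x t by (simp add: ennreal_mult[symmetric] epowr_ennreal)
  finally show ?thesis .
qed simp

lemma young_0_mono: "s \<le> t \<Longrightarrow> young_0 n \<phi> s \<le> young_0 n \<phi> t"
  unfolding young_0_def by (intro nn_integral_mono) (auto simp: indicator_def)

lemma young_0_eq_0: "t \<le> 1 \<Longrightarrow> young_0 n \<phi> t = 0"
  unfolding young_0_def by (subst nn_integral_cong[where v="\<lambda>_. 0"]) (auto simp: indicator_def)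

text \<open>If \<phi>(r) \<le> A r held for all r \<ge> 1, the integrand of \<open>young_J\<close>
  would be at least (1/A)^(1/(n-1)) and \<open>young_J\<close> would grow linearly. This serves the
  case where the inverse is infinite and \<open>young_bar\<close> takes the value infinity.\<close>

lemma young_J_bounded_imp_superlinear:
  assumes n: "n \<ge> 2" and \<phi>: "young_function \<phi>" and \<phi>1: "\<phi> 1 > 0"
    and J: "\<And>r. 1 \<le> r \<Longrightarrow> young_J n \<phi> r \<le> ennreal B" and A: "A > 0"
  obtains r where "1 \<le> r" "ennreal (A * r) < \<phi> r"
proof (rule ccontr)
  assume "\<not> thesis"
  then have le: "\<phi> r \<le> ennreal (A * r)" if "1 \<le> r" for r
    using that \<open>\<And>r. \<lbrakk>1 \<le> r; ennreal (A * r) < \<phi> r\<rbrakk> \<Longrightarrow> thesis\<close> by (meson not_le)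
  define p where "p = 1 / (real n - 1)"
  have p: "p > 0" using n by (simp add: p_def)
  define \<epsilon> where "\<epsilon> = (1 / A) powr p"
  have \<epsilon>: "\<epsilon> > 0" using A by (simp add: \<epsilon>_def)
  have lower: "ennreal \<epsilon> \<le> epowr (ennreal \<tau> / \<phi> \<tau>) p" if \<tau>: "1 \<le> \<tau>" for \<tau>
  proof -
    have "0 < \<phi> \<tau>" using \<phi>1 young_mono[OF \<phi>, of 1 \<tau>] \<tau> by (auto intro: less_le_trans)
    then obtain f where f: "\<phi> \<tau> = ennreal f" "f > 0" "f \<le> A * \<tau>"
      using le[OF \<tau>] A \<tau> by (cases "\<phi> \<tau>") (auto simp: top_unique)
    have "(1 / A) powr p \<le> (\<tau> / f) powr p"
      using f A \<tau> p by (intro powr_mono2) (auto simp: field_simps)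
    then show ?thesis using f \<tau> by (simp add: \<epsilon>_def divide_ennreal epowr_ennreal ennreal_leI)
  qed
  define r where "r = 1 + (\<bar>B\<bar> + 1) / \<epsilon>"
  have r: "1 \<le> r" using \<epsilon> by (simp add: r_def)
  have "ennreal (\<bar>B\<bar> + 1) = ennreal \<epsilon> * ennreal (r - 1)"
    using \<epsilon> by (simp add: r_def ennreal_mult[symmetric])
  also have "\<dots> = (\<integral>\<^sup>+\<tau>. ennreal \<epsilon> * indicator {1..r} \<tau> \<partial>lborel)"
    using r by (subst nn_integral_cmult_indicator) auto
  also have "\<dots> \<le> young_J n \<phi> r"
    unfolding young_J_def p_def[symmetric] using lower by (intro nn_integral_mono) (auto simp: indicator_def)
  also have "\<dots> \<le> ennreal B" by (rule J[OF r])
  finally have "ennreal (\<bar>B\<bar> + 1) \<le> ennreal B" .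
  moreover have "ennreal B < ennreal (\<bar>B\<bar> + 1)" by (intro ennreal_lessI) auto
  ultimately show False by simp
qed

subsection \<open>Decay of the superlevel sets\<close>

text \<open>For h > r it suffices that h - r \<le> h and \<phi>(r)/r \<le> \<phi>(h)/h.\<close>

lemma young_excess_le:
  assumes \<phi>: "young_function \<phi>" and "0 \<le> h" "0 < r"
  shows "ennreal (max 0 (h - r)) * \<phi> r \<le> ennreal r * \<phi> h"
proof (cases "h \<le> r")
  case False
  have "ennreal (max 0 (h - r)) * \<phi> r \<le> ennreal h * \<phi> r"
    using assms by (intro mult_right_mono ennreal_leI) auto
  also have "\<dots> \<le> ennreal h * (ennreal (r / h) * \<phi> h)"
    using False assms by (intro mult_left_mono young_scale[OF \<phi>]) auto
  also have "\<dots> = (ennreal h * ennreal (r / h)) * \<phi> h" by (simp only: mult.assoc)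
  also have "ennreal h * ennreal (r / h) = ennreal r"
    using False assms by (simp add: ennreal_mult[symmetric])
  finally show ?thesis .
qed simp

abbreviation crossing_const :: "nat \<Rightarrow> real" where
  "crossing_const n \<equiv> 2 / (real n * unit_ball_vol (real n))"

context borel_weak_gradient
begin

text \<open>Splitting the gradient at height \<open>r\<close> in the crossing estimate leaves two
  terms. The low part contributes at most 3 C s M |S|, which by \<open>gap\<close> is at most half
  of the left side and is absorbed. The excess, with integral X, contributes at most C \<rho> X,
  where \<rho> is the n-th root of |S|. Division by \<rho> gives (b - a) \<rho>^(n-1) \<le> 2 C X,
  and X \<phi>(r) is at most r times the energy.\<close>

lemma shell_decay:
  fixes \<phi> :: "real \<Rightarrow> ennreal"
  defines "n \<equiv> CARD('n)"
  defines "C \<equiv> crossing_const n * riesz_const n"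
  assumes n: "n \<ge> 2" and \<phi>: "young_function \<phi>" and \<phi>1: "\<phi> 1 > 0"
    and ab: "0 \<le> a" "a < b" and M: "M > 0"
    and supp: "emeasure lborel {z. a < \<bar>U z\<bar>} \<le> ennreal (M ^ n)"
    and energy: "(\<integral>\<^sup>+z. \<phi> (shell_gradient a b z) \<partial>lborel) \<le> ennreal (M ^ n)"
    and r: "r \<ge> 1" and s: "s \<ge> 1"
    and J: "young_J n \<phi> r \<le> ennreal (s powr (real n / (real n - 1)))"
    and gap: "6 * C * s * M \<le> b - a"
    and \<rho>: "\<rho> > 0" "emeasure lborel {z. b \<le> \<bar>U z\<bar>} = ennreal (\<rho> ^ n)"
  shows "ennreal ((b - a) * \<rho> ^ (n - 1)) * \<phi> r \<le> ennreal (2 * C * r) * (\<integral>\<^sup>+z. \<phi> (shell_gradient a b z) \<partial>lborel)"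
proof -
  define H where "H = shell_gradient a b"
  have H0: "0 \<le> H z" for z by (simp add: H_def shell_gradient_def)
  have H[measurable]: "H \<in> borel_measurable borel" unfolding H_def by measurable
  define C0 where "C0 = crossing_const n"
  define K where "K = riesz_const n"
  have C0: "C0 > 0" using n by (simp add: C0_def)
  have K: "K > 0" unfolding K_def by (intro add_nonneg_pos mult_nonneg_nonneg) auto
  have CC: "C = C0 * K" by (simp add: C_def C0_def K_def)
  define S where "S = {z. b \<le> \<bar>U z\<bar>}"
  have [measurable]: "S \<in> sets borel" unfolding S_def by measurable
  define k where "k = (\<lambda>x z :: real ^ 'n. ennreal (1 / norm (x - z) ^ (n - 1)))"
  have [measurable]: "(\<lambda>(x, z). k x z) \<in> borel_measurable (borel \<Otimes>\<^sub>M borel)"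
    unfolding k_def by measurable
  define X where "X = (\<integral>\<^sup>+z. ennreal (max 0 (H z - r)) \<partial>lborel)"
  define En where "En = (\<integral>\<^sup>+z. \<phi> (H z) \<partial>lborel)"
  have En_fin: "En < \<infinity>" using energy by (auto simp: En_def H_def less_top[symmetric] top_unique)
  have \<phi>r: "\<phi> r > 0" using \<phi>1 young_mono[OF \<phi>, of 1 r] r by (auto intro: less_le_trans)
  have X_phi: "X * \<phi> r \<le> ennreal r * En"
  proof -
    have "X * \<phi> r = (\<integral>\<^sup>+z. ennreal (max 0 (H z - r)) * \<phi> r \<partial>lborel)"
      unfolding X_def by (rule nn_integral_multc[symmetric]) measurable
    also have "\<dots> \<le> (\<integral>\<^sup>+z. ennreal r * \<phi> (H z) \<partial>lborel)"
      using r by (intro nn_integral_mono young_excess_le[OF \<phi> H0]) auto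
    also have "\<dots> = ennreal r * En"
      unfolding En_def using young_compose_borel[OF \<phi> H H0] by (intro nn_integral_cmult) auto
    finally show ?thesis .
  qed
  \<comment> \<open>Finiteness of \<open>X\<close> is what permits the absorption to be done with
    real numbers; it follows because \<phi>(r) > 0, also when \<phi>(r) is infinite.\<close>
  have "X * \<phi> r < \<infinity>"
    by (rule le_less_trans[OF X_phi]) (use En_fin in \<open>simp add: ennreal_mult_less_top\<close>)
  then have "X < \<infinity>" using \<phi>r by (auto simp: ennreal_mult_less_top)
  then obtain x where x: "X = ennreal x" "0 \<le> x" by (cases X) auto
  have supp_H: "emeasure lborel {z. 0 < H z} \<le> ennreal (M ^ n)"
  proof -
    have "emeasure lborel {z. 0 < H z} \<le> emeasure lborel {z. a < \<bar>U z\<bar>}"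
      by (intro emeasure_mono) (auto simp: H_def shell_gradient_def indicator_def split: if_splits)
    then show ?thesis using supp by (rule order_trans)
  qed
  have low: "(\<integral>\<^sup>+z. ennreal (min (H z) r) * k y z \<partial>lborel) \<le> ennreal (3 * K * s * M)" for y
    using riesz_potential_low_part[of \<phi> H M r s y] n \<phi> \<phi>1 H0 M supp_H energy r s J
    by (simp add: n_def k_def K_def young_J_def H_def)
  have split: "ennreal (H z) = ennreal (min (H z) r) + ennreal (max 0 (H z - r))" for z
  proof -
    have "H z = min (H z) r + max 0 (H z - r)" by auto
    also have "ennreal \<dots> = ennreal (min (H z) r) + ennreal (max 0 (H z - r))"
      using H0[of z] r by (intro ennreal_plus) auto
    finally show ?thesis .
  qed
  have "ennreal (b - a) * emeasure lborel S \<le> ennreal C0 * (\<integral>\<^sup>+y. indicator S y * (\<integral>\<^sup>+z. ennreal (H z) * k y z \<partial>lborel) \<partial>lborel)"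
    unfolding C0_def n_def H_def k_def
  proof (rule superlevel_gap_le_riesz[OF ab(2)])
    show "emeasure lborel {z. a < \<bar>U z\<bar>} < \<infinity>"
      using supp by (auto simp: less_top[symmetric] top_unique)
  qed (auto simp: S_def)
  also have "(\<integral>\<^sup>+y. indicator S y * (\<integral>\<^sup>+z. ennreal (H z) * k y z \<partial>lborel) \<partial>lborel)
    = (\<integral>\<^sup>+y. indicator S y * (\<integral>\<^sup>+z. ennreal (min (H z) r) * k y z \<partial>lborel) + indicator S y * (\<integral>\<^sup>+z. ennreal (max 0 (H z - r)) * k y z \<partial>lborel) \<partial>lborel)"
    by (subst split) (simp add: distrib_right nn_integral_add distrib_left)
  also have "\<dots> = (\<integral>\<^sup>+y. indicator S y * (\<integral>\<^sup>+z. ennreal (min (H z) r) * k y z \<partial>lborel) \<partial>lborel)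
      + (\<integral>\<^sup>+y. indicator S y * (\<integral>\<^sup>+z. ennreal (max 0 (H z - r)) * k y z \<partial>lborel) \<partial>lborel)"
    by (rule nn_integral_add) measurable
  also have "\<dots> \<le> ennreal (3 * K * s * M) * ennreal (\<rho> ^ n) + ennreal (K * \<rho>) * ennreal x"
  proof (rule add_mono)
    have "(\<integral>\<^sup>+y. indicator S y * (\<integral>\<^sup>+z. ennreal (min (H z) r) * k y z \<partial>lborel) \<partial>lborel)
        \<le> (\<integral>\<^sup>+y. ennreal (3 * K * s * M) * indicator S y \<partial>lborel)"
      by (intro nn_integral_mono) (auto simp: indicator_def low)
    also have "\<dots> = ennreal (3 * K * s * M) * ennreal (\<rho> ^ n)"
      using \<rho>(2) by (simp add: nn_integral_cmult_indicator S_def)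
    finally show "(\<integral>\<^sup>+y. indicator S y * (\<integral>\<^sup>+z. ennreal (min (H z) r) * k y z \<partial>lborel) \<partial>lborel)
        \<le> ennreal (3 * K * s * M) * ennreal (\<rho> ^ n)" .
    \<comment> \<open>The kernel is symmetric, so Fubini moves the potential onto the indicator of
      \<open>S\<close>, where it is bounded by K \<rho> uniformly in \<open>z\<close>.\<close>
    have "(\<integral>\<^sup>+y. indicator S y * (\<integral>\<^sup>+z. ennreal (max 0 (H z - r)) * k y z \<partial>lborel) \<partial>lborel)
        = (\<integral>\<^sup>+y. (\<integral>\<^sup>+z. indicator S y * (ennreal (max 0 (H z - r)) * k y z) \<partial>lborel) \<partial>lborel)"
      by (subst nn_integral_cmult[symmetric]) auto
    also have "\<dots> = (\<integral>\<^sup>+z. (\<integral>\<^sup>+y. indicator S y * (ennreal (max 0 (H z - r)) * k y z) \<partial>lborel) \<partial>lborel)"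
      by (rule lborel_pair.Fubini') measurable
    also have "\<dots> = (\<integral>\<^sup>+z. (\<integral>\<^sup>+y. ennreal (max 0 (H z - r)) * (indicator S y * k z y) \<partial>lborel) \<partial>lborel)"
      by (simp add: k_def norm_minus_commute mult.left_commute)
    also have "\<dots> = (\<integral>\<^sup>+z. ennreal (max 0 (H z - r)) * (\<integral>\<^sup>+y. indicator S y * k z y \<partial>lborel) \<partial>lborel)"
      by (intro nn_integral_cong nn_integral_cmult) measurable
    also have "\<dots> \<le> (\<integral>\<^sup>+z. ennreal (max 0 (H z - r)) * ennreal (K * \<rho>) \<partial>lborel)"
    proof (intro nn_integral_mono mult_left_mono)
      fix z :: "real ^ 'n"
      show "(\<integral>\<^sup>+y. indicator S y * k z y \<partial>lborel) \<le> ennreal (K * \<rho>)"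
        using riesz_kernel_integral_le[of S \<rho> z] \<rho> by (simp add: K_def k_def n_def S_def)
    qed simp
    also have "\<dots> = ennreal (K * \<rho>) * ennreal x"
      unfolding x(1)[symmetric] X_def by (subst nn_integral_multc) (auto simp: mult.commute)
    finally show "(\<integral>\<^sup>+y. indicator S y * (\<integral>\<^sup>+z. ennreal (max 0 (H z - r)) * k y z \<partial>lborel) \<partial>lborel) \<le> ennreal (K * \<rho>) * ennreal x" .
  qed
  also have "emeasure lborel S = ennreal (\<rho> ^ n)" using \<rho>(2) by (simp add: S_def)
  finally have "ennreal ((b - a) * \<rho> ^ n) \<le> ennreal (C0 * (3 * K * s * M * \<rho> ^ n + K * \<rho> * x))"
    using ab C0 K s M \<rho>(1) x(2) by (simp add: mult_left_mono ennreal_mult[symmetric] ennreal_plus[symmetric] del: ennreal_plus)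
  then have real_le: "(b - a) * \<rho> ^ n \<le> C0 * (3 * K * s * M * \<rho> ^ n + K * \<rho> * x)"
    using C0 K s M \<rho>(1) x(2) by (subst (asm) ennreal_le_iff) auto
  have "(b - a) * \<rho> ^ (n - 1) \<le> 2 * C * x"
  proof -
    have "6 * C * s * M * \<rho> ^ n \<le> (b - a) * \<rho> ^ n"
      using gap \<rho>(1) by (intro mult_right_mono) auto
    then have "(b - a) * \<rho> ^ n \<le> 2 * C * x * \<rho>"
      using real_le unfolding CC by (simp add: algebra_simps)
    moreover have "\<rho> ^ n = \<rho> ^ (n - 1) * \<rho>" using n by (simp add: power_eq_if)
    ultimately have "((b - a) * \<rho> ^ (n - 1)) * \<rho> \<le> (2 * C * x) * \<rho>" by (simp add: mult.assoc)
    then show ?thesis using \<rho>(1) by simp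
  qed
  then have "ennreal ((b - a) * \<rho> ^ (n - 1)) * \<phi> r \<le> ennreal (2 * C * x) * \<phi> r"
    by (intro mult_right_mono ennreal_leI) auto
  also have "\<dots> = ennreal (2 * C) * (X * \<phi> r)"
    using C0 K x by (simp add: CC ennreal_mult mult.assoc)
  also have "\<dots> \<le> ennreal (2 * C) * (ennreal r * En)"
    by (intro mult_left_mono X_phi) auto
  also have "\<dots> = ennreal (2 * C * r) * En"
    using C0 K r by (simp add: CC ennreal_mult mult.assoc)
  finally show ?thesis by (simp add: En_def H_def)
qed

text \<open>Put r = k, the inverse at \<open>s\<close>, in the decay estimate. The factor M in the
  gap b/2 = 6 C (s + 1) M yields (\<phi>(k)/k) s \<rho>^(n-1) \<le> e/M. Raised to the power q =
  n/(n-1), the left side becomes \<open>young_bar\<close> at s + 1 times \<rho>^n, since (n - 1) q =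
  n, and the right side is at most e.\<close>

lemma young_bar_superlevel_le:
  fixes \<phi> :: "real \<Rightarrow> ennreal"
  defines "n \<equiv> CARD('n)"
  defines "C \<equiv> crossing_const n * riesz_const n"
  assumes n: "n \<ge> 2" and \<phi>: "young_function \<phi>" and \<phi>1: "\<phi> 1 > 0" and M: "M > 0" and s: "s \<ge> 1"
    and b: "b = 12 * C * (s + 1) * M"
    and supp: "emeasure lborel {z. b / 2 < \<bar>U z\<bar>} \<le> ennreal (M ^ n)"
    and energy: "(\<integral>\<^sup>+z. \<phi> (shell_gradient (b / 2) b z) \<partial>lborel) \<le> ennreal (M ^ n)"
  shows "young_bar n \<phi> (s + 1) * emeasure lborel {z. b \<le> \<bar>U z\<bar>} \<le> (\<integral>\<^sup>+z. \<phi> (shell_gradient (b / 2) b z) \<partial>lborel)"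
proof -
  define q where "q = real n / (real n - 1)"
  have q: "q > 0" using n by (simp add: q_def)
  have C: "C > 0" unfolding C_def using n by (intro mult_pos_pos add_nonneg_pos mult_nonneg_nonneg) auto
  have b0: "b > 0" using b C s M by simp
  obtain e where e: "(\<integral>\<^sup>+z. \<phi> (shell_gradient (b / 2) b z) \<partial>lborel) = ennreal e" "0 \<le> e"
    using energy by (cases "\<integral>\<^sup>+z. \<phi> (shell_gradient (b / 2) b z) \<partial>lborel") (auto simp: top_unique)
  have e_le: "e \<le> M ^ n" using energy e M by (simp add: ennreal_le_iff)
  have "emeasure lborel {z. b \<le> \<bar>U z\<bar>} \<le> emeasure lborel {z. b / 2 < \<bar>U z\<bar>}"
    using b0 by (intro emeasure_mono) auto
  also note supp
  finally obtain m where m: "emeasure lborel {z. b \<le> \<bar>U z\<bar>} = ennreal m" "0 \<le> m"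
    by (cases "emeasure lborel {z. b \<le> \<bar>U z\<bar>}") (auto simp: top_unique)
  show ?thesis
  proof (cases "m = 0")
    case True
    then show ?thesis using m by simp
  next
    case False
    define \<rho> where "\<rho> = root n m"
    have \<rho>: "\<rho> > 0" "m = \<rho> ^ n" using False m n by (auto simp: \<rho>_def)
    have gap: "6 * C * s * M \<le> b - b / 2"
      using C M s by (simp add: b algebra_simps)
    have decay: "ennreal (b / 2 * \<rho> ^ (n - 1)) * \<phi> r \<le> ennreal (2 * C * r) * ennreal e"
      if "r \<ge> 1" "young_J n \<phi> r \<le> ennreal (s powr q)" for r
      using shell_decay[of \<phi> "b / 2" b M r s \<rho>] n \<phi> \<phi>1 b0 M supp energy that s gap \<rho> m e
      by (simp add: n_def C_def q_def)
    show ?thesis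
    proof (cases "young_K_inv n \<phi> s = \<infinity>")
      case True
      \<comment> \<open>Here \<open>young_bar\<close> is infinite, so a superlevel set of positive
        measure has to be refuted. For r with \<phi>(r) > A r the decay estimate fails: its left
        side is at least 2 C r e + (b/2) \<rho>^(n-1) r, and its right side is 2 C r e.\<close>
      define A where "A = 4 * C * e / (b * \<rho> ^ (n - 1)) + 1"
      have A: "A > 0" using C e b0 \<rho> by (simp add: A_def add_nonneg_pos)
      have J: "young_J n \<phi> r \<le> ennreal (s powr q)" if "1 \<le> r" for r
        using young_K_inv_infinite[OF n _ True that] s by (simp add: q_def)
      obtain r where r: "1 \<le> r" "ennreal (A * r) < \<phi> r"
        using young_J_bounded_imp_superlinear[OF n \<phi> \<phi>1 J A] by blast
      have "ennreal (b / 2 * \<rho> ^ (n - 1)) * ennreal (A * r) \<le> ennreal (b / 2 * \<rho> ^ (n - 1)) * \<phi> r"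
        using r by (intro mult_left_mono) auto
      also note decay[OF r(1) J[OF r(1)]]
      finally have "ennreal (b / 2 * \<rho> ^ (n - 1) * (A * r)) \<le> ennreal (2 * C * r * e)"
        using b0 \<rho> A r C e by (simp add: ennreal_mult[symmetric])
      then have "b / 2 * \<rho> ^ (n - 1) * (A * r) \<le> 2 * C * r * e"
        using C r e by (simp add: ennreal_le_iff)
      moreover have "b / 2 * \<rho> ^ (n - 1) * (A * r) = 2 * C * r * e + b / 2 * \<rho> ^ (n - 1) * r"
      proof -
        define w where "w = b * \<rho> ^ (n - 1)"
        have "w \<noteq> 0" using b0 \<rho> by (simp add: w_def)
        then have "w / 2 * ((4 * C * e / w + 1) * r) = 2 * C * r * e + w / 2 * r"
          by (simp add: field_simps)
        then show ?thesis by (simp add: A_def w_def)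
      qed
      moreover have "b / 2 * \<rho> ^ (n - 1) * r > 0" using b0 \<rho> r by simp
      ultimately show ?thesis by linarith
    next
      case False
      obtain k where k: "1 \<le> k" "young_K_inv n \<phi> s = ennreal k" "young_J n \<phi> k \<le> ennreal (s powr q)"
        using young_K_inv_finite[OF n \<phi> \<phi>1 _ False] s unfolding q_def by auto
      note dk = decay[OF k(1,3)]
      have "\<phi> k \<noteq> \<infinity>"
      proof
        assume "\<phi> k = \<infinity>"
        moreover have "ennreal w * \<infinity> = \<infinity>" if "w > 0" for w
          using that by (simp add: ennreal_mult_eq_top_iff)
        moreover have "b / 2 * \<rho> ^ (n - 1) > 0" using b0 \<rho> by simp
        ultimately have "ennreal (b / 2 * \<rho> ^ (n - 1)) * \<phi> k = \<infinity>"
          by metis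
        then show False using dk by (simp add: top_unique ennreal_mult_eq_top_iff)
      qed
      then obtain f where f: "\<phi> k = ennreal f" "0 \<le> f" by (cases "\<phi> k") auto
      have "ennreal (b / 2 * \<rho> ^ (n - 1) * f) \<le> ennreal (2 * C * k * e)"
        using dk f b0 \<rho> C k e by (simp add: ennreal_mult[symmetric])
      then have "b / 2 * \<rho> ^ (n - 1) * f \<le> 2 * C * k * e"
        using C k e by (simp add: ennreal_le_iff)
      then have "C * (3 * (s + 1) * M * \<rho> ^ (n - 1) * f) \<le> C * (k * e)"
        unfolding b by (simp add: algebra_simps)
      then have le: "3 * (s + 1) * M * \<rho> ^ (n - 1) * f \<le> k * e"
        using C by simp
      have "f / k * s * \<rho> ^ (n - 1) \<le> e / M"
      proof -
        have "s * (M * \<rho> ^ (n - 1) * f) \<le> (3 * (s + 1)) * (M * \<rho> ^ (n - 1) * f)"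
          using s M \<rho> f by (intro mult_right_mono) auto
        also have "\<dots> \<le> k * e" using le by (simp add: mult.assoc)
        finally show ?thesis using k M by (simp add: field_simps)
      qed
      then have "(f / k * s * \<rho> ^ (n - 1)) powr q \<le> (e / M) powr q"
        using f k s \<rho> q by (intro powr_mono2) auto
      \<comment> \<open>As q = 1 + 1/(n-1), the power e^q is e times e^(1/(n-1)), and e \<le> M^n
        bounds the second factor by M^q.\<close>
      also have "\<dots> \<le> e"
      proof (cases "e = 0")
        case False
        have "q = 1 + 1 / (real n - 1)" using n by (simp add: q_def field_simps)
        then have "e powr q = e * e powr (1 / (real n - 1))"
          using e False by (simp add: powr_add)
        also have "\<dots> \<le> e * (M ^ n) powr (1 / (real n - 1))"
          using e e_le n by (intro mult_left_mono powr_mono2) auto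
        also have "(M ^ n) powr (1 / (real n - 1)) = M powr q"
          using M by (simp add: powr_realpow[symmetric] powr_powr q_def)
        finally show ?thesis using M e by (simp add: powr_divide divide_le_eq)
      qed (use M in simp)
      also have "(f / k * s * \<rho> ^ (n - 1)) powr q = (f / k * s) powr q * \<rho> ^ n"
      proof -
        have "(\<rho> ^ (n - 1)) powr q = \<rho> powr (real (n - 1) * q)"
          using \<rho> by (simp add: powr_realpow[symmetric] powr_powr)
        also have "real (n - 1) * q = real n" using n by (simp add: q_def of_nat_diff)
        also have "\<rho> powr real n = \<rho> ^ n" using \<rho> by (simp add: powr_realpow)
        finally have "(\<rho> ^ (n - 1)) powr q = \<rho> ^ n" .
        moreover have "(f / k * s * \<rho> ^ (n - 1)) powr q = (f / k * s) powr q * (\<rho> ^ (n - 1)) powr q"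
          by (rule powr_mult)
        ultimately show ?thesis by simp
      qed
      finally have final: "(f / k * s) powr q * \<rho> ^ n \<le> e" .
      have "young_bar n \<phi> (s + 1) = epowr (\<phi> k / ennreal k * ennreal s) q"
        using s k by (simp add: young_bar_def q_def)
      also have "\<phi> k / ennreal k * ennreal s = ennreal (f / k * s)"
        using f k s by (simp add: divide_ennreal ennreal_mult[symmetric])
      also have "epowr (ennreal (f / k * s)) q = ennreal ((f / k * s) powr q)"
        using f k s by (simp add: epowr_ennreal)
      finally show ?thesis
        using final m e \<rho> by (simp add: ennreal_mult[symmetric] ennreal_leI)
    qed
  qed
qed

end

section \<open>Summation over the dyadic shells\<close>

context borel_weak_gradient
begin

text \<open>At most one of the open shells contains |U z|, and \<phi>(0) = 0 removes all other
  terms. Points exactly on a level belong to no shell, which is harmless for an upper bound.\<close>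

lemma suminf_shells_le:
  assumes \<phi>: "young_function \<phi>" and t: "t > 0"
  shows "(\<Sum>j. \<phi> (shell_gradient (2 ^ j * t / 2) (2 ^ j * t) z)) \<le> indicator {z. U z \<noteq> 0} z * \<phi> (norm (G z))"
proof (cases "\<exists>j. 2 ^ j * t / 2 < \<bar>U z\<bar> \<and> \<bar>U z\<bar> < 2 ^ j * t")
  case True
  then obtain j :: nat where j: "2 ^ j * t / 2 < \<bar>U z\<bar>" "\<bar>U z\<bar> < 2 ^ j * t" by blast
  have other: "shell_gradient (2 ^ i * t / 2) (2 ^ i * t) z = 0" if ij: "i \<noteq> j" for i
  proof -
    consider "i < j" | "j < i" using ij by linarith
    then have "\<not> (2 ^ i * t / 2 < \<bar>U z\<bar> \<and> \<bar>U z\<bar> < 2 ^ i * t)"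
    proof cases
      case 1
      then have "(2::real) ^ Suc i \<le> 2 ^ j" by (intro power_increasing) auto
      then have "2 ^ i * t \<le> 2 ^ j * t / 2" using t by simp
      then show ?thesis using j by linarith
    next
      case 2
      then have "(2::real) ^ Suc j \<le> 2 ^ i" by (intro power_increasing) auto
      then have "2 ^ j * t \<le> 2 ^ i * t / 2" using t by simp
      then show ?thesis using j by linarith
    qed
    then show ?thesis by (auto simp: shell_gradient_def)
  qed
  have "(\<Sum>i. \<phi> (shell_gradient (2 ^ i * t / 2) (2 ^ i * t) z)) = (\<Sum>i\<in>{j}. \<phi> (shell_gradient (2 ^ i * t / 2) (2 ^ i * t) z))"
    using other \<phi> by (intro suminf_finite) (auto simp: young_function_def)
  moreover have "0 < 2 ^ j * t" using t by simp
  ultimately show ?thesis using j by (auto simp: shell_gradient_def)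
next
  case False
  then have "shell_gradient (2 ^ j * t / 2) (2 ^ j * t) z = 0" for j
    unfolding shell_gradient_def by auto
  then show ?thesis using \<phi> by (simp add: young_function_def)
qed

text \<open>With t = M/c the inequality 2^j t \<le> |U| says 2^j \<le> c |U| / M. The integrand is
  therefore dominated by the term of the sum whose dyadic interval contains c |U| / M, and enlarging
  this to the sum over all superlevel sets still leaves each term bounded by the energy of its own
  shell.\<close>

lemma young_0_modular_le:
  fixes \<phi> :: "real \<Rightarrow> ennreal"
  defines "n \<equiv> CARD('n)"
  defines "c \<equiv> 1 / (24 * (crossing_const n * riesz_const n))"
  assumes n: "n \<ge> 2" and \<phi>: "young_function \<phi>" and \<phi>1: "\<phi> 1 > 0" and M: "M > 0"
    and supp: "emeasure lborel {z. U z \<noteq> 0} \<le> ennreal (M ^ n)"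
    and energy: "(\<integral>\<^sup>+z. indicator {z. U z \<noteq> 0} z * \<phi> (norm (G z)) \<partial>lborel) \<le> ennreal (M ^ n)"
  shows "(\<integral>\<^sup>+z. young_0 n \<phi> (c * \<bar>U z\<bar> / M) \<partial>lborel) \<le> (\<integral>\<^sup>+z. indicator {z. U z \<noteq> 0} z * \<phi> (norm (G z)) \<partial>lborel)"
proof -
  define C where "C = crossing_const n * riesz_const n"
  have C: "C > 0" unfolding C_def using n by (intro mult_pos_pos add_nonneg_pos mult_nonneg_nonneg) auto
  define t where "t = 24 * C * M"
  have t: "t > 0" using C M by (simp add: t_def)
  have c_eq: "c = 1 / (24 * C)" by (simp only: c_def C_def)
  have ct: "c * t = M" using C by (simp add: c_eq t_def)
  have c: "c > 0" using C by (simp add: c_eq)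
  let ?E = "\<lambda>j::nat. \<integral>\<^sup>+z. \<phi> (shell_gradient (2 ^ j * t / 2) (2 ^ j * t) z) \<partial>lborel"
  have meas: "(\<lambda>z. \<phi> (shell_gradient (2 ^ j * t / 2) (2 ^ j * t) z)) \<in> borel_measurable lborel" for j :: nat
    by (rule young_compose_borel[OF \<phi>]) (auto simp: shell_gradient_def)
  have sum_le: "(\<Sum>j. ?E j) \<le> (\<integral>\<^sup>+z. indicator {z. U z \<noteq> 0} z * \<phi> (norm (G z)) \<partial>lborel)"
  proof -
    have "(\<Sum>j. ?E j) = (\<integral>\<^sup>+z. (\<Sum>j. \<phi> (shell_gradient (2 ^ j * t / 2) (2 ^ j * t) z)) \<partial>lborel)"
      by (rule nn_integral_suminf[symmetric]) (rule meas)
    also have "\<dots> \<le> (\<integral>\<^sup>+z. indicator {z. U z \<noteq> 0} z * \<phi> (norm (G z)) \<partial>lborel)"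
      by (intro nn_integral_mono suminf_shells_le[OF \<phi> t])
    finally show ?thesis .
  qed
  have E_le: "?E j \<le> ennreal (M ^ n)" for j
  proof -
    have "?E j = (\<Sum>i\<in>{j}. ?E i)" by simp
    also have "\<dots> \<le> (\<Sum>j. ?E j)" by (intro sum_le_suminf) auto
    finally show ?thesis using sum_le energy by (meson order_trans)
  qed
  have term_le: "young_bar n \<phi> (2 ^ (j + 1)) * emeasure lborel {z. 2 ^ j * t \<le> \<bar>U z\<bar>} \<le> ?E j" for j :: nat
  proof -
    \<comment> \<open>The decay lemma is applied with s = 2^(j+1) - 1: then s + 1 is the argument of
      \<open>young_bar\<close>, and 12 C (s + 1) M is the level 2^j t.\<close>
    have 1: "(1::real) \<le> 2 ^ (j + 1) - 1" using one_le_power[of "2::real" j] by simp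
    have "emeasure lborel {z. 2 ^ j * t / 2 < \<bar>U z\<bar>} \<le> emeasure lborel {z. U z \<noteq> 0}"
    proof (intro emeasure_mono subsetI CollectI)
      fix z assume "z \<in> {z. 2 ^ j * t / 2 < \<bar>U z\<bar>}"
      moreover have "0 < 2 ^ j * t / 2" using t by simp
      ultimately show "U z \<noteq> 0" by auto
    qed measurable
    then have "emeasure lborel {z. 2 ^ j * t / 2 < \<bar>U z\<bar>} \<le> ennreal (M ^ n)"
      using supp by (rule order_trans)
    moreover have "2 ^ j * t = 12 * C * (2 ^ (j + 1) - 1 + 1) * M" by (simp add: t_def)
    ultimately show ?thesis
      using young_bar_superlevel_le[of \<phi> M "2 ^ (j + 1) - 1" "2 ^ j * t"] n \<phi> \<phi>1 M 1 E_le[of j]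
      by (simp add: n_def C_def)
  qed
  have pointwise: "young_0 n \<phi> (c * \<bar>U z\<bar> / M) \<le> (\<Sum>j. young_bar n \<phi> (2 ^ (j + 1)) * indicator {z. 2 ^ j * t \<le> \<bar>U z\<bar>} z)" for z
  proof (cases "c * \<bar>U z\<bar> / M \<le> 1")
    case False
    define w where "w = c * \<bar>U z\<bar> / M"
    have w: "1 < w" using False by (simp add: w_def)
    \<comment> \<open>Minimality of \<open>N\<close> gives 2^(N-1) \<le> w < 2^N; w > 1 excludes N =
      0.\<close>
    define N where "N = (LEAST N. w < 2 ^ N)"
    have N: "w < 2 ^ N" unfolding N_def
      by (rule LeastI_ex) (use real_arch_pow[of 2 w] in auto)
    have "N \<noteq> 0" using N w by (intro notI) simp
    then obtain j where j: "N = Suc j" using not0_implies_Suc by blast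
    have "\<not> w < 2 ^ j" unfolding N_def using j N_def not_less_Least[of j "\<lambda>N. w < 2 ^ N"] by simp
    then have wj: "2 ^ j \<le> w" by simp
    have "2 ^ j * (c * t) \<le> c * \<bar>U z\<bar>" using wj M unfolding ct w_def by (simp add: le_divide_eq)
    then have Uz: "2 ^ j * t \<le> \<bar>U z\<bar>" using c by (simp add: mult.left_commute)
    have "young_0 n \<phi> w \<le> young_0 n \<phi> (2 ^ (j + 1))"
      using N j by (intro young_0_mono) simp
    also have "\<dots> \<le> young_bar n \<phi> (2 ^ (j + 1))"
      by (rule young_0_le_young_bar[OF n \<phi>]) (rule one_less_power, auto)
    also have "\<dots> = (\<Sum>i\<in>{j}. young_bar n \<phi> (2 ^ (i + 1)) * indicator {z. 2 ^ i * t \<le> \<bar>U z\<bar>} z)"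
      using Uz by simp
    also have "\<dots> \<le> (\<Sum>j. young_bar n \<phi> (2 ^ (j + 1)) * indicator {z. 2 ^ j * t \<le> \<bar>U z\<bar>} z)"
      by (intro sum_le_suminf) auto
    finally show ?thesis by (simp add: w_def)
  qed (simp add: young_0_eq_0)
  have "(\<integral>\<^sup>+z. young_0 n \<phi> (c * \<bar>U z\<bar> / M) \<partial>lborel)
      \<le> (\<integral>\<^sup>+z. (\<Sum>j. young_bar n \<phi> (2 ^ (j + 1)) * indicator {z. 2 ^ j * t \<le> \<bar>U z\<bar>} z) \<partial>lborel)"
    by (intro nn_integral_mono pointwise)
  also have "\<dots> = (\<Sum>j. \<integral>\<^sup>+z. young_bar n \<phi> (2 ^ (j + 1)) * indicator {z. 2 ^ j * t \<le> \<bar>U z\<bar>} z \<partial>lborel)"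
    by (rule nn_integral_suminf) measurable
  also have "\<dots> = (\<Sum>j. young_bar n \<phi> (2 ^ (j + 1)) * emeasure lborel {z. 2 ^ j * t \<le> \<bar>U z\<bar>})"
    by (simp add: nn_integral_cmult_indicator)
  also have "\<dots> \<le> (\<Sum>j. ?E j)"
    by (intro suminf_le term_le) auto
  also note sum_le
  finally show ?thesis .
qed

end

subsection \<open>Borel representatives\<close>

lemma locally_integrable_on_imp_measurable:
  fixes f :: "real ^ 'n \<Rightarrow> 'b::euclidean_space"
  assumes "locally_integrable_on f UNIV"
  shows "f \<in> borel_measurable lebesgue"
proof (rule borel_measurable_LIMSEQ_metric)
  show "(\<lambda>x. indicator (cball 0 (real N)) x *\<^sub>R f x) \<in> borel_measurable lebesgue" for N
    using assms unfolding locally_integrable_on_def set_integrable_def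
    by (meson borel_measurable_integrable compact_cball subset_UNIV)
  show "(\<lambda>N. indicator (cball 0 (real N)) x *\<^sub>R f x) \<longlonglongrightarrow> f x" for x
  proof (rule tendsto_eventually)
    obtain N0 :: nat where "norm x \<le> real N0" using real_arch_simple by blast
    then show "\<forall>\<^sub>F N in sequentially. indicator (cball 0 (real N)) x *\<^sub>R f x = f x"
      by (intro eventually_sequentiallyI[of N0]) (auto simp: indicator_def)
  qed
qed

lemma continuous_on_UNIV_lebesgue_measurable:
  fixes f :: "real ^ 'n \<Rightarrow> real"
  assumes "continuous_on UNIV f" shows "f \<in> borel_measurable lebesgue"
  using assms by (intro measurable_completion) (simp add: borel_measurable_continuous_onI)

lemma integrable_mult_test_function:
  fixes f :: "real ^ 'n \<Rightarrow> real"
  assumes f: "locally_integrable_on f \<Omega>" and \<psi>: "test_function \<Omega> \<psi>" and \<Omega>: "open \<Omega>"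
  shows "integrable (lebesgue_on \<Omega>) (\<lambda>x. f x * \<psi> x)"
proof -
  let ?S = "closure {x. \<psi> x \<noteq> 0}"
  have S: "compact ?S" "?S \<subseteq> \<Omega>" using \<psi> by (auto simp: test_function_def)
  have zero: "\<psi> x = 0" if "x \<notin> ?S" for x
    using that closure_subset[of "{x. \<psi> x \<noteq> 0}"] by auto
  have cont: "continuous_on UNIV \<psi>"
    using test_function_mono[OF \<psi>] by (intro test_function_continuous) auto
  have "bounded (\<psi> ` ?S)"
    using S(1) cont by (intro compact_imp_bounded compact_continuous_image) (auto intro: continuous_on_subset)
  then obtain C where C: "\<And>x. x \<in> ?S \<Longrightarrow> \<bar>\<psi> x\<bar> \<le> C" by (auto simp: bounded_iff)
  have int: "integrable lebesgue (\<lambda>x. indicator ?S x *\<^sub>R f x)"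
    using f S by (auto simp: locally_integrable_on_def set_integrable_def)
  have "integrable lebesgue (\<lambda>x. indicator ?S x *\<^sub>R f x * \<psi> x)"
  proof (rule Bochner_Integration.integrable_bound[OF integrable_mult_right[OF int, of C]])
    show "(\<lambda>x. indicator ?S x *\<^sub>R f x * \<psi> x) \<in> borel_measurable lebesgue"
      by (rule borel_measurable_times[OF borel_measurable_integrable[OF int]
            continuous_on_UNIV_lebesgue_measurable[OF cont]])
    show "AE x in lebesgue. norm (indicator ?S x *\<^sub>R f x * \<psi> x) \<le> norm (C * (indicator ?S x *\<^sub>R f x))"
    proof (rule AE_I2)
      fix x
      show "norm (indicator ?S x *\<^sub>R f x * \<psi> x) \<le> norm (C * (indicator ?S x *\<^sub>R f x))"
      proof (cases "x \<in> ?S")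
        case True
        then have "\<bar>f x\<bar> * \<bar>\<psi> x\<bar> \<le> \<bar>f x\<bar> * \<bar>C\<bar>"
          using C[OF True] by (intro mult_left_mono) auto
        then show ?thesis using True by (simp add: abs_mult mult.commute)
      qed simp
    qed
  qed
  also have "(\<lambda>x. indicator ?S x *\<^sub>R f x * \<psi> x) = (\<lambda>x. indicator \<Omega> x *\<^sub>R (f x * \<psi> x))"
  proof
    fix x
    show "indicator ?S x *\<^sub>R f x * \<psi> x = indicator \<Omega> x *\<^sub>R (f x * \<psi> x)"
      using zero[of x] S(2) by (cases "x \<in> ?S") (auto simp del: closure_approachable)
  qed
  finally show ?thesis
    using \<Omega> integrable_restrict_space[of \<Omega> lebesgue "\<lambda>x. f x * \<psi> x"] by simp
qed

text \<open>A test function on \<open>\<Omega>\<close> is one on the whole space, so on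
  \<open>\<Omega>\<close> both gradients have the same test integrals and the fundamental lemma
  applies to each component. This links the arbitrary \<open>g\<close> of the energy to the gradient
  of the extension.\<close>

lemma weak_gradient_extension_eq:
  fixes u :: "real ^ 'n \<Rightarrow> real"
  assumes \<Omega>: "open \<Omega>" and g: "weak_gradient \<Omega> u g"
    and h: "weak_gradient UNIV (\<lambda>x. if x \<in> \<Omega> then u x else 0) h"
  shows "AE x in lebesgue. x \<in> \<Omega> \<longrightarrow> g x = h x"
proof -
  have \<Omega>_sets: "\<Omega> \<in> sets lebesgue" using \<Omega> by auto
  have comp: "locally_integrable_on (\<lambda>x. k x $ i) \<Omega>" if "locally_integrable_on k \<Omega>" for k :: "real ^ 'n \<Rightarrow> real ^ 'n" and i
  proof -
    have "(\<lambda>x. k x \<bullet> axis i 1) absolutely_integrable_on C" if "k absolutely_integrable_on C" for C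
      using that by (rule absolutely_integrable_component)
    with that show ?thesis by (simp add: locally_integrable_on_def inner_axis)
  qed
  have h_loc: "locally_integrable_on h \<Omega>"
    using h by (simp add: weak_gradient_def locally_integrable_on_def)
  have g_loc: "locally_integrable_on g \<Omega>" using g by (simp add: weak_gradient_def)
  have "AE x in lebesgue. x \<in> \<Omega> \<longrightarrow> g x $ i - h x $ i = 0" for i
  proof (rule test_integrals_zero_imp_AE_zero[OF \<Omega>])
    show "locally_integrable_on (\<lambda>x. g x $ i - h x $ i) \<Omega>"
      using comp[OF g_loc, of i] comp[OF h_loc, of i]
      by (simp add: locally_integrable_on_def set_integral_diff(1))
    fix \<psi> assume \<psi>: "test_function \<Omega> \<psi>"
    have \<psi>': "test_function UNIV \<psi>" using test_function_mono[OF \<psi>] by simp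
    have "(\<integral>x. g x $ i * \<psi> x \<partial>lebesgue_on \<Omega>) = - (\<integral>x. u x * frechet_derivative \<psi> (at x) (axis i 1) \<partial>lebesgue_on \<Omega>)"
      using g \<psi> by (simp add: weak_gradient_def)
    also have "(\<integral>x. u x * frechet_derivative \<psi> (at x) (axis i 1) \<partial>lebesgue_on \<Omega>)
        = (\<integral>x. (if x \<in> \<Omega> then u x else 0) * frechet_derivative \<psi> (at x) (axis i 1) \<partial>lebesgue_on UNIV)"
    proof -
      have "(\<integral>x. u x * frechet_derivative \<psi> (at x) (axis i 1) \<partial>lebesgue_on \<Omega>)
          = (\<integral>x. u x * frechet_derivative \<psi> (at x) (axis i 1) \<partial>lebesgue)"
        using \<Omega>_sets test_function_derivative_zero_outside[OF \<psi>]
        by (intro integral_lebesgue_on_UNIV) auto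
      also have "\<dots> = (\<integral>x. (if x \<in> \<Omega> then u x else 0) * frechet_derivative \<psi> (at x) (axis i 1) \<partial>lebesgue)"
        using test_function_derivative_zero_outside[OF \<psi>]
        by (intro Bochner_Integration.integral_cong) auto
      also have "\<dots> = (\<integral>x. (if x \<in> \<Omega> then u x else 0) * frechet_derivative \<psi> (at x) (axis i 1) \<partial>lebesgue_on UNIV)"
        by (rule integral_lebesgue_on_UNIV[symmetric]) auto
      finally show ?thesis .
    qed
    also have "\<dots> = - (\<integral>x. h x $ i * \<psi> x \<partial>lebesgue_on UNIV)"
      using h \<psi>' by (simp add: weak_gradient_def)
    also have "(\<integral>x. h x $ i * \<psi> x \<partial>lebesgue_on UNIV) = (\<integral>x. h x $ i * \<psi> x \<partial>lebesgue)"
      by (rule integral_lebesgue_on_UNIV) auto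
    also have "\<dots> = (\<integral>x. h x $ i * \<psi> x \<partial>lebesgue_on \<Omega>)"
      using \<Omega>_sets test_function_zero_outside[OF \<psi>]
      by (intro integral_lebesgue_on_UNIV[symmetric]) auto
    finally have "(\<integral>x. g x $ i * \<psi> x \<partial>lebesgue_on \<Omega>) = (\<integral>x. h x $ i * \<psi> x \<partial>lebesgue_on \<Omega>)" by simp
    moreover have "(\<integral>x. (g x $ i - h x $ i) * \<psi> x \<partial>lebesgue_on \<Omega>)
        = (\<integral>x. g x $ i * \<psi> x \<partial>lebesgue_on \<Omega>) - (\<integral>x. h x $ i * \<psi> x \<partial>lebesgue_on \<Omega>)"
      using integrable_mult_test_function[OF comp[OF g_loc] \<psi> \<Omega>] integrable_mult_test_function[OF comp[OF h_loc] \<psi> \<Omega>]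
      by (simp add: left_diff_distrib)
    ultimately show "(\<integral>x. (g x $ i - h x $ i) * \<psi> x \<partial>lebesgue_on \<Omega>) = 0" by simp
  qed
  then have "AE x in lebesgue. \<forall>i\<in>UNIV. x \<in> \<Omega> \<longrightarrow> g x $ i - h x $ i = 0"
    by (intro AE_finite_allI) auto
  then show ?thesis by eventually_elim (auto simp: vec_eq_iff)
qed

lemma set_integrable_borel_representative:
  fixes f F :: "real ^ 'n \<Rightarrow> 'b::euclidean_space"
  assumes f: "locally_integrable_on f UNIV" and F: "F \<in> borel_measurable borel"
    and eq: "AE x in lebesgue. f x = F x"
  shows "set_integrable lborel (cbox a b) F"
proof -
  have "integrable lebesgue (\<lambda>x. indicator (cbox a b) x *\<^sub>R f x)"
    using f compact_cbox[of a b] by (simp add: locally_integrable_on_def set_integrable_def)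
  moreover have meas: "(\<lambda>x. indicator (cbox a b) x *\<^sub>R F x) \<in> borel_measurable lborel"
    using F by measurable
  ultimately have "integrable lebesgue (\<lambda>x. indicator (cbox a b) x *\<^sub>R F x)"
    using eq by (subst integrable_cong_AE[of _ _ "\<lambda>x. indicator (cbox a b) x *\<^sub>R f x"])
      (auto intro: measurable_completion borel_measurable_integrable elim!: eventually_mono)
  then show ?thesis
    using meas unfolding set_integrable_def by (subst (asm) integrable_completion) auto
qed

text \<open>Changing the functions on null sets leaves all test integrals unchanged. The gradient is
  replaced component by component and reassembled, since the choice of a Borel representative is
  made for real-valued functions.\<close>

lemma weak_gradient_borel_representative:
  fixes v :: "real ^ 'n \<Rightarrow> real"
  assumes wg: "weak_gradient UNIV v h"
  obtains U G where "borel_weak_gradient U G" "AE x in lebesgue. v x = U x" "AE x in lebesgue. h x = G x"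
proof -
  have v_loc: "locally_integrable_on v UNIV" and h_loc: "locally_integrable_on h UNIV"
    using wg by (auto simp: weak_gradient_def)
  have v_meas: "v \<in> borel_measurable lebesgue" and h_meas: "h \<in> borel_measurable lebesgue"
    using locally_integrable_on_imp_measurable v_loc h_loc by auto
  obtain U where U: "U \<in> borel_measurable lborel" "AE x in lborel. v x = U x"
    using completion_ex_borel_measurable_real[OF v_meas] by blast
  have "\<exists>w\<in>borel_measurable lborel. AE x in lborel. h x $ i = w x" for i
  proof (rule completion_ex_borel_measurable_real)
    have "(\<lambda>x. h x \<bullet> axis i 1) \<in> borel_measurable lebesgue" using h_meas by measurable
    then show "(\<lambda>x. h x $ i) \<in> borel_measurable lebesgue" by (simp add: inner_axis)
  qed
  then obtain w where w: "\<And>i. w i \<in> borel_measurable lborel" "\<And>i. AE x in lborel. h x $ i = w i x"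
    by metis
  define G where "G = (\<lambda>x. \<Sum>i\<in>UNIV. w i x *\<^sub>R (axis i 1 :: real ^ 'n))"
  have G_nth: "G x $ i = w i x" for x i
    by (simp add: G_def axis_def if_distrib cong: if_cong)
  have G_meas: "G \<in> borel_measurable borel"
    using w(1) unfolding G_def by (intro borel_measurable_sum borel_measurable_scaleR) auto
  have "AE x in lborel. \<forall>i\<in>UNIV. h x $ i = w i x"
    by (intro AE_finite_allI w(2)) auto
  then have G_eq: "AE x in lebesgue. h x = G x"
    by (intro AE_completion) (auto simp: vec_eq_iff G_nth elim!: eventually_mono)
  have U_eq: "AE x in lebesgue. v x = U x" using U(2) by (rule AE_completion)
  have U_meas: "U \<in> borel_measurable borel" using U(1) by simp
  have "borel_weak_gradient U G"
  proof
    show "set_integrable lborel (cbox a b) U" for a b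
      by (rule set_integrable_borel_representative[OF v_loc U_meas U_eq])
    show "set_integrable lborel (cbox a b) G" for a b
      by (rule set_integrable_borel_representative[OF h_loc G_meas G_eq])
    fix \<psi> :: "real ^ 'n \<Rightarrow> real" and i assume \<psi>: "test_function UNIV \<psi>"
    let ?D = "\<lambda>x. frechet_derivative \<psi> (at x) (axis i 1)"
    have D: "?D \<in> borel_measurable borel" and P: "\<psi> \<in> borel_measurable borel"
      using test_function_derivative_continuous[OF \<psi>] test_function_continuous[OF \<psi>]
      by (auto intro: borel_measurable_continuous_onI)
    have D': "?D \<in> borel_measurable lebesgue" and P': "\<psi> \<in> borel_measurable lebesgue"
      using D P by (auto intro: measurable_completion)
    have w': "w i \<in> borel_measurable borel" using w(1) by simp
    have "(\<integral>x. U x * ?D x \<partial>lborel) = (\<integral>x. U x * ?D x \<partial>lebesgue)"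
      using U_meas D by (intro integral_completion[symmetric]) auto
    also have "\<dots> = (\<integral>x. v x * ?D x \<partial>lebesgue)"
      using U_eq v_meas U_meas D'
      by (intro integral_cong_AE borel_measurable_times) (auto intro: measurable_completion elim!: eventually_mono)
    also have "\<dots> = - (\<integral>x. h x $ i * \<psi> x \<partial>lebesgue)"
    proof -
      have "(\<integral>x. v x * ?D x \<partial>lebesgue_on UNIV) = - (\<integral>x. h x $ i * \<psi> x \<partial>lebesgue_on UNIV)"
        using wg \<psi> unfolding weak_gradient_def by blast
      moreover have "(\<integral>x. f x \<partial>lebesgue_on UNIV) = (\<integral>x. f x \<partial>lebesgue)" for f :: "real ^ 'n \<Rightarrow> real"
        by (rule integral_lebesgue_on_UNIV) auto
      ultimately show ?thesis by (simp only:)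
    qed
    also have "(\<integral>x. h x $ i * \<psi> x \<partial>lebesgue) = (\<integral>x. w i x * \<psi> x \<partial>lebesgue)"
    proof (rule integral_cong_AE)
      have "(\<lambda>x. h x \<bullet> axis i 1) \<in> borel_measurable lebesgue" using h_meas by measurable
      then show "(\<lambda>x. h x $ i * \<psi> x) \<in> borel_measurable lebesgue"
        using P' by (intro borel_measurable_times) (auto simp: inner_axis)
      show "(\<lambda>x. w i x * \<psi> x) \<in> borel_measurable lebesgue"
        using P' w' by (intro borel_measurable_times) (auto intro: measurable_completion)
      show "AE x in lebesgue. h x $ i * \<psi> x = w i x * \<psi> x"
        using AE_completion[OF w(2)[of i]] by eventually_elim simp
    qed
    also have "\<dots> = (\<integral>x. G x $ i * \<psi> x \<partial>lborel)"
      using w' P by (subst integral_completion) (auto simp: G_nth)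
    finally show "(\<integral>x. U x * ?D x \<partial>lborel) = - (\<integral>x. G x $ i * \<psi> x \<partial>lborel)" .
  qed (use U_meas G_meas in auto)
  then show thesis using that U_eq G_eq by blast
qed

theorem theorem5p2:
  assumes "CARD('n::finite) \<ge> 2"
  shows "\<exists>c::real. c > 0 \<and>
    (\<forall>(\<Omega> :: (real ^ 'n) set) (\<phi> :: real \<Rightarrow> ennreal).
       open \<Omega> \<longrightarrow> emeasure lebesgue \<Omega> < \<infinity> \<longrightarrow> young_function \<phi> \<longrightarrow> \<phi> 1 > 0 \<longrightarrow>
       (\<forall>u \<in> orlicz_sobolev_0 \<phi> \<Omega>. \<forall>g. weak_gradient \<Omega> u g \<longrightarrow>
          (\<integral>\<^sup>+x. young_0 CARD('n) \<phi>
               (c * \<bar>u x\<bar> / (measure lebesgue \<Omega> + enn2real (young_energy \<phi> \<Omega> g))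
                             powr (1 / real CARD('n)))
             \<partial>lebesgue_on \<Omega>)
          \<le> young_energy \<phi> \<Omega> g))"
proof -
  define n where "n = CARD('n)"
  have n: "n \<ge> 2" using assms by (simp add: n_def)
  define c where "c = 1 / (24 * (crossing_const n * riesz_const n))"
  have c: "c > 0" unfolding c_def using n
    by (intro divide_pos_pos mult_pos_pos add_nonneg_pos mult_nonneg_nonneg) auto
  have main: "(\<integral>\<^sup>+x. young_0 n \<phi> (c * \<bar>u x\<bar> / (measure lebesgue \<Omega> + enn2real (young_energy \<phi> \<Omega> g)) powr (1 / real n)) \<partial>lebesgue_on \<Omega>)
      \<le> young_energy \<phi> \<Omega> g"
    if \<Omega>: "open \<Omega>" "emeasure lebesgue \<Omega> < \<infinity>" and \<phi>: "young_function \<phi>" "\<phi> 1 > 0"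
      and u: "u \<in> orlicz_sobolev_0 \<phi> \<Omega>" and g: "weak_gradient \<Omega> u g"
    for \<Omega> :: "(real ^ 'n) set" and \<phi> :: "real \<Rightarrow> ennreal" and u g
  proof (cases "young_energy \<phi> \<Omega> g = \<infinity> \<or> emeasure lebesgue \<Omega> = 0")
    case True
    then show ?thesis
    proof
      assume null: "emeasure lebesgue \<Omega> = 0"
      have "AE x in lebesgue_on \<Omega>. False"
        using \<Omega>(1) null by (subst AE_restrict_space_iff) (auto intro!: AE_I[of _ _ \<Omega>])
      then have "(\<integral>\<^sup>+x. young_0 n \<phi> (c * \<bar>u x\<bar> / (measure lebesgue \<Omega> + enn2real (young_energy \<phi> \<Omega> g)) powr (1 / real n)) \<partial>lebesgue_on \<Omega>)
          = (\<integral>\<^sup>+x. 0 \<partial>lebesgue_on \<Omega>)"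
        by (intro nn_integral_cong_AE) (auto elim: eventually_mono)
      then show ?thesis by simp
    qed simp
  next
    case False
    have \<Omega>_sets: "\<Omega> \<in> sets lebesgue" using \<Omega>(1) by auto
    obtain e where e: "young_energy \<phi> \<Omega> g = ennreal e" "0 \<le> e"
      using False by (cases "young_energy \<phi> \<Omega> g") auto
    have \<Omega>_meas: "emeasure lebesgue \<Omega> = ennreal (measure lebesgue \<Omega>)"
      using \<Omega>(2) by (simp add: emeasure_eq_ennreal_measure less_top)
    then have pos: "measure lebesgue \<Omega> > 0"
      using False by (metis ennreal_0 measure_nonneg order_le_less)
    \<comment> \<open>The case |\<Omega>| = 0 was separated so that \<open>M\<close> is positive
      even when the energy vanishes.\<close>
    define M where "M = (measure lebesgue \<Omega> + e) powr (1 / real n)"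
    have M: "M > 0" using pos e by (simp add: M_def)
    have M_pow: "M ^ n = measure lebesgue \<Omega> + e"
      using pos e n by (simp add: M_def powr_realpow[symmetric] powr_powr)
    obtain h where h: "weak_gradient UNIV (\<lambda>x. if x \<in> \<Omega> then u x else 0) h"
      using u unfolding orlicz_sobolev_0_def by blast
    obtain U G where UG: "borel_weak_gradient U G" "AE x in lebesgue. (if x \<in> \<Omega> then u x else 0) = U x"
        "AE x in lebesgue. h x = G x"
      using weak_gradient_borel_representative[OF h] by blast
    interpret borel_weak_gradient U G by (rule UG(1))
    have AE: "AE x in lebesgue. (x \<in> \<Omega> \<longrightarrow> u x = U x \<and> g x = G x) \<and> (x \<notin> \<Omega> \<longrightarrow> U x = 0)"
      using UG(2,3) weak_gradient_extension_eq[OF \<Omega>(1) g h] by eventually_elim auto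
    have E_le: "(\<integral>\<^sup>+z. indicator {z. U z \<noteq> 0} z * \<phi> (norm (G z)) \<partial>lborel) \<le> ennreal e"
    proof -
      have "(\<integral>\<^sup>+z. indicator {z. U z \<noteq> 0} z * \<phi> (norm (G z)) \<partial>lborel)
          = (\<integral>\<^sup>+z. indicator {z. U z \<noteq> 0} z * \<phi> (norm (G z)) \<partial>lebesgue)"
        by (simp add: nn_integral_completion)
      also have "\<dots> \<le> (\<integral>\<^sup>+x. \<phi> (norm (g x)) * indicator \<Omega> x \<partial>lebesgue)"
      proof (rule nn_integral_mono_AE)
        show "AE z in lebesgue. indicator {z. U z \<noteq> 0} z * \<phi> (norm (G z)) \<le> \<phi> (norm (g z)) * indicator \<Omega> z"
          using AE by eventually_elim (auto simp: indicator_def)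
      qed
      also have "\<dots> = young_energy \<phi> \<Omega> g"
        unfolding young_energy_def using \<Omega>_sets by (subst nn_integral_restrict_space) auto
      finally show ?thesis using e by simp
    qed
    have supp: "emeasure lborel {z. U z \<noteq> 0} \<le> ennreal (M ^ n)"
    proof -
      have "emeasure lborel {z. U z \<noteq> 0} = emeasure lebesgue {z. U z \<noteq> 0}" by simp
      also have "\<dots> \<le> emeasure lebesgue \<Omega>"
      proof (rule emeasure_mono_AE[OF _ \<Omega>_sets])
        show "AE z in lebesgue. z \<in> {z. U z \<noteq> 0} \<longrightarrow> z \<in> \<Omega>"
          using AE by eventually_elim auto
      qed
      also have "\<dots> \<le> ennreal (M ^ n)"
        unfolding \<Omega>_meas M_pow using e by (intro ennreal_leI) simp
      finally show ?thesis .
    qed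
    have energy: "(\<integral>\<^sup>+z. indicator {z. U z \<noteq> 0} z * \<phi> (norm (G z)) \<partial>lborel) \<le> ennreal (M ^ n)"
      using E_le unfolding M_pow by (rule order_trans) (intro ennreal_leI, simp)
    have "(\<integral>\<^sup>+x. young_0 n \<phi> (c * \<bar>u x\<bar> / M) \<partial>lebesgue_on \<Omega>)
        = (\<integral>\<^sup>+x. young_0 n \<phi> (c * \<bar>u x\<bar> / M) * indicator \<Omega> x \<partial>lebesgue)"
      using \<Omega>_sets by (subst nn_integral_restrict_space) auto
    also have "\<dots> \<le> (\<integral>\<^sup>+x. young_0 n \<phi> (c * \<bar>U x\<bar> / M) \<partial>lebesgue)"
    proof (rule nn_integral_mono_AE)
      show "AE x in lebesgue. young_0 n \<phi> (c * \<bar>u x\<bar> / M) * indicator \<Omega> x \<le> young_0 n \<phi> (c * \<bar>U x\<bar> / M)"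
        using AE by eventually_elim (auto simp: indicator_def)
    qed
    also have "\<dots> = (\<integral>\<^sup>+x. young_0 n \<phi> (c * \<bar>U x\<bar> / M) \<partial>lborel)"
      by (simp add: nn_integral_completion)
    also have "\<dots> \<le> (\<integral>\<^sup>+z. indicator {z. U z \<noteq> 0} z * \<phi> (norm (G z)) \<partial>lborel)"
      using young_0_modular_le[of \<phi> M] n \<phi> M supp energy unfolding n_def c_def by simp
    also note E_le
    finally show ?thesis using e by (simp add: M_def)
  qed
  show ?thesis
    using c main unfolding n_def by blast
qed

end
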